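(* The following lower bounds hold: $$c_3 \ge 1.792,\qquad c_4\ge 1.897,\qquad c_5\ge 1.953,$$ $$\tilde c_3\ge 1.743,\qquad \tilde c_4\ge 1.875,\qquad \tilde c_5\ge 1.940.$$
   Context: All graphs are finite and simple. For a graph $G$ of order $n$, $N(G)$ is the number of nonempty vertex subsets $V'\subseteq V(G)$ such that the induced subgraph $G[V']$ is connected, and $N_{dom}(G)$ is the number of such subsets $V'$ that are moreover dominating sets of $G$ (every vertex outside $V'$ has a neighbor in $V'$). Put $c(G)=N(G)^{1/n}$ and $\tilde c(G)=N_{dom}(G)^{1/n}$. For $n$ such that $d$-regular graphs of order $n$ exist, $c_d(n)=\max c(G)$ and $\tilde c_d(n)=\max \tilde c(G)$, both maxima being over all $d$-regular graphs $G$ of order $n$. Finally $c_d=\limsup_{n} c_d(n)$ and $\tilde c_d=\limsup_n \tilde c_d(n)$, where $n$ runs over the orders for which $d$-regular graphs exist. The bounds for $c_3$ and $c_4$ are tabulated as values "rounded up to 3 decimals"; all constants are given to three decimals. *)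

theory Defs
  imports Complex_Main "HOL-Library.Extended_Real" "Graph_Theory.Graph_Theory"
begin

(* Finite simple graphs are the locale pair_graph: finite loopless symmetric digraphs whose
   arcs are ordered pairs of vertices, so that each edge {u,v} is the two arcs (u,v), (v,u).
   The degree of a vertex is therefore its out-degree. *)

definition graph_order :: "'a pair_pre_digraph \<Rightarrow> nat" where
  "graph_order G = card (pverts G)"

definition regular_graph :: "nat \<Rightarrow> 'a pair_pre_digraph \<Rightarrow> bool" where
  "regular_graph d G \<longleftrightarrow> (\<forall>v \<in> pverts G. out_degree (with_proj G) v = d)"

(* The name "connected" is qualified because of the topological notion. The graph-theoretic
   one includes non-emptiness of the vertex set. *)

definition connected_sets :: "'a pair_pre_digraph \<Rightarrow> 'a set set" where
  "connected_sets G =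
     {S. S \<subseteq> pverts G \<and> S \<noteq> {} \<and> Digraph_Component.connected (with_proj G \<restriction> S)}"

definition dominating :: "'a pair_pre_digraph \<Rightarrow> 'a set \<Rightarrow> bool" where
  "dominating G S \<longleftrightarrow>
     S \<subseteq> pverts G \<and> (\<forall>v \<in> pverts G - S. \<exists>u \<in> S. v \<rightarrow>\<^bsub>with_proj G\<^esub> u)"

definition num_conn :: "'a pair_pre_digraph \<Rightarrow> nat" where
  "num_conn G = card (connected_sets G)"

definition num_conn_dom :: "'a pair_pre_digraph \<Rightarrow> nat" where
  "num_conn_dom G = card {S \<in> connected_sets G. dominating G S}"

definition conn_root :: "'a pair_pre_digraph \<Rightarrow> real" where
  "conn_root G = root (graph_order G) (real (num_conn G))"

definition conn_dom_root :: "'a pair_pre_digraph \<Rightarrow> real" where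
  "conn_dom_root G = root (graph_order G) (real (num_conn_dom G))"

(* Every finite graph is isomorphic to one with vertices in nat, so the maxima below range
   over all d-regular graphs of order n up to isomorphism. *)

definition regular_graphs :: "nat \<Rightarrow> nat \<Rightarrow> nat pair_pre_digraph set" where
  "regular_graphs d n = {G. pair_graph G \<and> graph_order G = n \<and> regular_graph d G}"

definition regular_orders :: "nat \<Rightarrow> nat set" where
  "regular_orders d = {n. n > 0 \<and> regular_graphs d n \<noteq> {}}"

definition c_max :: "nat \<Rightarrow> nat \<Rightarrow> real" where
  "c_max d n = Max (conn_root ` regular_graphs d n)"

definition c_dom_max :: "nat \<Rightarrow> nat \<Rightarrow> real" where
  "c_dom_max d n = Max (conn_dom_root ` regular_graphs d n)"

(* The set of graphs regular_graphs d n is infinite (the vertex labels are arbitrary), but only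
   finitely many values occur, so the maxima are attained for every n in regular_orders d. *)

lemma num_conn_le: "num_conn G \<le> 2 ^ graph_order G"
  and num_conn_dom_le: "num_conn_dom G \<le> 2 ^ graph_order G"
  if "pair_graph G"
proof -
  have fin: "finite (pverts G)"
    using that by (simp add: pair_graph_def pair_digraph_def pair_fin_digraph.pair_finite_verts)
  have sub: "connected_sets G \<subseteq> Pow (pverts G)"
    "{S \<in> connected_sets G. dominating G S} \<subseteq> Pow (pverts G)"
    by (auto simp: connected_sets_def)
  show "num_conn G \<le> 2 ^ graph_order G" "num_conn_dom G \<le> 2 ^ graph_order G"
    using card_mono[OF _ sub(1)] card_mono[OF _ sub(2)] fin
    by (simp_all add: num_conn_def num_conn_dom_def graph_order_def card_Pow)
qed

lemma finite_values:
  "finite (conn_root ` regular_graphs d n)" "finite (conn_dom_root ` regular_graphs d n)"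
proof -
  have "conn_root ` regular_graphs d n \<subseteq> (\<lambda>k. root n (real k)) ` {..2 ^ n}"
    "conn_dom_root ` regular_graphs d n \<subseteq> (\<lambda>k. root n (real k)) ` {..2 ^ n}"
    using num_conn_le num_conn_dom_le by (fastforce simp: conn_root_def conn_dom_root_def regular_graphs_def)+
  then show "finite (conn_root ` regular_graphs d n)" "finite (conn_dom_root ` regular_graphs d n)"
    by (meson finite_atMost finite_imageI finite_subset)+
qed

(* The limsup is taken along those n tending to infinity for which d-regular graphs of order n
   exist. *)

definition c_lim :: "nat \<Rightarrow> ereal" where
  "c_lim d = Limsup (inf sequentially (principal (regular_orders d))) (\<lambda>n. ereal (c_max d n))"

definition c_dom_lim :: "nat \<Rightarrow> ereal" where
  "c_dom_lim d =
     Limsup (inf sequentially (principal (regular_orders d))) (\<lambda>n. ereal (c_dom_max d n))"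

end

theory Submission
  imports Defs "HOL-Library.Multiset" "HOL-Library.Disjoint_Sets"
begin

text \<open>Grow a graph vertex by vertex along a Hamiltonian path, joining each new vertex also to vertices of
  a small frontier that still lack edges. Of a vertex set \<open>S\<close> only the way its components meet the
  frontier matters (and which frontier vertices outside \<open>S\<close> still lack a neighbour in \<open>S\<close>). If the
  vertex to attach to is drawn uniformly from a pool, the expected weight of the new state depends
  only on the numbers of pool vertices in each component, and some choice is at least as good as the
  average. Hence a nonnegative weight function on these profiles that one period of the growth
  multiplies by at least \<open>\<lambda>\<^sup>p\<close> on average (a truncated, rounded Perron eigenvector) yields graphs
  in which the number of surviving sets grows like \<open>\<lambda>\<^sup>n\<close>. Finally a bounded number of
  vertices, all put into \<open>S\<close>, completes the degrees and connects all components.\<close>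

section \<open>Profiles and their weights\<close>

text \<open>One graph has to serve all subsets at once. Linearity makes this possible: the weights
  of a whole family of subsets are summed before an attachment is chosen. The frontier has the same
  class sizes after every period, so only finitely many profiles occur there and a finite table can
  carry the weights. A period of \<open>p\<close> vertices that restores the frontier uses
  \<open>d * p / 2\<close> edges for degree \<open>d\<close>; hence odd degrees need two vertices
  per period, while one suffices for degree 4. Truncation is harmless for lower bounds: a profile
  missing from the table has weight 0, and its inequality holds because all weighted sums are
  nonnegative. Only the inequalities at the listed profiles are checked, in exact integer
  arithmetic, so no spectral theory enters. The closing vertices lose no set of the family: every
  block still meets the frontier, so once the frontier is a single vertex of the set, there is one
  block and nothing is left to dominate. The bounded weights, the start and the closing cost a
  constant factor and a bounded number of vertices, which disappear under the \<open>n\<close>-th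
  root.\<close>

text \<open>Classes of frontier vertices: the vertex being added, the last vertex of the path, the pool of
  exchangeable vertices, a vertex waiting to enter the pool (this keeps short cycles away), and
  vertices set aside during a period.\<close>

datatype cls = New | Last | Pool | Queue | Temp

text \<open>An explicit tuple instead of a function on \<open>cls\<close>, so that vectors can be
  compared and sorted by plain rewriting.\<close>

datatype vec = V nat nat nat nat nat

primrec get :: "cls \<Rightarrow> vec \<Rightarrow> nat" where
  "get New v = (case v of V n l p q t \<Rightarrow> n)"
| "get Last v = (case v of V n l p q t \<Rightarrow> l)"
| "get Pool v = (case v of V n l p q t \<Rightarrow> p)"
| "get Queue v = (case v of V n l p q t \<Rightarrow> q)"
| "get Temp v = (case v of V n l p q t \<Rightarrow> t)"

primrec upd :: "cls \<Rightarrow> (nat \<Rightarrow> nat) \<Rightarrow> vec \<Rightarrow> vec" where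
  "upd New f v = (case v of V n l p q t \<Rightarrow> V (f n) l p q t)"
| "upd Last f v = (case v of V n l p q t \<Rightarrow> V n (f l) p q t)"
| "upd Pool f v = (case v of V n l p q t \<Rightarrow> V n l (f p) q t)"
| "upd Queue f v = (case v of V n l p q t \<Rightarrow> V n l p (f q) t)"
| "upd Temp f v = (case v of V n l p q t \<Rightarrow> V n l p q (f t))"

abbreviation "inc c \<equiv> upd c Suc"
abbreviation "dec c \<equiv> upd c (\<lambda>n. n - 1)"

fun plus_vec :: "vec \<Rightarrow> vec \<Rightarrow> vec" where
  "plus_vec (V n l p q t) (V n' l' p' q' t') = V (n + n') (l + l') (p + p') (q + q') (t + t')"

fun is_zero :: "vec \<Rightarrow> bool" where
  "is_zero (V n l p q t) = (n + (l + (p + (q + t))) = 0)"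

lemma get_upd: "get c (upd c' f x) = (if c = c' then f (get c x) else get c x)"
  by (cases c; cases c'; cases x) simp_all

lemma get_plus_vec: "get c (plus_vec x y) = get c x + get c y"
  by (cases c; cases x; cases y) simp_all

lemma all_cls: "(\<forall>c. P c) \<longleftrightarrow> P New \<and> P Last \<and> P Pool \<and> P Queue \<and> P Temp"
  by (metis cls.exhaust)

lemma is_zero_iff: "is_zero x \<longleftrightarrow> (\<forall>c. get c x = 0)"
  by (cases x) (simp add: all_cls)

lemma vec_eqI: "(\<And>c. get c x = get c y) \<Longrightarrow> x = y"
proof -
  assume *: "\<And>c. get c x = get c y"
  show "x = y"
    using *[of New] *[of Last] *[of Pool] *[of Queue] *[of Temp] by (cases x; cases y) simp
qed

declare get.simps [simp del] upd.simps [simp del]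

text \<open>The order serves to sort the blocks of a profile into the canonical key of a table
  entry. It is lexicographic, written with conditionals so that evaluation stops at the first
  difference.\<close>

instantiation vec :: linorder
begin

fun less_eq_vec :: "vec \<Rightarrow> vec \<Rightarrow> bool" where
  "V n l p q t \<le> V n' l' p' q' t' =
     (if n = n' then if l = l' then if p = p' then if q = q' then t \<le> t'
      else q \<le> q' else p \<le> p' else l \<le> l' else n \<le> n')"

definition less_vec :: "vec \<Rightarrow> vec \<Rightarrow> bool" where
  "x < y \<longleftrightarrow> x \<le> y \<and> x \<noteq> (y :: vec)"

instance
proof
  fix x y z :: vec
  have anti: "x = y" if "x \<le> y" "y \<le> x" for x y :: vec
    using that by (cases x; cases y) (auto split: if_splits)
  show refl: "x \<le> x"
    by (cases x) auto
  show "x = y" if "x \<le> y" "y \<le> x"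
    using that by (rule anti)
  show "x < y \<longleftrightarrow> x \<le> y \<and> \<not> y \<le> x"
    using anti refl by (auto simp: less_vec_def)
  show "x \<le> z" if "x \<le> y" "y \<le> z"
    using that by (cases x; cases y; cases z) (auto split: if_splits)
  show "x \<le> y \<or> y \<le> x"
    by (cases x; cases y) auto
qed

end

text \<open>The truncated subtraction in \<open>dec\<close> does no harm: in \<open>W\<close> a
  shifted vector contributes only behind the factor \<open>get f x\<close>, which vanishes when
  class \<open>f\<close> is empty.\<close>

definition shift :: "cls \<Rightarrow> cls option \<Rightarrow> vec \<Rightarrow> vec" where
  "shift f g x = (case g of None \<Rightarrow> dec f x | Some c \<Rightarrow> inc c (dec f x))"

definition put :: "cls option \<Rightarrow> vec \<Rightarrow> vec" where
  "put g x = (case g of None \<Rightarrow> x | Some c \<Rightarrow> inc c x)"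

definition pour :: "cls \<Rightarrow> cls \<Rightarrow> vec \<Rightarrow> vec" where
  "pour a b x = upd a (\<lambda>_. 0) (upd b (\<lambda>n. n + get a x) x)"

text \<open>Multiplication under a name of its own, so that a congruence rule can evaluate the
  factor alone and a branch with factor 0 is dropped unevaluated.\<close>

definition scale :: "nat \<Rightarrow> int \<Rightarrow> int" where
  "scale k x = int k * x"

text \<open>\<open>Add free\<close> adds a vertex, which may stay outside the set only if \<open>free\<close>; \<open>Att f g\<close> joins it to some
  vertex of class \<open>f\<close>, which then moves to class \<open>g\<close> or, for \<open>None\<close>, has full degree and leaves the
  frontier; \<open>Mv a b\<close> relabels a whole class.\<close>

datatype oper = Add bool | Att cls "cls option" | Mv cls cls

text \<open>Weights of lists of vectors, stored along common prefixes. A key that is not stored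
  reads as 0, which is how the eigenvector is truncated.\<close>

datatype trie = Nd int forest
  and forest = Tip | Br vec trie forest

primrec look :: "trie \<Rightarrow> vec list \<Rightarrow> int" and look_in :: "forest \<Rightarrow> vec \<Rightarrow> vec list \<Rightarrow> int" where
  "look (Nd w f) ks = (case ks of [] \<Rightarrow> w | k # ks \<Rightarrow> look_in f k ks)"
| "look_in Tip k ks = 0"
| "look_in (Br k' t f) k ks = (if k = k' then look t ks else look_in f k ks)"

text \<open>In a profile, \<open>bs\<close> lists the class counts of the blocks (components of the set, cut down to the
  frontier), \<open>m\<close> is the block of the new vertex, \<open>u\<close> counts the frontier vertices still to be
  dominated and \<open>d\<close> the remaining ones. \<open>W\<close> sums the weights of the final profiles over both choices
  for each free vertex and over all choices of attachment; a block or an undominated vertex that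
  leaves the frontier is lost.\<close>

fun W :: "bool \<Rightarrow> trie \<Rightarrow> oper list \<Rightarrow> vec option \<Rightarrow> vec \<Rightarrow> vec \<Rightarrow> vec list \<Rightarrow> int" where
  "W dm z [] None d u bs = look z (d # u # sort bs)"
| "W dm z [] (Some b0) d u bs = 0"
| "W dm z (Add free # ops) m d u bs =
     W dm z ops (Some (V 1 0 0 0 0)) d u bs +
     (if free then if dm then W dm z ops None d (inc New u) bs else W dm z ops None (inc New d) u bs
      else 0)"
| "W dm z (Mv a b # ops) None d u bs =
     W dm z ops None (pour a b d) (pour a b u) (map (pour a b) bs)"
| "W dm z (Mv a b # ops) (Some b0) d u bs =
     (if a = New then W dm z ops None (pour a b d) (pour a b u) (pour a b b0 # map (pour a b) bs)
      else W dm z ops (Some (pour a b b0)) (pour a b d) (pour a b u) (map (pour a b) bs))"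
| "W dm z (Att f g # ops) (Some b0) d u bs =
     scale (get f d) (W dm z ops (Some b0) (shift f g d) u bs) +
     scale (get f u) (W dm z ops (Some b0) (put g d) (dec f u) bs) +
     scale (get f b0) (W dm z ops (Some (shift f g b0)) d u bs) +
     (\<Sum>b\<leftarrow>bs. scale (get f b) (W dm z ops (Some (plus_vec b0 (shift f g b))) d u (remove1 b bs)))"
| "W dm z (Att f g # ops) None d u bs =
     scale (get f d) (W dm z ops None (shift f g d) u bs) +
     (if g = None then 0 else scale (get f u) (W dm z ops None d (shift f g u) bs)) +
     (\<Sum>b\<leftarrow>bs. if is_zero (shift f g b) then 0 else scale (get f b)
        (if get New u = 0 then W dm z ops None d u (shift f g b # remove1 b bs)
         else W dm z ops None (inc New d) (dec New u) (shift f g b # remove1 b bs)))"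

text \<open>The blocks enter only through sums over the list, \<open>map\<close>,
  \<open>remove1\<close> and the final \<open>sort\<close>. A configuration determines its block
  list only up to order, so this makes its weight well defined.\<close>

lemma W_mset_cong: "mset bs = mset bs' \<Longrightarrow> W dm z ops m d u bs = W dm z ops m d u bs'"
proof (induction ops arbitrary: m d u bs bs')
  case Nil
  then show ?case
    by (cases m) (simp_all add: properties_for_sort[of "sort bs'" bs])
next
  case (Cons op ops)
  have sums: "(\<Sum>b\<leftarrow>bs. h b) = (\<Sum>b\<leftarrow>bs'. h' b)"
    if "\<And>b. h b = h' b" for h h' :: "vec \<Rightarrow> int"
  proof -
    have "h = h'" using that by auto
    then show ?thesis
      using Cons.prems by (metis mset_map sum_mset_sum_list)
  qed
  show ?case
  proof (cases op)
    case (Add free)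
    show ?thesis unfolding Add W.simps by (simp only: Cons.IH[OF Cons.prems])
  next
    case (Mv a b)
    have "mset (map (pour a b) bs) = mset (map (pour a b) bs')"
      "mset (x # map (pour a b) bs) = mset (x # map (pour a b) bs')" for x
      using Cons.prems by simp_all
    note IH = Cons.IH[OF this(1)] Cons.IH[OF this(2)]
    show ?thesis
      unfolding Mv by (cases m) (simp_all only: W.simps IH)
  next
    case (Att f g)
    have r: "mset (remove1 b bs) = mset (remove1 b bs')"
      "mset (x # remove1 b bs) = mset (x # remove1 b bs')" for x b
      using Cons.prems by simp_all
    note IH = Cons.IH[OF Cons.prems] Cons.IH[OF r(1)] Cons.IH[OF r(2)]
    show ?thesis
    proof (cases m)
      case None
      show ?thesis
        unfolding Att None W.simps
        by (intro arg_cong2[where f = "(+)"] sums) (simp_all only: IH)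
    next
      case (Some b0)
      show ?thesis
        unfolding Att Some W.simps
        by (intro arg_cong2[where f = "(+)"] sums) (simp_all only: IH)
    qed
  qed
qed

text \<open>Losses count as 0, never negatively. This settles the certificate inequality at every
  profile of weight 0.\<close>

lemma W_nonneg:
  assumes "\<And>ks. 0 \<le> look z ks"
  shows "0 \<le> W dm z ops m d u bs"
proof (induction ops arbitrary: m d u bs)
  case Nil
  then show ?case using assms by (cases m) auto
next
  case (Cons op ops)
  then show ?case
    by (cases op; cases m)
      (auto simp: scale_def intro!: add_nonneg_nonneg sum_list_nonneg)
qed

section \<open>Configurations\<close>

type_synonym classes = "cls \<Rightarrow> nat set"
type_synonym config = "nat set set \<times> nat set"

definition frontier :: "classes \<Rightarrow> nat set" where
  "frontier F = (\<Union>c. F c)"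

definition vec_of :: "classes \<Rightarrow> nat set \<Rightarrow> vec" where
  "vec_of F B = V (card (F New \<inter> B)) (card (F Last \<inter> B)) (card (F Pool \<inter> B))
     (card (F Queue \<inter> B)) (card (F Temp \<inter> B))"

definition classes_ok :: "classes \<Rightarrow> bool" where
  "classes_ok F \<longleftrightarrow> (\<forall>c. finite (F c)) \<and> (\<forall>c c'. c \<noteq> c' \<longrightarrow> F c \<inter> F c' = {})"

definition move :: "nat \<Rightarrow> cls option \<Rightarrow> classes \<Rightarrow> classes" where
  "move x g F = (\<lambda>c. if g = Some c then insert x (F c - {x}) else F c - {x})"

definition merge :: "cls \<Rightarrow> cls \<Rightarrow> classes \<Rightarrow> classes" where
  "merge a b F = (\<lambda>c. if c = b then F a \<union> F b else if c = a then {} else F c)"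

lemma get_vec_of [simp]: "get c (vec_of F B) = card (F c \<inter> B)"
  by (cases c) (simp_all add: vec_of_def get.simps)

lemma vec_of_move:
  assumes F: "classes_ok F" and x: "x \<in> F f"
  shows "vec_of (move x g F) B = (if x \<in> B then shift f g (vec_of F B) else vec_of F B)"
proof (rule vec_eqI)
  fix c
  have fin: "finite (F c \<inter> B)" using F by (simp add: classes_ok_def)
  have c: "x \<in> F c \<longleftrightarrow> c = f" using F x by (auto simp: classes_ok_def)
  show "get c (vec_of (move x g F) B) = get c (if x \<in> B then shift f g (vec_of F B) else vec_of F B)"
  proof (cases "x \<in> B")
    case False
    then have "move x g F c \<inter> B = F c \<inter> B" by (auto simp: move_def)
    then show ?thesis using False by simp
  next
    case True
    have 1: "card ((F c - {x}) \<inter> B) = (if c = f then card (F c \<inter> B) - 1 else card (F c \<inter> B))"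
    proof -
      have "(F c - {x}) \<inter> B = F c \<inter> B - {x}" by auto
      then show ?thesis using c True fin by (cases "c = f") auto
    qed
    have 2: "insert x (F c - {x}) \<inter> B = insert x ((F c - {x}) \<inter> B)" using True by auto
    have 3: "card (insert x (F c - {x}) \<inter> B) = Suc (card ((F c - {x}) \<inter> B))"
      unfolding 2 using fin by (simp add: Diff_Int_distrib2)
    show ?thesis
      using True 1 3 by (auto simp: move_def shift_def get_upd split: option.split)
  qed
qed

lemma vec_of_merge:
  assumes "classes_ok F" and "a \<noteq> b"
  shows "vec_of (merge a b F) B = pour a b (vec_of F B)"
proof (rule vec_eqI)
  fix c
  have "card ((F a \<union> F b) \<inter> B) = card (F b \<inter> B) + card (F a \<inter> B)"
    using assms by (subst Int_Un_distrib2, subst card_Un_disjoint) (auto simp: classes_ok_def)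
  then show "get c (vec_of (merge a b F) B) = get c (pour a b (vec_of F B))"
    using assms by (auto simp: merge_def pour_def get_upd)
qed

lemma vec_of_Un:
  assumes "classes_ok F" and "A \<inter> B = {}"
  shows "vec_of F (A \<union> B) = plus_vec (vec_of F A) (vec_of F B)"
proof (rule vec_eqI)
  fix c
  have "card (F c \<inter> (A \<union> B)) = card (F c \<inter> A) + card (F c \<inter> B)"
    using assms by (subst Int_Un_distrib, subst card_Un_disjoint) (auto simp: classes_ok_def)
  then show "get c (vec_of F (A \<union> B)) = get c (plus_vec (vec_of F A) (vec_of F B))"
    by (simp add: get_plus_vec)
qed

lemma vec_of_insert:
  assumes F: "classes_ok F" and "x \<in> F c" "x \<notin> B"
  shows "vec_of F (insert x B) = inc c (vec_of F B)"
proof (rule vec_eqI)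
  fix c'
  have "F c' \<inter> insert x B = (if c' = c then insert x (F c' \<inter> B) else F c' \<inter> B)"
    using assms by (auto simp: classes_ok_def)
  moreover have "finite (F c' \<inter> B)" using F by (simp add: classes_ok_def)
  ultimately show "get c' (vec_of F (insert x B)) = get c' (inc c (vec_of F B))"
    using assms by (cases "c' = c") (auto simp: get_upd)
qed

lemma vec_of_remove:
  assumes F: "classes_ok F" and "x \<in> F c" "x \<in> B"
  shows "vec_of F (B - {x}) = dec c (vec_of F B)"
proof (rule vec_eqI)
  fix c'
  have "F c' \<inter> (B - {x}) = (if c' = c then F c' \<inter> B - {x} else F c' \<inter> B)"
    using assms by (auto simp: classes_ok_def)
  moreover have "finite (F c' \<inter> B)" using F by (simp add: classes_ok_def)
  ultimately show "get c' (vec_of F (B - {x})) = get c' (dec c (vec_of F B))"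
    using assms by (cases "c' = c") (auto simp: get_upd)
qed

lemma vec_of_cong: "B \<inter> frontier F = B' \<inter> frontier F \<Longrightarrow> vec_of F B = vec_of F B'"
proof (rule vec_eqI)
  fix c assume "B \<inter> frontier F = B' \<inter> frontier F"
  then have "F c \<inter> B = F c \<inter> B'" by (auto simp: frontier_def)
  then show "get c (vec_of F B) = get c (vec_of F B')" by simp
qed

lemma is_zero_vec_of: "classes_ok F \<Longrightarrow> is_zero (vec_of F B) \<longleftrightarrow> B \<inter> frontier F = {}"
  by (simp add: is_zero_iff classes_ok_def frontier_def) blast

lemma classes_ok_move: "classes_ok F \<Longrightarrow> classes_ok (move x g F)"
  by (auto simp: classes_ok_def move_def)

lemma classes_ok_merge: "classes_ok F \<Longrightarrow> classes_ok (merge a b F)"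
  by (auto simp: classes_ok_def merge_def)

lemma frontier_move: "x \<in> frontier F \<Longrightarrow> frontier (move x g F) = (if g = None then frontier F - {x} else frontier F)"
  by (auto simp: frontier_def move_def)

lemma frontier_merge: "frontier (merge a b F) = frontier F"
proof
  show "frontier (merge a b F) \<subseteq> frontier F"
    by (auto simp: frontier_def merge_def split: if_splits)
  have "F c \<subseteq> merge a b F (if c = a then b else c)" for c
    by (auto simp: merge_def)
  then show "frontier F \<subseteq> frontier (merge a b F)"
    unfolding frontier_def by blast
qed

text \<open>A configuration \<open>(P, U)\<close> stands for the set \<open>\<Union>P\<close>, partitioned into connected blocks, with \<open>U\<close> the vertices
  that still need a neighbour in it.\<close>

definition sound :: "bool \<Rightarrow> nat \<Rightarrow> (nat \<times> nat) set \<Rightarrow> classes \<Rightarrow> config \<Rightarrow> bool" where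
  "sound dm t E F = (\<lambda>(P, U).
     \<Union>P \<subseteq> {..<t} \<and> disjoint P \<and>
     (\<forall>B\<in>P. B \<inter> frontier F \<noteq> {} \<and> (\<forall>x\<in>B. \<forall>y\<in>B. (x, y) \<in> (E \<inter> B \<times> B)\<^sup>*)) \<and>
     U \<subseteq> frontier F - \<Union>P \<and>
     (dm \<longrightarrow> (\<forall>x<t. x \<notin> \<Union>P \<longrightarrow> x \<in> U \<or> (\<exists>y\<in>\<Union>P. (x, y) \<in> E))))"

text \<open>The complement behind \<open>d\<close> is infinite, but \<open>vec_of\<close> intersects
  it with the frontier classes. A relation is used because the order of \<open>bs\<close> is left
  open.\<close>

definition profile where
  "profile F P U m d u bs \<longleftrightarrow> d = vec_of F (- \<Union>P - U) \<and> u = vec_of F U \<and>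
     (case m of
        None \<Rightarrow> F New \<inter> \<Union>P = {} \<and> mset bs = image_mset (vec_of F) (mset_set P)
      | Some b0 \<Rightarrow> \<exists>B0\<in>P. F New \<inter> B0 \<noteq> {} \<and> b0 = vec_of F B0 \<and>
          mset bs = image_mset (vec_of F) (mset_set (P - {B0})))"

text \<open>The choice operator turns the relation \<open>profile\<close> into a number;
  \<open>tally_eq\<close> shows that every profile of a configuration with disjoint blocks and at
  most one new vertex gives the same value.\<close>

definition tally where
  "tally dm z ops F P U = (SOME w. \<exists>m d u bs. profile F P U m d u bs \<and> w = W dm z ops m d u bs)"

lemma profile_exists:
  assumes "finite P" obtains m d u bs where "profile F P U m d u bs"
proof (cases "F New \<inter> \<Union>P = {}")
  case True
  obtain bs where "mset bs = image_mset (vec_of F) (mset_set P)" using ex_mset by blast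
  with True have "profile F P U None (vec_of F (- \<Union>P - U)) (vec_of F U) bs" by (simp add: profile_def)
  then show ?thesis by (rule that)
next
  case False
  then obtain B0 where B0: "B0 \<in> P" "F New \<inter> B0 \<noteq> {}" by auto
  obtain bs where "mset bs = image_mset (vec_of F) (mset_set (P - {B0}))" using ex_mset by blast
  with B0 have "profile F P U (Some (vec_of F B0)) (vec_of F (- \<Union>P - U)) (vec_of F U) bs"
    by (auto simp: profile_def)
  then show ?thesis by (rule that)
qed

text \<open>Disjoint blocks can meet the at most one vertex of \<open>F New\<close> only once, which
  fixes the distinguished block.\<close>

lemma profile_unique:
  assumes "disjoint P" "F New \<subseteq> {v}" "profile F P U m d u bs" "profile F P U m' d' u' bs'"
  shows "m = m' \<and> d = d' \<and> u = u' \<and> mset bs = mset bs'"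
proof -
  have uniq: "B = B'" if "B \<in> P" "B' \<in> P" "F New \<inter> B \<noteq> {}" "F New \<inter> B' \<noteq> {}" for B B'
    using that assms(1,2) by (auto simp: disjoint_def)
  show ?thesis
  proof (cases "F New \<inter> \<Union>P = {}")
    case True
    then have none: "\<not> (\<exists>B\<in>P. F New \<inter> B \<noteq> {} \<and> Q B)" for Q by blast
    show ?thesis using assms(3,4) none by (cases m; cases m') (simp_all add: profile_def)
  next
    case False
    then obtain b b' where m: "m = Some b" "m' = Some b'"
      using assms(3,4) by (cases m; cases m') (simp_all add: profile_def)
    obtain B where B: "B \<in> P" "F New \<inter> B \<noteq> {}" "b = vec_of F B"
        "mset bs = image_mset (vec_of F) (mset_set (P - {B}))"
      using assms(3) m by (auto simp: profile_def)
    obtain B' where B': "B' \<in> P" "F New \<inter> B' \<noteq> {}" "b' = vec_of F B'"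
        "mset bs' = image_mset (vec_of F) (mset_set (P - {B'}))"
      using assms(4) m by (auto simp: profile_def)
    have "B = B'" using uniq B B' by blast
    then show ?thesis using assms(3,4) m B B' by (simp add: profile_def)
  qed
qed

lemma tally_eq:
  assumes "disjoint P" "F New \<subseteq> {v}" "profile F P U m d u bs"
  shows "tally dm z ops F P U = W dm z ops m d u bs"
proof -
  have *: "w = W dm z ops m d u bs" if "profile F P U m' d' u' bs'" "w = W dm z ops m' d' u' bs'" for w m' d' u' bs'
    using profile_unique[OF assms that(1)] that(2) W_mset_cong[of bs bs'] by simp
  show ?thesis
    unfolding tally_def by (rule some_equality) (use assms(3) * in blast)+
qed

section \<open>Attaching the new vertex\<close>

text \<open>If \<open>x\<close> lies outside the set, the union consists of the block of
  \<open>v\<close> alone and a partition stays unchanged, so one formula covers all positions of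
  \<open>x\<close>.\<close>

definition attach_blocks :: "nat \<Rightarrow> nat \<Rightarrow> nat set set \<Rightarrow> nat set set" where
  "attach_blocks v x P =
     (if v \<in> \<Union>P then insert (\<Union>{B \<in> P. v \<in> B \<or> x \<in> B}) {B \<in> P. v \<notin> B \<and> x \<notin> B} else P)"

definition attach_wait :: "nat \<Rightarrow> nat \<Rightarrow> nat set set \<Rightarrow> nat set \<Rightarrow> nat set" where
  "attach_wait v x P U = (if v \<in> \<Union>P then U - {x} else if x \<in> \<Union>P then U - {v} else U)"

text \<open>The survival test after an attachment: a block off the frontier can no longer be joined
  to the rest, and a waiting vertex off the frontier can no longer be dominated.\<close>

definition valid :: "classes \<Rightarrow> nat set set \<Rightarrow> nat set \<Rightarrow> bool" where
  "valid F P U \<longleftrightarrow> (\<forall>B\<in>P. B \<inter> frontier F \<noteq> {}) \<and> U \<subseteq> frontier F"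

lemma Union_attach_blocks [simp]: "\<Union>(attach_blocks v x P) = \<Union>P"
  by (auto simp: attach_blocks_def)

lemma disjoint_attach_blocks: "disjoint P \<Longrightarrow> disjoint (attach_blocks v x P)"
  by (simp add: attach_blocks_def disjoint_def) blast

text \<open>Every old block inside the merged one contains \<open>v\<close> or \<open>x\<close>, so
  the new edge connects each of its vertices to \<open>v\<close> within the union.\<close>

lemma sound_attach:
  assumes s: "sound dm t E F (P, U)"
    and val: "valid F' (attach_blocks v x P) (attach_wait v x P U)"
  shows "sound dm t (E \<union> {(v, x), (x, v)}) F' (attach_blocks v x P, attach_wait v x P U)"
proof -
  let ?E = "E \<union> {(v, x), (x, v)}"
  have link: "(y, y') \<in> (E \<inter> B \<times> B)\<^sup>*" if "B \<in> P" "y \<in> B" "y' \<in> B" for B y y'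
    using s that by (auto simp: sound_def)
  have mono: "(E \<inter> B \<times> B)\<^sup>* \<subseteq> (?E \<inter> B' \<times> B')\<^sup>*" if "B \<subseteq> B'" for B B'
    using that by (intro rtrancl_mono) auto
  have links: "(y, y') \<in> (?E \<inter> B \<times> B)\<^sup>*"
    if B: "B \<in> attach_blocks v x P" and y: "y \<in> B" "y' \<in> B" for B y y'
  proof (cases "B \<in> P")
    case True
    then show ?thesis using link[OF True y] mono[of B B] by auto
  next
    case False
    then have v: "v \<in> \<Union>P" and BA: "B = \<Union>{B \<in> P. v \<in> B \<or> x \<in> B}"
      using B by (auto simp: attach_blocks_def split: if_splits)
    have vB: "v \<in> B" using v BA by auto
    have "(y, v) \<in> (?E \<inter> B \<times> B)\<^sup>* \<and> (v, y) \<in> (?E \<inter> B \<times> B)\<^sup>*" if yB: "y \<in> B" for y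
    proof -
      obtain C where C: "C \<in> P" "y \<in> C" "v \<in> C \<or> x \<in> C" using yB BA by auto
      have CB: "C \<subseteq> B" using C BA by auto
      show ?thesis
      proof (cases "v \<in> C")
        case True
        then show ?thesis using link[OF C(1,2)] link[OF C(1) _ C(2)] mono[OF CB] by blast
      next
        case False
        then have x: "x \<in> C" using C by simp
        then have "(x, v) \<in> ?E \<inter> B \<times> B" "(v, x) \<in> ?E \<inter> B \<times> B" using vB CB by auto
        moreover have "(y, x) \<in> (?E \<inter> B \<times> B)\<^sup>*" "(x, y) \<in> (?E \<inter> B \<times> B)\<^sup>*"
          using link[OF C(1,2) x] link[OF C(1) x C(2)] mono[OF CB] by blast+
        ultimately show ?thesis by (meson converse_rtrancl_into_rtrancl rtrancl.rtrancl_into_rtrancl)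
      qed
    qed
    then show ?thesis using y by (meson rtrancl_trans)
  qed
  have dom: "y \<in> attach_wait v x P U \<or> (\<exists>y'\<in>\<Union>P. (y, y') \<in> ?E)"
    if "dm" "y < t" "y \<notin> \<Union>P" for y
  proof -
    have "y \<in> U \<or> (\<exists>y'\<in>\<Union>P. (y, y') \<in> E)" using s that by (auto simp: sound_def)
    then show ?thesis by (auto simp: attach_wait_def)
  qed
  have "attach_wait v x P U \<inter> \<Union>P = {}"
    using s by (auto simp: attach_wait_def sound_def)
  then have "attach_wait v x P U \<subseteq> frontier F' - \<Union>P"
    using val by (auto simp: valid_def)
  moreover have "\<Union>P \<subseteq> {..<t}" "disjoint P"
    using s by (simp_all add: sound_def)
  moreover have "\<forall>B\<in>attach_blocks v x P. B \<inter> frontier F' \<noteq> {} \<and> (\<forall>y\<in>B. \<forall>y'\<in>B. (y, y') \<in> (?E \<inter> B \<times> B)\<^sup>*)"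
    using val links unfolding valid_def by blast
  moreover have "dm \<longrightarrow> (\<forall>y<t. y \<notin> \<Union>P \<longrightarrow> y \<in> attach_wait v x P U \<or> (\<exists>y'\<in>\<Union>P. (y, y') \<in> ?E))"
    using dom by blast
  ultimately show ?thesis
    unfolding sound_def prod.case Union_attach_blocks
    by (intro conjI disjoint_attach_blocks) assumption+
qed

text \<open>With \<open>v\<close> in the set nothing is lost: a block containing \<open>x\<close> is
  absorbed by the block of \<open>v\<close>, which stays on the frontier, and \<open>x\<close>
  itself no longer waits.\<close>

lemma valid_attach:
  assumes val: "valid F P U" and x: "x \<in> frontier F" and v: "v \<in> frontier F" "x \<noteq> v"
    and vP: "v \<in> \<Union>P" and U: "U \<subseteq> frontier F - \<Union>P"
  shows "valid (move x g F) (attach_blocks v x P) (attach_wait v x P U)"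
proof -
  have fr: "frontier F - {x} \<subseteq> frontier (move x g F)" using frontier_move[OF x] by auto
  have "B \<inter> frontier (move x g F) \<noteq> {}" if "B \<in> attach_blocks v x P" for B
  proof (cases "v \<in> B")
    case True
    then show ?thesis using fr v by auto
  next
    case False
    then have B: "B \<in> P" "x \<notin> B" using that vP by (auto simp: attach_blocks_def)
    then obtain y where "y \<in> B" "y \<in> frontier F" using val by (auto simp: valid_def)
    moreover from this B have "y \<noteq> x" by auto
    ultimately show ?thesis using fr by auto
  qed
  moreover have "attach_wait v x P U \<subseteq> frontier (move x g F)"
    using vP U fr by (auto simp: attach_wait_def)
  ultimately show ?thesis by (auto simp: valid_def)
qed

lemma sum_list_profile:
  assumes "mset bs = image_mset g (mset_set P)" and "finite P"
  shows "(\<Sum>b\<leftarrow>bs. h b) = (\<Sum>B\<in>P. (h (g B) :: int))"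
proof -
  have "(\<Sum>b\<leftarrow>bs. h b) = sum_mset (image_mset h (mset bs))"
    by (metis mset_map sum_mset_sum_list)
  also have "\<dots> = (\<Sum>B\<in>P. h (g B))"
    using assms by (simp add: image_mset.compositionality comp_def sum_unfold_sum_mset)
  finally show ?thesis .
qed

lemma scale_if: "scale k (if b then 0 else x) = (if b then 0 else scale k x)"
  by (simp add: scale_def)

lemma profile_Some:
  assumes "B0 \<in> P" "F New \<inter> B0 \<noteq> {}" "vec_of F B0 = b0"
    and "mset bs = image_mset (vec_of F) (mset_set (P - {B0}))"
    and "vec_of F (- \<Union>P - U) = d" "vec_of F U = u"
  shows "profile F P U (Some b0) d u bs"
  using assms by (auto simp: profile_def)

lemma profile_None:
  assumes "F New \<inter> \<Union>P = {}" "mset bs = image_mset (vec_of F) (mset_set P)"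
    and "vec_of F (- \<Union>P - U) = d" "vec_of F U = u"
  shows "profile F P U None d u bs"
  using assms by (simp add: profile_def)

text \<open>The vertices of \<open>F f\<close> split into those neither in the set nor waiting,
  those in \<open>U\<close>, and those in each block. All vertices of one part lead to the same new
  profile, so a part contributes its size times one value of \<open>W\<close>, or 0 if the
  configuration is lost. This is where the exchangeability of the vertices of a class
  enters.\<close>

lemma tally_attach:
  assumes F: "classes_ok F" and v: "F New = {v}" and f: "f \<noteq> New" and g: "g \<noteq> Some New"
    and P: "finite P" "disjoint P" and PU: "U \<subseteq> frontier F - \<Union>P" and "valid F P U"
  shows "tally dm z (Att f g # ops) F P U =
    (\<Sum>x\<in>F f. if valid (move x g F) (attach_blocks v x P) (attach_wait v x P U)
       then tally dm z ops (move x g F) (attach_blocks v x P) (attach_wait v x P U) else 0)"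
    (is "_ = (\<Sum>x\<in>F f. ?h x)")
proof -
  obtain m d u bs where prof: "profile F P U m d u bs" using profile_exists[OF P(1)] .
  then have d: "d = vec_of F (- \<Union>P - U)" and u: "u = vec_of F U" by (simp_all add: profile_def)
  let ?D = "- \<Union>P - U"
  have finF: "finite (F c)" for c using F by (simp add: classes_ok_def)
  have xv: "x \<noteq> v" if "x \<in> F f" for x using that F v f unfolding classes_ok_def by (metis disjoint_iff singletonI)
  have newF: "move x g F New = {v}" if "x \<in> F f" for x
    using xv[OF that] v g by (auto simp: move_def)
  have xfr: "x \<in> frontier F" if "x \<in> F f" for x using that by (auto simp: frontier_def)
  have vfr: "v \<in> frontier F" using v by (auto simp: frontier_def)
  have vin: "vec_of (move x g F) B = shift f g (vec_of F B)" if "x \<in> F f" "x \<in> B" for x B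
    using vec_of_move[OF F that(1)] that(2) by simp
  have vout: "vec_of (move x g F) B = vec_of F B" if "x \<in> F f" "x \<notin> B" for x B
    using vec_of_move[OF F that(1)] that(2) by simp
  have split: "(\<Sum>x\<in>F f. ?h x) = (\<Sum>x\<in>F f \<inter> ?D. ?h x) + (\<Sum>x\<in>F f \<inter> U. ?h x) + (\<Sum>B\<in>P. \<Sum>x\<in>F f \<inter> B. ?h x)"
  proof -
    have "F f = ((F f \<inter> ?D) \<union> (F f \<inter> U)) \<union> (\<Union>B\<in>P. F f \<inter> B)" by blast
    then have "(\<Sum>x\<in>F f. ?h x) = (\<Sum>x\<in>((F f \<inter> ?D) \<union> (F f \<inter> U)) \<union> (\<Union>B\<in>P. F f \<inter> B). ?h x)" by simp
    also have "\<dots> = (\<Sum>x\<in>(F f \<inter> ?D) \<union> (F f \<inter> U). ?h x) + (\<Sum>x\<in>(\<Union>B\<in>P. F f \<inter> B). ?h x)"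
      using PU finF P(1) by (intro sum.union_disjoint) auto
    also have "(\<Sum>x\<in>(F f \<inter> ?D) \<union> (F f \<inter> U). ?h x) = (\<Sum>x\<in>F f \<inter> ?D. ?h x) + (\<Sum>x\<in>F f \<inter> U. ?h x)"
      using finF by (intro sum.union_disjoint) auto
    also have "(\<Sum>x\<in>(\<Union>B\<in>P. F f \<inter> B). ?h x) = (\<Sum>B\<in>P. \<Sum>x\<in>F f \<inter> B. ?h x)"
      using finF P by (intro sum.UNION_disjoint) (auto simp: disjoint_def)
    finally show ?thesis .
  qed
  have const: "(\<Sum>x\<in>F f \<inter> X. ?h x) = scale (get f (vec_of F X)) k"
    if "\<And>x. x \<in> F f \<Longrightarrow> x \<in> X \<Longrightarrow> ?h x = k" for X k
    using that by (simp add: scale_def)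
  have tally: "tally dm z ops (move x g F) P' U' = W dm z ops m' d' u' bs'"
    if "x \<in> F f" "disjoint P'" "profile (move x g F) P' U' m' d' u' bs'" for x P' U' m' d' u' bs'
    using tally_eq[OF that(2) _ that(3)] newF[OF that(1)] by auto
  have main: "tally dm z (Att f g # ops) F P U = W dm z (Att f g # ops) m d u bs"
    using tally_eq[OF P(2) _ prof] v by auto
  show ?thesis
  proof (cases m)
    case (Some b0)
    then obtain B0 where B0: "B0 \<in> P" "v \<in> B0" "b0 = vec_of F B0"
      and bs: "mset bs = image_mset (vec_of F) (mset_set (P - {B0}))"
      using prof v by (auto simp: profile_def)
    have vP: "v \<in> \<Union>P" using B0 by auto
    have v_iff: "v \<in> B \<longleftrightarrow> B = B0" if "B \<in> P" for B using that B0 P by (auto simp: disjoint_def)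
    have valid: "valid (move x g F) (attach_blocks v x P) (attach_wait v x P U)" if x: "x \<in> F f" for x
      using valid_attach[OF assms(8) xfr[OF x] vfr _ vP PU] xv[OF x] by simp
    have rest: "mset bs = image_mset (vec_of (move x g F)) (mset_set (P - {B0}))"
      if "x \<in> F f" "x \<notin> \<Union>(P - {B0})" for x
      unfolding bs using that P(1) by (intro image_mset_cong) (simp add: vout)
    have 1: "(\<Sum>x\<in>F f \<inter> ?D. ?h x) = scale (get f d) (W dm z ops m (shift f g d) u bs)"
      unfolding d
    proof (rule const)
      fix x assume x: "x \<in> F f" "x \<in> ?D"
      have "attach_blocks v x P = P"
      proof -
        have "{B \<in> P. v \<in> B \<or> x \<in> B} = {B0}" "{B \<in> P. v \<notin> B \<and> x \<notin> B} = P - {B0}"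
          using x B0(1) v_iff by auto
        then show ?thesis using vP B0 by (auto simp: attach_blocks_def)
      qed
      moreover have "attach_wait v x P U = U" using x vP by (auto simp: attach_wait_def)
      moreover have "profile (move x g F) P U m (shift f g (vec_of F ?D)) u bs"
        unfolding Some
      proof (rule profile_Some[OF B0(1)])
        have xP: "x \<notin> \<Union>P" "x \<notin> U" "x \<notin> B0" using x B0 by auto
        show "move x g F New \<inter> B0 \<noteq> {}" using newF[OF x(1)] B0 by simp
        show "vec_of (move x g F) B0 = b0" "vec_of (move x g F) U = u"
          using vout[OF x(1)] xP B0(3) u by simp_all
        show "mset bs = image_mset (vec_of (move x g F)) (mset_set (P - {B0}))"
          using rest[OF x(1)] xP by blast
        show "vec_of (move x g F) ?D = shift f g (vec_of F ?D)" by (rule vin[OF x])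
      qed
      ultimately show "?h x = W dm z ops m (shift f g (vec_of F ?D)) u bs"
        using valid[OF x(1)] tally[OF x(1) P(2)] by simp
    qed
    have 2: "(\<Sum>x\<in>F f \<inter> U. ?h x) = scale (get f u) (W dm z ops m (put g d) (dec f u) bs)"
      unfolding u
    proof (rule const)
      fix x assume x: "x \<in> F f" "x \<in> U"
      then have xP: "x \<notin> \<Union>P" using PU by auto
      have "attach_blocks v x P = P"
      proof -
        have "{B \<in> P. v \<in> B \<or> x \<in> B} = {B0}" "{B \<in> P. v \<notin> B \<and> x \<notin> B} = P - {B0}"
          using xP B0(1) v_iff by auto
        then show ?thesis using vP B0 by (auto simp: attach_blocks_def)
      qed
      moreover have "attach_wait v x P U = U - {x}" using vP by (auto simp: attach_wait_def)
      moreover have "vec_of (move x g F) (U - {x}) = dec f (vec_of F U)"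
        using x vout[OF x(1), of "U - {x}"] by (simp add: vec_of_remove[OF F])
      moreover have "vec_of (move x g F) (- \<Union>P - (U - {x})) = put g d"
      proof -
        have "- \<Union>P - (U - {x}) = insert x ?D" using xP by auto
        moreover have "vec_of (move x g F) (insert x ?D) = put g (vec_of F ?D)"
        proof -
          \<comment> \<open>The vertex leaves \<open>U\<close> from class \<open>f\<close> and joins
            the dominated ones in class \<open>g\<close>: it is first counted in class
            \<open>f\<close> and then shifted, and the two effects compose to
            \<open>put g\<close>.\<close>
          have "vec_of F (insert x ?D) = inc f (vec_of F ?D)" using x by (intro vec_of_insert[OF F]) auto
          moreover have "shift f g (inc f y) = put g y" for y
            by (rule vec_eqI) (auto simp: shift_def put_def get_upd split: option.split)
          ultimately show ?thesis using vin[OF x(1), of "insert x ?D"] by simp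
        qed
        ultimately show ?thesis by (simp add: d)
      qed
      moreover have "profile (move x g F) P (U - {x}) m (vec_of (move x g F) (- \<Union>P - (U - {x})))
          (vec_of (move x g F) (U - {x})) bs"
        unfolding Some
      proof (rule profile_Some[OF B0(1)])
        show "move x g F New \<inter> B0 \<noteq> {}" using newF[OF x(1)] B0 by simp
        have "x \<notin> B0" using xP B0 by auto
        then show "vec_of (move x g F) B0 = b0"
          using vout[OF x(1)] B0(3) by simp
        show "mset bs = image_mset (vec_of (move x g F)) (mset_set (P - {B0}))"
          using rest[OF x(1)] xP by blast
      qed simp_all
      ultimately have "profile (move x g F) P (U - {x}) m (put g d) (dec f (vec_of F U)) bs"
        by simp
      then show "?h x = W dm z ops m (put g d) (dec f (vec_of F U)) bs"
        using valid[OF x(1)] tally[OF x(1) P(2)] \<open>attach_blocks v x P = P\<close> \<open>attach_wait v x P U = U - {x}\<close> by simp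
    qed
    have 3: "(\<Sum>x\<in>F f \<inter> B0. ?h x) = scale (get f b0) (W dm z ops (Some (shift f g b0)) d u bs)"
      unfolding B0(3)
    proof (rule const)
      fix x assume x: "x \<in> F f" "x \<in> B0"
      have xP: "x \<notin> \<Union>(P - {B0})" using x B0 P by (auto simp: disjoint_def)
      have "attach_blocks v x P = P"
      proof -
        have "{B \<in> P. v \<in> B \<or> x \<in> B} = {B0}" "{B \<in> P. v \<notin> B \<and> x \<notin> B} = P - {B0}"
          using x xP B0(1) v_iff by auto
        then show ?thesis using vP B0 by (auto simp: attach_blocks_def)
      qed
      moreover have "attach_wait v x P U = U" using x vP B0 PU by (auto simp: attach_wait_def)
      moreover have "profile (move x g F) P U (Some (shift f g (vec_of F B0))) d u bs"
      proof -
        have "x \<notin> U" "x \<notin> ?D" using x B0 PU by auto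
        then show ?thesis
          using B0 newF[OF x(1)] rest[OF x(1) xP] x
          by (intro profile_Some[OF B0(1)]) (simp_all add: vin[OF x(1)] vout[OF x(1)] d u)
      qed
      ultimately show "?h x = W dm z ops (Some (shift f g (vec_of F B0))) d u bs"
        using valid[OF x(1)] tally[OF x(1) P(2)] by simp
    qed
    have 4: "(\<Sum>x\<in>F f \<inter> B. ?h x) = scale (get f (vec_of F B))
         (W dm z ops (Some (plus_vec b0 (shift f g (vec_of F B)))) d u (remove1 (vec_of F B) bs))"
      if B: "B \<in> P - {B0}" for B
    proof (rule const)
      fix x assume x: "x \<in> F f" "x \<in> B"
      have vB: "v \<notin> B" using B v_iff by auto
      have dis: "B0 \<inter> B = {}" using B B0 P by (auto simp: disjoint_def)
      have xP: "x \<notin> \<Union>(P - {B0} - {B})" using x B P by (auto simp: disjoint_def)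
      have att: "attach_blocks v x P = insert (B0 \<union> B) (P - {B0} - {B})"
      proof -
        have "{B' \<in> P. v \<in> B' \<or> x \<in> B'} = {B0, B}" "{B \<in> P. v \<notin> B \<and> x \<notin> B} = P - {B0} - {B}"
          using x xP B B0(1) v_iff by auto
        then show ?thesis using vP B0 by (auto simp: attach_blocks_def)
      qed
      \<comment> \<open>The union contains \<open>v\<close>, so as an old block it would equal
        \<open>B0\<close>, although \<open>x\<close> lies in \<open>B\<close> and not in
        \<open>B0\<close>. Removing it from the new partition therefore leaves exactly the untouched
        blocks.\<close>
      have "B0 \<union> B \<notin> P"
        using v_iff[of "B0 \<union> B"] B0 dis x by auto
      then have att2: "attach_blocks v x P - {B0 \<union> B} = P - {B0} - {B}" unfolding att by auto
      have wait: "attach_wait v x P U = U" using x B vP PU by (auto simp: attach_wait_def)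
      have xD: "x \<notin> U" "x \<notin> ?D" using x B PU by auto
      have b: "vec_of (move x g F) (B0 \<union> B) = plus_vec b0 (shift f g (vec_of F B))"
      proof -
        have "vec_of (move x g F) (B0 \<union> B) = plus_vec (vec_of (move x g F) B0) (vec_of (move x g F) B)"
          using dis by (intro vec_of_Un classes_ok_move F)
        moreover have "x \<notin> B0" using x dis by auto
        ultimately show ?thesis by (simp add: vin[OF x] vout[OF x(1)] B0(3))
      qed
      have r: "mset (remove1 (vec_of F B) bs) = image_mset (vec_of (move x g F)) (mset_set (P - {B0} - {B}))"
      proof -
        have "mset (remove1 (vec_of F B) bs) = image_mset (vec_of F) (mset_set (P - {B0} - {B}))"
          using B P(1) by (simp add: bs mset_set_Diff image_mset_Diff)
        also have "\<dots> = image_mset (vec_of (move x g F)) (mset_set (P - {B0} - {B}))"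
          using x(1) xP P(1) by (intro image_mset_cong) (simp add: vout)
        finally show ?thesis .
      qed
      have "profile (move x g F) (attach_blocks v x P) U
          (Some (plus_vec b0 (shift f g (vec_of F B)))) d u (remove1 (vec_of F B) bs)"
      proof (rule profile_Some)
        show "B0 \<union> B \<in> attach_blocks v x P" unfolding att by simp
        show "move x g F New \<inter> (B0 \<union> B) \<noteq> {}" using newF[OF x(1)] B0 by simp
        show "vec_of (move x g F) (- \<Union>(attach_blocks v x P) - U) = d"
          unfolding Union_attach_blocks using xD by (simp add: d vout[OF x(1)])
        show "vec_of (move x g F) U = u" using xD by (simp add: u vout[OF x(1)])
        show "mset (remove1 (vec_of F B) bs) = image_mset (vec_of (move x g F)) (mset_set (attach_blocks v x P - {B0 \<union> B}))"
          unfolding att2 by (rule r)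
      qed (rule b)
      then show "?h x = W dm z ops (Some (plus_vec b0 (shift f g (vec_of F B)))) d u (remove1 (vec_of F B) bs)"
        using valid[OF x(1)] tally[OF x(1) disjoint_attach_blocks[OF P(2)]] wait by simp
    qed
    have "(\<Sum>B\<in>P. \<Sum>x\<in>F f \<inter> B. ?h x) = (\<Sum>x\<in>F f \<inter> B0. ?h x) + (\<Sum>B\<in>P - {B0}. \<Sum>x\<in>F f \<inter> B. ?h x)"
      using P(1) B0(1) by (rule sum.remove)
    also have "(\<Sum>B\<in>P - {B0}. \<Sum>x\<in>F f \<inter> B. ?h x) = (\<Sum>b\<leftarrow>bs. scale (get f b)
         (W dm z ops (Some (plus_vec b0 (shift f g b))) d u (remove1 b bs)))"
      using sum_list_profile[OF bs] P(1) 4 by simp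
    finally show ?thesis
      unfolding main split 1 2 3 Some W.simps by (simp add: add.assoc)
  next
    case None
    then have vP: "v \<notin> \<Union>P" and bs: "mset bs = image_mset (vec_of F) (mset_set P)"
      using prof v by (auto simp: profile_def)
    have att: "attach_blocks v x P = P" for x using vP by (simp add: attach_blocks_def)
    have val: "valid F P U" by fact
    have rest: "mset bs = image_mset (vec_of (move x g F)) (mset_set P)"
      if "x \<in> F f" "x \<notin> \<Union>P" for x
      unfolding bs using that P(1) by (intro image_mset_cong) (simp add: vout)
    have 1: "(\<Sum>x\<in>F f \<inter> ?D. ?h x) = scale (get f d) (W dm z ops None (shift f g d) u bs)"
      unfolding d
    proof (rule const)
      fix x assume x: "x \<in> F f" "x \<in> ?D"
      have wait: "attach_wait v x P U = U" using x vP by (auto simp: attach_wait_def)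
      have ok: "valid (move x g F) P U"
        using val x frontier_move[OF xfr[OF x(1)], of g] by (fastforce simp: valid_def split: if_splits)
      have "profile (move x g F) P U None (shift f g (vec_of F ?D)) u bs"
      proof (rule profile_None)
        have xP: "x \<notin> \<Union>P" "x \<notin> U" using x by auto
        show "move x g F New \<inter> \<Union>P = {}" using newF[OF x(1)] vP by simp
        show "mset bs = image_mset (vec_of (move x g F)) (mset_set P)" by (rule rest[OF x(1) xP(1)])
        show "vec_of (move x g F) ?D = shift f g (vec_of F ?D)" by (rule vin[OF x])
        show "vec_of (move x g F) U = u" using xP by (simp add: u vout[OF x(1)])
      qed
      then show "?h x = W dm z ops None (shift f g (vec_of F ?D)) u bs"
        using ok tally[OF x(1) P(2)] wait att by simp
    qed
    have 2: "(\<Sum>x\<in>F f \<inter> U. ?h x) = scale (get f u) (if g = None then 0 else W dm z ops None d (shift f g u) bs)"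
      unfolding u
    proof (rule const)
      fix x assume x: "x \<in> F f" "x \<in> U"
      then have xP: "x \<notin> \<Union>P" using PU by auto
      have wait: "attach_wait v x P U = U" using xP vP by (auto simp: attach_wait_def)
      have fr: "frontier (move x g F) = (if g = None then frontier F - {x} else frontier F)"
        by (rule frontier_move[OF xfr[OF x(1)]])
      have ok: "valid (move x g F) P U \<longleftrightarrow> g \<noteq> None"
        using val x fr by (auto simp: valid_def)
      have "profile (move x g F) P U None d (shift f g (vec_of F U)) bs"
      proof (rule profile_None)
        show "move x g F New \<inter> \<Union>P = {}" using newF[OF x(1)] vP by simp
        show "mset bs = image_mset (vec_of (move x g F)) (mset_set P)" by (rule rest[OF x(1) xP])
        show "vec_of (move x g F) ?D = d" using x by (simp add: d vout[OF x(1)])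
        show "vec_of (move x g F) U = shift f g (vec_of F U)" by (rule vin[OF x])
      qed
      then show "?h x = (if g = None then 0 else W dm z ops None d (shift f g (vec_of F U)) bs)"
        using ok tally[OF x(1) P(2)] wait att by simp
    qed
    have 3: "(\<Sum>x\<in>F f \<inter> B. ?h x) = scale (get f (vec_of F B)) (if is_zero (shift f g (vec_of F B)) then 0 else
        (if get New u = 0 then W dm z ops None d u (shift f g (vec_of F B) # remove1 (vec_of F B) bs)
         else W dm z ops None (inc New d) (dec New u) (shift f g (vec_of F B) # remove1 (vec_of F B) bs)))"
      if B: "B \<in> P" for B
    proof (rule const)
      fix x assume x: "x \<in> F f" "x \<in> B"
      have vB: "v \<notin> B" using vP B by auto
      have wait: "attach_wait v x P U = U - {v}" using x B vP by (auto simp: attach_wait_def)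
      have xP: "x \<notin> \<Union>(P - {B})" using x B P by (auto simp: disjoint_def)
      have fr: "frontier (move x g F) = (if g = None then frontier F - {x} else frontier F)"
        by (rule frontier_move[OF xfr[OF x(1)]])
      have xD: "x \<notin> U" "x \<notin> ?D" using x B PU by auto
      have "is_zero (shift f g (vec_of F B)) \<longleftrightarrow> B \<inter> frontier (move x g F) = {}"
        using is_zero_vec_of[OF classes_ok_move[OF F], of x g B] vin[OF x] by simp
      moreover have "B' \<inter> frontier (move x g F) \<noteq> {}" if "B' \<in> P" "B' \<noteq> B" for B'
      proof -
        have "x \<notin> B'" using xP that by blast
        then have "B' \<inter> frontier (move x g F) = B' \<inter> frontier F" unfolding fr by auto
        moreover have "B' \<inter> frontier F \<noteq> {}" using val that(1) by (simp add: valid_def)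
        ultimately show ?thesis by simp
      qed
      moreover have "U - {v} \<subseteq> frontier (move x g F)" using PU fr xD by auto
      ultimately have ok: "valid (move x g F) P (U - {v}) \<longleftrightarrow> \<not> is_zero (shift f g (vec_of F B))"
        using B unfolding valid_def by blast
      have r: "mset (shift f g (vec_of F B) # remove1 (vec_of F B) bs) = image_mset (vec_of (move x g F)) (mset_set P)"
      proof -
        have "mset (remove1 (vec_of F B) bs) = image_mset (vec_of F) (mset_set (P - {B}))"
          using B P(1) by (simp add: bs mset_set_Diff image_mset_Diff)
        also have "\<dots> = image_mset (vec_of (move x g F)) (mset_set (P - {B}))"
          using x(1) xP P(1) by (intro image_mset_cong) (simp add: vout)
        finally have "mset (remove1 (vec_of F B) bs) = image_mset (vec_of (move x g F)) (mset_set (P - {B}))" .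
        moreover have "mset_set P = add_mset B (mset_set (P - {B}))"
          using B P(1) by (rule mset_set.remove[rotated])
        ultimately show ?thesis using vin[OF x] by simp
      qed
      have u0: "get New u = 0 \<longleftrightarrow> v \<notin> U" by (simp add: u v)
      have "profile (move x g F) P (U - {v}) None (if v \<in> U then inc New d else d)
          (if v \<in> U then dec New u else u) (shift f g (vec_of F B) # remove1 (vec_of F B) bs)"
      proof (cases "v \<in> U")
        case False
        then show ?thesis
          using vP newF[OF x(1)] r xD vout[OF x(1)]
          by (intro profile_None) (simp_all add: u d)
      next
        case True
        have D: "- \<Union>P - (U - {v}) = insert v ?D" using vP True by auto
        have "vec_of F (insert v ?D) = inc New (vec_of F ?D)"
          using v True by (intro vec_of_insert[OF F]) auto
        moreover have "vec_of F (U - {v}) = dec New (vec_of F U)"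
          using v True by (intro vec_of_remove[OF F]) auto
        moreover have "x \<notin> insert v ?D" "x \<notin> U - {v}" using xD xv[OF x(1)] by auto
        ultimately show ?thesis
          using vP newF[OF x(1)] r True vout[OF x(1)]
          by (intro profile_None) (simp_all add: u d D)
      qed
      then show "?h x = (if is_zero (shift f g (vec_of F B)) then 0 else
        (if get New u = 0 then W dm z ops None d u (shift f g (vec_of F B) # remove1 (vec_of F B) bs)
         else W dm z ops None (inc New d) (dec New u) (shift f g (vec_of F B) # remove1 (vec_of F B) bs)))"
        using ok tally[OF x(1) P(2)] wait att u0 by (cases "v \<in> U") simp_all
    qed
    have "(\<Sum>B\<in>P. \<Sum>x\<in>F f \<inter> B. ?h x) = (\<Sum>b\<leftarrow>bs. scale (get f b) (if is_zero (shift f g b) then 0 else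
        (if get New u = 0 then W dm z ops None d u (shift f g b # remove1 b bs)
         else W dm z ops None (inc New d) (dec New u) (shift f g b # remove1 b bs))))"
      using sum_list_profile[OF bs P(1)] 3 by simp
    then show ?thesis
      unfolding main split 1 2 None W.simps scale_if by simp
  qed
qed

section \<open>Growing graphs\<close>

lemma tally_add:
  assumes F: "classes_ok F" and new: "F New = {}" and t: "t \<notin> frontier F" "t \<notin> \<Union>P" "t \<notin> U"
    and P: "finite P" "disjoint P"
  shows "tally dm z (Add free # ops) F P U =
    tally dm z ops (F(New := {t})) (insert {t} P) U +
    (if free then tally dm z ops (F(New := {t})) P (if dm then insert t U else U) else 0)"
proof -
  let ?F = "F(New := {t})"
  obtain m d u bs where prof: "profile F P U m d u bs" using profile_exists[OF P(1)] .
  then have m: "m = None" using new by (cases m) (auto simp: profile_def)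
  then have d: "d = vec_of F (- \<Union>P - U)" and u: "u = vec_of F U"
    and bs: "mset bs = image_mset (vec_of F) (mset_set P)"
    using prof by (simp_all add: profile_def)
  have vec: "vec_of ?F B = (if t \<in> B then inc New (vec_of F B) else vec_of F B)" for B
    by (rule vec_eqI) (simp add: get_upd new)
  have tally: "tally dm z ops ?F P' U' = W dm z ops m' d' u' bs'"
    if "disjoint P'" "profile ?F P' U' m' d' u' bs'" for P' U' m' d' u' bs'
    by (rule tally_eq[where v = t]) (use that in simp_all)
  have t0: "{t} \<notin> P" "\<And>B. B \<in> P \<Longrightarrow> t \<notin> B" using t by auto
  have bs': "mset bs = image_mset (vec_of ?F) (mset_set P)"
    unfolding bs using P(1) t0 by (intro image_mset_cong) (simp add: vec)
  have one: "vec_of ?F {t} = V 1 0 0 0 0"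
  proof (rule vec_eqI)
    fix c
    have "c \<noteq> New \<Longrightarrow> t \<notin> F c" using t by (auto simp: frontier_def)
    then show "get c (vec_of ?F {t}) = get c (V 1 0 0 0 0)"
      by (cases c) (simp_all add: get.simps)
  qed
  have 1: "tally dm z ops ?F (insert {t} P) U = W dm z ops (Some (V 1 0 0 0 0)) d u bs"
  proof (rule tally)
    show "disjoint (insert {t} P)" using P t0 by (auto simp: disjoint_def)
    show "profile ?F (insert {t} P) U (Some (V 1 0 0 0 0)) d u bs"
    proof (rule profile_Some[where ?B0.0 = "{t}"])
      \<comment> \<open>The complement changes only by \<open>t\<close>, which is not on the old
        frontier and hence invisible to \<open>vec_of F\<close>.\<close>
      have "vec_of ?F (- \<Union>(insert {t} P) - U) = vec_of F (- \<Union>(insert {t} P) - U)"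
        by (simp add: vec)
      also have "\<dots> = d"
        unfolding d by (rule vec_of_cong) (use t in auto)
      finally show "vec_of ?F (- \<Union>(insert {t} P) - U) = d" .
      show "vec_of ?F {t} = V 1 0 0 0 0" by (rule one)
    qed (use t t0 bs' in \<open>simp_all add: vec u\<close>)
  qed
  have 2: "tally dm z ops ?F P (if dm then insert t U else U) =
     (if dm then W dm z ops None d (inc New u) bs else W dm z ops None (inc New d) u bs)"
  proof (cases dm)
    case True
    have "profile ?F P (insert t U) None d (inc New u) bs"
    proof (rule profile_None)
      have "vec_of F (- \<Union>P - insert t U) = d"
        unfolding d by (rule vec_of_cong) (use t in auto)
      then show "vec_of ?F (- \<Union>P - insert t U) = d" by (simp add: vec)
      have "vec_of F (insert t U) = u"
        unfolding u by (rule vec_of_cong) (use t in auto)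
      then show "vec_of ?F (insert t U) = inc New u" by (simp add: vec)
    qed (use t t0 bs' in auto)
    then show ?thesis using tally[OF P(2)] True by simp
  next
    case False
    have "profile ?F P U None (inc New d) u bs"
      by (rule profile_None) (use t t0 bs' in \<open>simp_all add: vec d u\<close>)
    then show ?thesis using tally[OF P(2)] False by simp
  qed
  have "tally dm z (Add free # ops) F P U = W dm z (Add free # ops) None d u bs"
    using tally_eq[OF P(2) _ prof, of t] new m by simp
  then show ?thesis unfolding W.simps 1 2 by simp
qed

lemma tally_merge:
  assumes F: "classes_ok F" and new: "F New \<subseteq> {v}" and ab: "a \<noteq> b" "b \<noteq> New"
    and P: "finite P" "disjoint P"
  shows "tally dm z (Mv a b # ops) F P U = tally dm z ops (merge a b F) P U"
proof -
  let ?F = "merge a b F"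
  obtain m d u bs where prof: "profile F P U m d u bs" using profile_exists[OF P(1)] .
  then have d: "d = vec_of F (- \<Union>P - U)" and u: "u = vec_of F U" by (simp_all add: profile_def)
  note vec = vec_of_merge[OF F ab(1)]
  have newF: "?F New = (if a = New then {} else F New)" using ab by (simp add: merge_def)
  have newv: "?F New \<subseteq> {v}" using newF new by (simp split: if_splits)
  have tally: "tally dm z ops ?F P U = W dm z ops m' d' u' bs'"
    if "profile ?F P U m' d' u' bs'" for m' d' u' bs'
    by (rule tally_eq[where v = v, OF P(2)], rule newv, rule that)
  have main: "tally dm z (Mv a b # ops) F P U = W dm z (Mv a b # ops) m d u bs"
    using tally_eq[OF P(2) new prof] .
  have map: "mset (map (pour a b) bs) = image_mset (vec_of ?F) (mset_set Q)"
    if "mset bs = image_mset (vec_of F) (mset_set Q)" for Q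
  proof -
    have "vec_of ?F = pour a b \<circ> vec_of F" by (rule ext) (simp add: vec)
    then show ?thesis using that by (simp add: image_mset.compositionality)
  qed
  show ?thesis
  proof (cases m)
    case None
    then have "F New \<inter> \<Union>P = {}" "mset bs = image_mset (vec_of F) (mset_set P)"
      using prof by (simp_all add: profile_def)
    then have "profile ?F P U None (pour a b d) (pour a b u) (map (pour a b) bs)"
      using map[of P] by (intro profile_None) (auto simp: newF vec d u)
    then show ?thesis using tally main None by simp
  next
    case (Some b0)
    then obtain B0 where B0: "B0 \<in> P" "F New \<inter> B0 \<noteq> {}" "b0 = vec_of F B0"
      and bs: "mset bs = image_mset (vec_of F) (mset_set (P - {B0}))"
      using prof by (auto simp: profile_def)
    show ?thesis
    proof (cases "a = New")
      case True
      have "mset (pour a b b0 # map (pour a b) bs) = image_mset (vec_of ?F) (mset_set P)"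
      proof -
        have "mset_set P = add_mset B0 (mset_set (P - {B0}))"
          using P(1) B0(1) by (rule mset_set.remove)
        then show ?thesis using map[OF bs] by (simp add: vec B0)
      qed
      then have "profile ?F P U None (pour a b d) (pour a b u) (pour a b b0 # map (pour a b) bs)"
      proof (rule profile_None[rotated])
        show "?F New \<inter> \<Union>P = {}" unfolding newF using True by simp
      qed (simp_all only: vec d u)
      then show ?thesis using tally main Some True by simp
    next
      case False
      have "profile ?F P U (Some (pour a b b0)) (pour a b d) (pour a b u) (map (pour a b) bs)"
        using False map[OF bs] B0 by (intro profile_Some[OF B0(1)]) (auto simp: newF vec d u)
      then show ?thesis using tally main Some False by simp
    qed
  qed
qed

section \<open>Sizes, degrees and simplicity of the growing graph\<close>

text \<open>All vertices of a class share one degree, and those that have left the frontier have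
  full degree \<open>r\<close>. The last clause confines the neighbours of the new vertex to the
  classes in \<open>tc\<close>; it is what excludes double edges.\<close>

definition state_ok :: "nat \<Rightarrow> nat \<Rightarrow> (nat \<times> nat) set \<Rightarrow> classes \<Rightarrow> vec \<Rightarrow> vec \<Rightarrow> cls list \<Rightarrow> bool" where
  "state_ok r t E F sz dg tc \<longleftrightarrow>
     classes_ok F \<and> frontier F \<subseteq> {..<t} \<and> (\<forall>c. card (F c) = get c sz) \<and>
     E \<subseteq> {..<t} \<times> {..<t} \<and> sym E \<and> irrefl E \<and>
     (\<forall>c. \<forall>x\<in>F c. card (E `` {x}) = get c dg) \<and>
     (\<forall>x<t. x \<notin> frontier F \<longrightarrow> card (E `` {x}) = r) \<and>
     (\<forall>c. c \<notin> set tc \<longrightarrow> (\<forall>x\<in>F c. \<forall>v\<in>F New. (v, x) \<notin> E))"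

text \<open>Sizes and degrees of the classes do not depend on the choices made, so a program can be checked
  symbolically. The list \<open>tc\<close> contains the classes that may hold neighbours of the new vertex, and
  the multiplier collects the numbers of choices.\<close>

fun srun :: "nat \<Rightarrow> oper list \<Rightarrow> nat \<times> vec \<times> vec \<times> cls list \<Rightarrow> (nat \<times> vec \<times> vec \<times> cls list) option" where
  "srun r [] s = Some s"
| "srun r (Add free # ops) (k, sz, dg, tc) =
     (if get New sz = 0 then srun r ops (k, upd New (\<lambda>_. 1) sz, upd New (\<lambda>_. 0) dg, []) else None)"
| "srun r (Mv a b # ops) (k, sz, dg, tc) =
     (if a \<noteq> b \<and> b \<noteq> New \<and> get New sz \<le> 1 \<and> (get a sz = 0 \<or> get b sz = 0 \<or> get a dg = get b dg)
      then srun r ops (k, pour a b sz, if get a sz = 0 then dg else upd b (\<lambda>_. get a dg) dg,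
             if a \<in> set tc then b # tc else tc)
      else None)"
| "srun r (Att f g # ops) (k, sz, dg, tc) =
     (if f \<noteq> New \<and> f \<notin> set tc \<and> get New sz = 1 \<and> 0 < get f sz then
        case g of
          None \<Rightarrow>
            if Suc (get f dg) = r then srun r ops (k * get f sz, dec f sz, inc New dg, tc) else None
        | Some c \<Rightarrow>
            if c \<noteq> New \<and> (get c (dec f sz) = 0 \<or> get c dg = Suc (get f dg))
            then srun r ops (k * get f sz, inc c (dec f sz), inc New (upd c (\<lambda>_. Suc (get f dg)) dg), c # tc)
            else None
      else None)"

lemma frontier_add:
  assumes new: "F New = {}"
  shows "frontier (F(New := {t})) = insert t (frontier F)"
proof
  show "frontier (F(New := {t})) \<subseteq> insert t (frontier F)"
    by (auto simp: frontier_def split: if_splits)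
  have "F c \<subseteq> (F(New := {t})) c" for c using new by simp
  then have "frontier F \<subseteq> frontier (F(New := {t}))" unfolding frontier_def by blast
  moreover have "t \<in> (F(New := {t})) New" by simp
  ultimately show "insert t (frontier F) \<subseteq> frontier (F(New := {t}))" unfolding frontier_def by blast
qed

lemma state_ok_add:
  assumes "state_ok r t E F sz dg tc" "get New sz = 0"
  shows "state_ok r (Suc t) E (F(New := {t})) (upd New (\<lambda>_. 1) sz) (upd New (\<lambda>_. 0) dg) []"
proof -
  have F: "classes_ok F" "frontier F \<subseteq> {..<t}" and E: "E \<subseteq> {..<t} \<times> {..<t}"
    using assms by (simp_all add: state_ok_def)
  have "card (F New) = 0" "finite (F New)" using assms by (simp_all add: state_ok_def classes_ok_def)
  then have new: "F New = {}" by simp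
  have tF: "t \<notin> F c" for c using F by (auto simp: frontier_def)
  note fr = frontier_add[of F t, OF new]
  have Et: "E `` {t} = {}" "\<And>x. (t, x) \<notin> E" using E by auto
  have "classes_ok (F(New := {t}))" using F tF by (auto simp: classes_ok_def)
  moreover have "E \<subseteq> {..<Suc t} \<times> {..<Suc t}" using E by auto
  ultimately show ?thesis
    using assms(1) fr F Et unfolding state_ok_def by (auto simp: get_upd less_Suc_eq)
qed

lemma state_ok_merge:
  assumes wf: "state_ok r t E F sz dg tc" and ab: "a \<noteq> b" "b \<noteq> New"
    and deg: "get a sz = 0 \<or> get b sz = 0 \<or> get a dg = get b dg"
  shows "state_ok r t E (merge a b F) (pour a b sz) (if get a sz = 0 then dg else upd b (\<lambda>_. get a dg) dg)
    (if a \<in> set tc then b # tc else tc)"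
proof -
  have F: "classes_ok F" using wf by (simp add: state_ok_def)
  have card: "card (F c) = get c sz" for c using wf by (simp add: state_ok_def)
  have fin: "finite (F c)" for c using F by (simp add: classes_ok_def)
  have empty: "F c = {} \<longleftrightarrow> get c sz = 0" for c using card fin by (metis card_0_eq)
  have dgF: "card (E `` {x}) = get c dg" if "x \<in> F c" for x c using wf that by (simp add: state_ok_def)
  have "card (F a \<union> F b) = get a sz + get b sz"
    using F ab card by (subst card_Un_disjoint) (auto simp: classes_ok_def)
  then have 1: "card (merge a b F c) = get c (pour a b sz)" for c
    using card ab by (auto simp: merge_def pour_def get_upd)
  have 2: "card (E `` {x}) = get c (if get a sz = 0 then dg else upd b (\<lambda>_. get a dg) dg)"
    if "x \<in> merge a b F c" for x c
    using that deg empty ab dgF by (auto simp: merge_def get_upd split: if_splits)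
  have 3: "(v, x) \<notin> E" if "c \<notin> set (if a \<in> set tc then b # tc else tc)"
    "x \<in> merge a b F c" "v \<in> merge a b F New" for c x v
  proof -
    have "v \<in> F New" "a \<noteq> New" using that(3) ab by (auto simp: merge_def split: if_splits)
    moreover have "x \<in> F c \<and> c \<notin> set tc \<or> x \<in> F a \<and> a \<notin> set tc"
      using that by (auto simp: merge_def split: if_splits)
    ultimately show ?thesis using wf unfolding state_ok_def by blast
  qed
  show ?thesis
    using wf classes_ok_merge[OF F] 1 2 3 unfolding state_ok_def frontier_merge by blast
qed

text \<open>Because \<open>f\<close> is not in \<open>tc\<close>, the edge is really new and both
  end degrees grow by exactly one. The target class keeps a common degree, since apart from
  \<open>x\<close> it is empty or already has the raised degree.\<close>

lemma state_ok_attach: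
  assumes wf: "state_ok r t E F sz dg tc" and f: "f \<noteq> New" "f \<notin> set tc" and v: "F New = {v}"
    and x: "x \<in> F f"
    and g: "case g of None \<Rightarrow> Suc (get f dg) = r
      | Some c \<Rightarrow> c \<noteq> New \<and> (get c (dec f sz) = 0 \<or> get c dg = Suc (get f dg))"
  shows "state_ok r t (E \<union> {(v, x), (x, v)}) (move x g F) (shift f g sz)
    (inc New (case g of None \<Rightarrow> dg | Some c \<Rightarrow> upd c (\<lambda>_. Suc (get f dg)) dg))
    (case g of None \<Rightarrow> tc | Some c \<Rightarrow> c # tc)"
    (is "state_ok r t ?E ?F _ ?dg ?tc")
proof -
  have F: "classes_ok F" and fr: "frontier F \<subseteq> {..<t}" and E: "E \<subseteq> {..<t} \<times> {..<t}" "sym E" "irrefl E"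
    using wf by (simp_all add: state_ok_def)
  have card: "card (F c) = get c sz" for c using wf by (simp add: state_ok_def)
  have fin: "finite (F c)" for c using F by (simp add: classes_ok_def)
  have dgF: "card (E `` {x}) = get c dg" if "x \<in> F c" for x c using wf that by (simp add: state_ok_def)
  have xc: "x \<in> F c \<longleftrightarrow> c = f" for c using F x by (auto simp: classes_ok_def)
  have vc: "v \<in> F c \<longleftrightarrow> c = New" for c using F v unfolding classes_ok_def by blast
  have xv: "x \<noteq> v" using xc vc f x by auto
  have xt: "x < t" "v < t" using x v fr by (auto simp: frontier_def)
  have nE: "(v, x) \<notin> E" "(x, v) \<notin> E"
    using wf f x v E(2) unfolding state_ok_def by (auto dest: symD)
  have finE: "finite (E `` {y})" for y
    using E(1) by (rule_tac finite_subset[of _ "{..<t}"]) auto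
  have deg: "card (?E `` {y}) = (if y = x \<or> y = v then Suc (card (E `` {y})) else card (E `` {y}))" for y
  proof -
    have "?E `` {y} = (if y = x then insert v (E `` {x}) else if y = v then insert x (E `` {v}) else E `` {y})"
      using xv by auto
    then show ?thesis using xv nE finE by auto
  qed
  have mem: "y \<in> ?F c \<longleftrightarrow> (if y = x then g = Some c else y \<in> F c)" for y c
    using xc by (auto simp: move_def)
  have 1: "card (?F c) = get c (shift f g sz)" for c
  proof -
    \<comment> \<open>The sizes are the class vector of the whole universe, so their change is an
      instance of \<open>vec_of_move\<close>.\<close>
    have "vec_of F UNIV = sz" by (rule vec_eqI) (simp add: card)
    then have "vec_of ?F UNIV = shift f g sz" using vec_of_move[OF F x, of g UNIV] by simp
    then show ?thesis by (metis Int_UNIV_right get_vec_of)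
  qed
  have 2: "card (?E `` {y}) = get c ?dg" if y: "y \<in> ?F c" for y c
  proof (cases "y = x")
    case True
    then have "g = Some c" using y mem by simp
    then show ?thesis using g True dgF[OF x] deg by (auto simp: get_upd)
  next
    case False
    then have yF: "y \<in> F c" using y mem by simp
    show ?thesis
    proof (cases "y = v")
      case True
      then have "c = New" using yF vc by simp
      then show ?thesis using g True deg[of y] dgF[OF yF] by (auto simp: get_upd split: option.splits)
    next
      case nv: False
      then have cN: "c \<noteq> New" using yF v by auto
      \<comment> \<open>Some vertex besides \<open>x\<close> already lies in class \<open>c\<close>;
        if \<open>c\<close> is the target class, this excludes the empty alternative in the
        assumption on \<open>g\<close> and leaves equality of degrees.\<close>
      have "get c (dec f sz) \<noteq> 0" 
      proof -
        have "F c - {x} \<noteq> {}" using yF False by auto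
        then have "card (F c - {x}) \<noteq> 0" using fin by simp
        then show ?thesis using card xc fin by (cases "c = f") (auto simp: get_upd)
      qed
      then show ?thesis using g cN nv False deg[of y] dgF[OF yF] by (auto simp: get_upd split: option.splits)
    qed
  qed
  have 3: "card (?E `` {y}) = r" if "y < t" "y \<notin> frontier ?F" for y
  proof (cases "y = x")
    case True
    then have "g = None" using that(2) mem by (auto simp: frontier_def)
    then show ?thesis using g deg True dgF[OF x] by simp
  next
    case False
    then have "y \<notin> frontier F" using that(2) mem by (auto simp: frontier_def)
    moreover from this have "y \<noteq> v" using v by (auto simp: frontier_def)
    ultimately show ?thesis using wf that False deg unfolding state_ok_def by simp
  qed
  have 4: "(w, y) \<notin> ?E" if "c \<notin> set ?tc" "y \<in> ?F c" "w \<in> ?F New" for c y w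
  proof -
    have wv: "w = v" using that(3) mem g v by (auto split: if_splits)
    have "y \<noteq> x" using that(1,2) mem by auto
    moreover from this have "y \<in> F c" using that(2) mem by simp
    moreover have "c \<notin> set tc" using that(1) by (auto split: option.splits)
    ultimately show ?thesis using wf wv v xv unfolding state_ok_def by auto
  qed
  have "frontier ?F \<subseteq> {..<t}"
  proof -
    have "x \<in> frontier F" using x by (auto simp: frontier_def)
    then show ?thesis using fr frontier_move[of x F g] by auto
  qed
  moreover have "sym ?E" using E(2) by (auto simp: sym_def)
  moreover have "irrefl ?E" using E(3) xv by (auto simp: irrefl_def)
  moreover have "?E \<subseteq> {..<t} \<times> {..<t}" using E(1) xt by auto
  ultimately show ?thesis
    unfolding state_ok_def using classes_ok_move[OF F] 1 2 3 4
    by (intro conjI allI ballI impI) assumption+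
qed

section \<open>Runs of a program\<close>

text \<open>Injectivity on the underlying sets makes the size of a family a count of distinct vertex
  subsets.\<close>

definition fam_ok :: "bool \<Rightarrow> nat \<Rightarrow> (nat \<times> nat) set \<Rightarrow> classes \<Rightarrow> config set \<Rightarrow> bool" where
  "fam_ok dm t E F fam \<longleftrightarrow> finite fam \<and> inj_on (\<lambda>c. \<Union>(fst c)) fam \<and> (\<forall>c\<in>fam. sound dm t E F c)"

lemma soundD:
  assumes "sound dm t E F (P, U)" and "frontier F \<subseteq> {..<t}"
  shows "finite P" "disjoint P" "\<Union>P \<subseteq> {..<t}" "U \<subseteq> frontier F - \<Union>P" "valid F P U"
proof -
  show P: "\<Union>P \<subseteq> {..<t}" and "disjoint P" and U: "U \<subseteq> frontier F - \<Union>P"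
    using assms(1) by (simp_all add: sound_def)
  show "finite P" using P by (meson finite_UnionD finite_lessThan finite_subset)
  have "\<forall>B\<in>P. B \<inter> frontier F \<noteq> {}" using assms(1) by (simp add: sound_def)
  then show "valid F P U" using U unfolding valid_def by blast
qed

lemma soundI:
  assumes "\<Union>P \<subseteq> {..<t}" "disjoint P" "U \<subseteq> frontier F - \<Union>P"
    and "\<And>B. B \<in> P \<Longrightarrow> B \<inter> frontier F \<noteq> {}"
    and "\<And>B x y. B \<in> P \<Longrightarrow> x \<in> B \<Longrightarrow> y \<in> B \<Longrightarrow> (x, y) \<in> (E \<inter> B \<times> B)\<^sup>*"
    and "\<And>x. dm \<Longrightarrow> x < t \<Longrightarrow> x \<notin> \<Union>P \<Longrightarrow> x \<in> U \<or> (\<exists>y\<in>\<Union>P. (x, y) \<in> E)"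
  shows "sound dm t E F (P, U)"
  unfolding sound_def prod.case using assms by (intro conjI ballI impI allI) assumption+

lemma sound_link:
  assumes "sound dm t E F (P, U)" "B \<in> P" "x \<in> B" "y \<in> B"
  shows "(x, y) \<in> (E \<inter> B \<times> B)\<^sup>*"
  using assms by (simp add: sound_def)

lemma sound_dom:
  assumes "sound dm t E F (P, U)" "dm" "x < t" "x \<notin> \<Union>P"
  shows "x \<in> U \<or> (\<exists>y\<in>\<Union>P. (x, y) \<in> E)"
  using assms by (simp add: sound_def)

lemma sound_add_in:
  assumes s: "sound dm t E F (P, U)" and F: "frontier F \<subseteq> {..<t}" "F New = {}"
  shows "sound dm (Suc t) E (F(New := {t})) (insert {t} P, U)"
proof (rule soundI)
  note sd = soundD[OF s F(1)] and fr = frontier_add[of F t, OF F(2)]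
  show "\<Union>(insert {t} P) \<subseteq> {..<Suc t}" using sd(3) by auto
  have t: "t \<notin> \<Union>P" using sd(3) by auto
  then show "disjoint (insert {t} P)" using sd(2) by (auto simp: disjoint_def)
  show "U \<subseteq> frontier (F(New := {t})) - \<Union>(insert {t} P)"
    using sd(4) F(1) unfolding fr by auto
  show "B \<inter> frontier (F(New := {t})) \<noteq> {}" if "B \<in> insert {t} P" for B
    using that sd(5) unfolding fr valid_def by auto
  show "(x, y) \<in> (E \<inter> B \<times> B)\<^sup>*" if "B \<in> insert {t} P" "x \<in> B" "y \<in> B" for B x y
    using that sound_link[OF s] by auto
  show "x \<in> U \<or> (\<exists>y\<in>\<Union>(insert {t} P). (x, y) \<in> E)"
    if "dm" "x < Suc t" "x \<notin> \<Union>(insert {t} P)" for x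
    using that sound_dom[OF s, of x] by auto
qed

lemma sound_add_out:
  assumes s: "sound dm t E F (P, U)" and F: "frontier F \<subseteq> {..<t}" "F New = {}"
  shows "sound dm (Suc t) E (F(New := {t})) (P, if dm then insert t U else U)"
proof (rule soundI)
  note sd = soundD[OF s F(1)] and fr = frontier_add[of F t, OF F(2)]
  show "\<Union>P \<subseteq> {..<Suc t}" using sd(3) by auto
  show "disjoint P" by (rule sd(2))
  have "t \<notin> \<Union>P" using sd(3) by auto
  then show "(if dm then insert t U else U) \<subseteq> frontier (F(New := {t})) - \<Union>P"
    using sd(4) unfolding fr by auto
  show "B \<inter> frontier (F(New := {t})) \<noteq> {}" if "B \<in> P" for B
    using that sd(5) unfolding fr valid_def by auto
  show "(x, y) \<in> (E \<inter> B \<times> B)\<^sup>*" if "B \<in> P" "x \<in> B" "y \<in> B" for B x y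
    using that by (rule sound_link[OF s])
  show "x \<in> (if dm then insert t U else U) \<or> (\<exists>y\<in>\<Union>P. (x, y) \<in> E)"
    if "dm" "x < Suc t" "x \<notin> \<Union>P" for x
    using that sound_dom[OF s that(1), of x] by (cases "x = t") auto
qed

lemma sound_merge: "sound dm t E F c \<Longrightarrow> sound dm t E (merge a b F) c"
  by (simp add: sound_def frontier_merge)

definition attach_config :: "nat \<Rightarrow> nat \<Rightarrow> config \<Rightarrow> config" where
  "attach_config v x = (\<lambda>(P, U). (attach_blocks v x P, attach_wait v x P U))"

definition attach_fam :: "nat \<Rightarrow> nat \<Rightarrow> cls option \<Rightarrow> classes \<Rightarrow> config set \<Rightarrow> config set" where
  "attach_fam v x g F fam = attach_config v x ` {c \<in> fam. case_prod (valid (move x g F)) (attach_config v x c)}"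

lemma Union_attach_config: "\<Union>(fst (attach_config v x c)) = \<Union>(fst c)"
  by (simp add: attach_config_def split: prod.split)

text \<open>An attachment regroups blocks but never changes the underlying set, so distinct sets
  stay distinct.\<close>

lemma inj_attach_config: "inj_on (\<lambda>c. \<Union>(fst c)) A \<Longrightarrow> inj_on (attach_config v x) A"
  unfolding inj_on_def using Union_attach_config by metis

lemma fam_ok_attach:
  assumes "fam_ok dm t E F fam"
  shows "fam_ok dm t (E \<union> {(v, x), (x, v)}) (move x g F) (attach_fam v x g F fam)"
proof -
  let ?A = "{c \<in> fam. case_prod (valid (move x g F)) (attach_config v x c)}"
  have "sound dm t (E \<union> {(v, x), (x, v)}) (move x g F) (attach_config v x c)" if "c \<in> ?A" for c
  proof (cases c)
    case (Pair P U)
    then have "sound dm t E F (P, U)" "valid (move x g F) (attach_blocks v x P) (attach_wait v x P U)"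
      using that assms by (auto simp: fam_ok_def attach_config_def)
    then show ?thesis unfolding Pair attach_config_def prod.case by (rule sound_attach)
  qed
  moreover have "inj_on (\<lambda>c. \<Union>(fst c)) (attach_config v x ` ?A)"
  proof (rule inj_on_imageI)
    have "inj_on (\<lambda>c. \<Union>(fst c)) ?A"
      by (rule inj_on_subset[of _ fam]) (use assms in \<open>simp_all add: fam_ok_def\<close>)
    then show "inj_on ((\<lambda>c. \<Union>(fst c)) \<circ> attach_config v x) ?A"
      by (simp add: comp_def Union_attach_config)
  qed
  ultimately show ?thesis
    using assms by (simp add: fam_ok_def attach_fam_def)
qed

lemma sum_attach_fam:
  assumes "fam_ok dm t E F fam"
  shows "(\<Sum>c\<in>attach_fam v x g F fam. h c) =
    (\<Sum>c\<in>fam. if case_prod (valid (move x g F)) (attach_config v x c) then h (attach_config v x c) else (0::int))"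
proof -
  let ?A = "{c \<in> fam. case_prod (valid (move x g F)) (attach_config v x c)}"
  have "inj_on (attach_config v x) ?A"
    by (rule inj_attach_config, rule inj_on_subset[of _ fam]) (use assms in \<open>simp_all add: fam_ok_def\<close>)
  then have "(\<Sum>c\<in>attach_fam v x g F fam. h c) = (\<Sum>c\<in>?A. h (attach_config v x c))"
    by (simp add: attach_fam_def sum.reindex)
  also have "\<dots> = (\<Sum>c\<in>fam. if case_prod (valid (move x g F)) (attach_config v x c) then h (attach_config v x c) else 0)"
    by (rule sum.inter_filter) (use assms in \<open>simp add: fam_ok_def\<close>)
  finally show ?thesis .
qed

text \<open>Up to the product of the class sizes, this is the expected final weight of the family
  when all attachments still to come are drawn uniformly.\<close>

definition mass :: "bool \<Rightarrow> trie \<Rightarrow> oper list \<Rightarrow> classes \<Rightarrow> config set \<Rightarrow> int" where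
  "mass dm z ops F fam = (\<Sum>(P, U)\<in>fam. tally dm z ops F P U)"

primrec adds :: "oper list \<Rightarrow> nat" where
  "adds [] = 0"
| "adds (op # ops) = (case op of Add _ \<Rightarrow> 1 | _ \<Rightarrow> 0) + adds ops"

lemma exists_ge_average:
  fixes h :: "'a \<Rightarrow> int"
  assumes "finite A" "A \<noteq> {}"
  obtains x where "x \<in> A" "(\<Sum>y\<in>A. h y) \<le> int (card A) * h x"
proof -
  have "Max (h ` A) \<in> h ` A" using assms by (intro Max_in) auto
  then obtain x where x: "x \<in> A" "Max (h ` A) = h x" by blast
  have "h y \<le> h x" if "y \<in> A" for y
    unfolding x(2)[symmetric] using assms(1) that by (intro Max_ge) auto
  then have "(\<Sum>y\<in>A. h y) \<le> int (card A) * h x"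
    using sum_bounded_above[of A h "h x"] by simp
  with x(1) show ?thesis by (rule that)
qed

text \<open>The vertex \<open>t\<close> is fresh, so the copies with and without it have different
  underlying sets: a free vertex doubles the family without collisions.\<close>

lemma fam_ok_add:
  assumes fam: "fam_ok dm t E F fam" and F: "frontier F \<subseteq> {..<t}" "F New = {}" "classes_ok F"
  obtains fam' where "fam_ok dm (Suc t) E (F(New := {t})) fam'"
    "mass dm z (Add free # ops) F fam = mass dm z ops (F(New := {t})) fam'"
    "\<not> free \<Longrightarrow> card fam' = card fam \<and> (\<forall>c\<in>fam'. t \<in> \<Union>(fst c))"
proof -
  let ?F = "F(New := {t})"
  define ins :: "config \<Rightarrow> config" where "ins = (\<lambda>(P, U). (insert {t} P, U))"
  define out :: "config \<Rightarrow> config" where "out = (\<lambda>(P, U). (P, if dm then insert t U else U))"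
  have U_ins: "\<Union>(fst (ins c)) = insert t (\<Union>(fst c))" and U_out: "\<Union>(fst (out c)) = \<Union>(fst c)" for c
    by (cases c; simp add: ins_def out_def)+
  have s: "sound dm t E F c" if "c \<in> fam" for c using fam that by (simp add: fam_ok_def)
  have t: "t \<notin> \<Union>(fst c)" if "c \<in> fam" for c
    using soundD(3)[of dm t E F "fst c" "snd c"] s[OF that] F by auto
  have inj: "inj_on (\<lambda>c. \<Union>(fst c)) fam" using fam by (simp add: fam_ok_def)
  have inj1: "inj_on ((\<lambda>c. \<Union>(fst c)) \<circ> ins) fam"
  proof (rule inj_onI)
    fix c c' assume c: "c \<in> fam" "c' \<in> fam"
      and "((\<lambda>c. \<Union>(fst c)) \<circ> ins) c = ((\<lambda>c. \<Union>(fst c)) \<circ> ins) c'"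
    then have "insert t (\<Union>(fst c)) = insert t (\<Union>(fst c'))" by (simp add: U_ins)
    then have "\<Union>(fst c) = \<Union>(fst c')" using insert_ident[OF t t, OF c] by simp
    then show "c = c'" using inj_onD[OF inj _ c] by simp
  qed
  have inj2: "inj_on ((\<lambda>c. \<Union>(fst c)) \<circ> out) fam"
    using inj by (simp add: comp_def U_out)
  note inj_ins = inj_on_imageI2[OF inj1] and inj_out = inj_on_imageI2[OF inj2]
  have fin: "finite fam" using fam by (simp add: fam_ok_def)
  have ok_ins: "fam_ok dm (Suc t) E ?F (ins ` fam)"
  proof -
    have "sound dm (Suc t) E ?F (ins c)" if "c \<in> fam" for c
      using sound_add_in[OF _ F(1,2)] s[OF that] by (cases c) (simp add: ins_def)
    moreover note inj_on_imageI[OF inj1]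
    ultimately show ?thesis using fin by (simp add: fam_ok_def)
  qed
  have ok_out: "fam_ok dm (Suc t) E ?F (out ` fam)"
  proof -
    have "sound dm (Suc t) E ?F (out c)" if "c \<in> fam" for c
      using sound_add_out[OF _ F(1,2)] s[OF that] by (cases c) (simp add: out_def)
    moreover note inj_on_imageI[OF inj2]
    ultimately show ?thesis using fin by (simp add: fam_ok_def)
  qed
  have tal: "case_prod (tally dm z (Add free # ops) F) c =
      case_prod (tally dm z ops ?F) (ins c) + (if free then case_prod (tally dm z ops ?F) (out c) else 0)"
    if "c \<in> fam" for c
  proof (cases c)
    case (Pair P U)
    then have "sound dm t E F (P, U)" using s[OF that] by simp
    note sd = soundD[OF this F(1)]
    have "t \<notin> frontier F" "t \<notin> \<Union>P" "t \<notin> U" using sd F(1) by auto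
    then show ?thesis
      unfolding Pair ins_def out_def prod.case
      by (rule tally_add[OF F(3,2) _ _ _ sd(1,2)])
  qed
  show ?thesis
  proof (cases free)
    case True
    have ne: "\<Union>(fst c) \<noteq> \<Union>(fst c')" if "c \<in> ins ` fam" "c' \<in> out ` fam" for c c'
    proof -
      have "t \<in> \<Union>(fst c)" using that(1) U_ins by blast
      moreover have "t \<notin> \<Union>(fst c')" using that(2) t U_out by (metis imageE)
      ultimately show ?thesis by metis
    qed
    then have dis: "ins ` fam \<inter> out ` fam = {}" by blast
    have "fam_ok dm (Suc t) E ?F (ins ` fam \<union> out ` fam)"
    proof -
      have "inj_on (\<lambda>c. \<Union>(fst c)) (ins ` fam \<union> out ` fam)"
      proof (rule inj_onI)
        fix c c' assume "c \<in> ins ` fam \<union> out ` fam" "c' \<in> ins ` fam \<union> out ` fam"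
          and eq: "\<Union>(fst c) = \<Union>(fst c')"
        then consider "c \<in> ins ` fam" "c' \<in> ins ` fam" | "c \<in> out ` fam" "c' \<in> out ` fam"
          using ne ne[of c' c] by (elim UnE) simp_all
        then show "c = c'"
          by cases (rule inj_onD[OF inj_on_imageI[OF inj1] eq] inj_onD[OF inj_on_imageI[OF inj2] eq]; assumption)+
      qed
      then show ?thesis using ok_ins ok_out unfolding fam_ok_def by blast
    qed
    moreover have "mass dm z (Add free # ops) F fam = mass dm z ops ?F (ins ` fam \<union> out ` fam)"
    proof -
      have "mass dm z ops ?F (ins ` fam \<union> out ` fam) = mass dm z ops ?F (ins ` fam) + mass dm z ops ?F (out ` fam)"
        unfolding mass_def using fin dis by (intro sum.union_disjoint) auto
      then show ?thesis
        using True tal by (simp add: mass_def sum.reindex inj_ins inj_out sum.distrib)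
    qed
    ultimately show ?thesis using True by (intro that) auto
  next
    case False
    have "mass dm z (Add free # ops) F fam = mass dm z ops ?F (ins ` fam)"
      using False tal by (simp add: mass_def sum.reindex inj_ins)
    moreover have "card (ins ` fam) = card fam" using inj_ins by (rule card_image)
    moreover have "\<forall>c\<in>ins ` fam. t \<in> \<Union>(fst c)" using U_ins by (metis imageE insertI1)
    ultimately show ?thesis using ok_ins by (intro that) auto
  qed
qed

text \<open>The sizes, degrees and \<open>tc\<close> after the step are the same for every choice of
  \<open>x\<close>, which allows the choice to be postponed until the masses are compared.\<close>

lemma run_step_attach:
  assumes "srun r (Att f g # ops) (k, sz, dg, tc) = Some s" and wf: "state_ok r t E F sz dg tc"
  obtains v dg' tc' where "F New = {v}" "f \<noteq> New" "g \<noteq> Some New" "0 < get f sz"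
    "srun r ops (k * get f sz, shift f g sz, dg', tc') = Some s"
    "\<And>x. x \<in> F f \<Longrightarrow> state_ok r t (E \<union> {(v, x), (x, v)}) (move x g F) (shift f g sz) dg' tc'"
proof -
  have c: "f \<noteq> New" "f \<notin> set tc" "get New sz = 1" "0 < get f sz"
    using assms(1) by (simp_all split: if_splits)
  have "card (F New) = 1" using wf c by (simp add: state_ok_def)
  then obtain v where v: "F New = {v}" by (auto simp: card_1_singleton_iff)
  let ?dg = "inc New (case g of None \<Rightarrow> dg | Some c \<Rightarrow> upd c (\<lambda>_. Suc (get f dg)) dg)"
  let ?tc = "case g of None \<Rightarrow> tc | Some c \<Rightarrow> c # tc"
  have g: "case g of None \<Rightarrow> Suc (get f dg) = r
      | Some c \<Rightarrow> c \<noteq> New \<and> (get c (dec f sz) = 0 \<or> get c dg = Suc (get f dg))"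
    using assms(1) by (auto split: if_splits option.splits)
  have s: "srun r ops (k * get f sz, shift f g sz, ?dg, ?tc) = Some s"
    using assms(1) by (auto simp: shift_def split: if_splits option.splits)
  have gN: "g \<noteq> Some New" using g by auto
  show ?thesis
    using that[OF v c(1) gN c(4) s] state_ok_attach[OF wf c(1,2) v _ g] by blast
qed

text \<open>Averaging: some choice of the attachment vertices does at least as well as the mean over all choices.\<close>

lemma run_average:
  assumes "srun r ops (k, sz, dg, tc) = Some (k', sz', dg', tc')"
    and "state_ok r t E F sz dg tc" and "fam_ok dm t E F fam"
  shows "\<exists>E' F' fam'. state_ok r (t + adds ops) E' F' sz' dg' tc' \<and> fam_ok dm (t + adds ops) E' F' fam' \<and>
    int k * mass dm z ops F fam \<le> int k' * mass dm z [] F' fam'"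
  using assms
proof (induction ops arbitrary: k sz dg tc t E F fam)
  case Nil
  then show ?case by auto
next
  case (Cons op ops)
  have wf: "state_ok r t E F sz dg tc" and fam: "fam_ok dm t E F fam" by fact+
  have F: "classes_ok F" and fr: "frontier F \<subseteq> {..<t}" and card: "card (F c) = get c sz" for c
    using wf by (simp_all add: state_ok_def)
  have fin: "finite (F c)" for c using F by (simp add: classes_ok_def)
  show ?case
  proof (cases op)
    case (Add free)
    then have sz: "get New sz = 0"
      and s: "srun r ops (k, upd New (\<lambda>_. 1) sz, upd New (\<lambda>_. 0) dg, []) = Some (k', sz', dg', tc')"
      using Cons.prems(1) by (simp_all split: if_splits)
    have new: "F New = {}" using card[of New] sz fin by simp
    obtain fam1 where fam1: "fam_ok dm (Suc t) E (F(New := {t})) fam1"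
      "mass dm z (Add free # ops) F fam = mass dm z ops (F(New := {t})) fam1"
      by (rule fam_ok_add[OF fam fr new F]) (rule that, assumption+)
    have t: "t + adds (Add free # ops) = Suc t + adds ops" by simp
    show ?thesis
      unfolding Add t fam1(2) by (rule Cons.IH[OF s state_ok_add[OF wf sz] fam1(1)])
  next
    case (Mv a b)
    then have ab: "a \<noteq> b" "b \<noteq> New" and one: "get New sz \<le> 1" and deg: "get a sz = 0 \<or> get b sz = 0 \<or> get a dg = get b dg"
      and s: "srun r ops (k, pour a b sz, if get a sz = 0 then dg else upd b (\<lambda>_. get a dg) dg,
             if a \<in> set tc then b # tc else tc) = Some (k', sz', dg', tc')"
      using Cons.prems(1) by (simp_all split: if_split_asm)
    have "card (F New) = 0 \<or> card (F New) = 1"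
      using card[of New] one by auto
    then obtain v where v: "F New \<subseteq> {v}"
      using fin[of New] by (auto simp: card_1_singleton_iff)
    have fam1: "fam_ok dm t E (merge a b F) fam"
      using fam sound_merge by (auto simp: fam_ok_def)
    have eq: "mass dm z (Mv a b # ops) F fam = mass dm z ops (merge a b F) fam"
      unfolding mass_def
    proof (rule sum.cong[OF refl])
      fix c assume c: "c \<in> fam"
      then have "sound dm t E F (fst c, snd c)" using fam by (simp add: fam_ok_def)
      note sd = soundD[OF this fr]
      show "(case c of (P, U) \<Rightarrow> tally dm z (Mv a b # ops) F P U) = (case c of (P, U) \<Rightarrow> tally dm z ops (merge a b F) P U)"
        using tally_merge[OF F v ab sd(1,2)] by (simp add: case_prod_beta)
    qed
    have t: "t + adds (Mv a b # ops) = t + adds ops" by simp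
    show ?thesis
      unfolding Mv t eq by (rule Cons.IH[OF s state_ok_merge[OF wf ab deg] fam1])
  next
    case (Att f g)
    obtain v dg1 tc1 where v: "F New = {v}" and f: "f \<noteq> New" "g \<noteq> Some New" "0 < get f sz"
      and s: "srun r ops (k * get f sz, shift f g sz, dg1, tc1) = Some (k', sz', dg', tc')"
      and wf1: "\<And>x. x \<in> F f \<Longrightarrow> state_ok r t (E \<union> {(v, x), (x, v)}) (move x g F) (shift f g sz) dg1 tc1"
      by (rule run_step_attach[OF Cons.prems(1)[unfolded Att] wf]) (rule that, assumption+)
    let ?h = "\<lambda>x. mass dm z ops (move x g F) (attach_fam v x g F fam)"
    have "F f \<noteq> {}" using f(3) card[of f] by auto
    then obtain x where x: "x \<in> F f" "(\<Sum>y\<in>F f. ?h y) \<le> int (card (F f)) * ?h x"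
      by (rule exists_ge_average[OF fin[of f], where h = ?h]) (rule that, assumption+)
    have sum: "(\<Sum>y\<in>F f. ?h y) = mass dm z (Att f g # ops) F fam"
    proof -
      have "(\<Sum>y\<in>F f. ?h y) = (\<Sum>y\<in>F f. \<Sum>c\<in>fam. if case_prod (valid (move y g F)) (attach_config v y c)
          then case_prod (tally dm z ops (move y g F)) (attach_config v y c) else 0)"
        unfolding mass_def by (simp add: sum_attach_fam[OF fam])
      also have "\<dots> = (\<Sum>c\<in>fam. \<Sum>y\<in>F f. if case_prod (valid (move y g F)) (attach_config v y c)
          then case_prod (tally dm z ops (move y g F)) (attach_config v y c) else 0)"
        by (rule sum.swap)
      also have "\<dots> = mass dm z (Att f g # ops) F fam"
        unfolding mass_def
      proof (rule sum.cong[OF refl])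
        fix c assume c: "c \<in> fam"
        obtain P U where PU: "c = (P, U)" by (cases c)
        then have "sound dm t E F (P, U)" using fam c by (simp add: fam_ok_def)
        note sd = soundD[OF this fr]
        show "(\<Sum>y\<in>F f. if case_prod (valid (move y g F)) (attach_config v y c)
          then case_prod (tally dm z ops (move y g F)) (attach_config v y c) else 0) =
          (case c of (P, U) \<Rightarrow> tally dm z (Att f g # ops) F P U)"
          unfolding PU attach_config_def prod.case
          by (rule tally_attach[OF F v f(1,2) sd(1,2,4,5), symmetric])
      qed
      finally show ?thesis .
    qed
    have "int k * mass dm z (op # ops) F fam \<le> int k * (int (card (F f)) * ?h x)"
      unfolding Att sum[symmetric] by (rule mult_left_mono[OF x(2)]) simp
    also have "\<dots> = int (k * get f sz) * ?h x"
      by (simp only: card of_nat_mult mult.assoc)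
    finally have le: "int k * mass dm z (op # ops) F fam \<le> int (k * get f sz) * ?h x" .
    have t: "t + adds (op # ops) = t + adds ops" by (simp add: Att)
    obtain E' F' fam' where "state_ok r (t + adds ops) E' F' sz' dg' tc'"
      "fam_ok dm (t + adds ops) E' F' fam'" "int (k * get f sz) * ?h x \<le> int k' * mass dm z [] F' fam'"
      using Cons.IH[OF s wf1[OF x(1)] fam_ok_attach[OF fam]] by blast
    then show ?thesis unfolding t using order_trans[OF le] by blast
  qed
qed

section \<open>Closing the graph\<close>

abbreviation "zero_vec \<equiv> V 0 0 0 0 0"
abbreviation "all_classes \<equiv> [New, Last, Pool, Queue, Temp]"

text \<open>When all new vertices are put into the set, no attachment can lose a block.\<close>

lemma run_forced:
  assumes "srun r ops (k, sz, dg, tc) = Some (k', sz', dg', tc')" and "Add True \<notin> set ops"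
    and "state_ok r t E F sz dg tc" and "fam_ok dm t E F fam" and "\<forall>c\<in>fam. F New \<subseteq> \<Union>(fst c)"
  shows "\<exists>E' F' fam'. state_ok r (t + adds ops) E' F' sz' dg' tc' \<and> fam_ok dm (t + adds ops) E' F' fam' \<and>
    card fam' = card fam \<and> (\<forall>c\<in>fam'. F' New \<subseteq> \<Union>(fst c))"
  using assms
proof (induction ops arbitrary: k sz dg tc t E F fam)
  case Nil
  then show ?case by auto
next
  case (Cons op ops)
  have wf: "state_ok r t E F sz dg tc" and fam: "fam_ok dm t E F fam"
    and new_in: "\<forall>c\<in>fam. F New \<subseteq> \<Union>(fst c)" by fact+
  have forced: "Add True \<notin> set ops" using Cons.prems(2) by simp
  have F: "classes_ok F" and fr: "frontier F \<subseteq> {..<t}" and card: "card (F c) = get c sz" for c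
    using wf by (simp_all add: state_ok_def)
  have fin: "finite (F c)" for c using F by (simp add: classes_ok_def)
  show ?case
  proof (cases op)
    case (Add free)
    then have sz: "get New sz = 0"
      and s: "srun r ops (k, upd New (\<lambda>_. 1) sz, upd New (\<lambda>_. 0) dg, []) = Some (k', sz', dg', tc')"
      using Cons.prems(1) by (simp_all split: if_splits)
    have new: "F New = {}" using card[of New] sz fin by simp
    have free: "\<not> free" using Add Cons.prems(2) by (cases free) simp_all
    obtain fam1 where fam1: "fam_ok dm (Suc t) E (F(New := {t})) fam1"
      "\<not> free \<Longrightarrow> card fam1 = card fam \<and> (\<forall>c\<in>fam1. t \<in> \<Union>(fst c))"
      by (rule fam_ok_add[OF fam fr new F]) (rule that, assumption+)
    have "\<forall>c\<in>fam1. (F(New := {t})) New \<subseteq> \<Union>(fst c)" and c: "card fam1 = card fam"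
      using fam1(2)[OF free] by simp_all
    have t: "t + adds (Add free # ops) = Suc t + adds ops" by simp
    show ?thesis
      unfolding Add t c[symmetric] by (rule Cons.IH[OF s forced state_ok_add[OF wf sz] fam1(1)]) fact
  next
    case (Mv a b)
    then have ab: "a \<noteq> b" "b \<noteq> New" and deg: "get a sz = 0 \<or> get b sz = 0 \<or> get a dg = get b dg"
      and s: "srun r ops (k, pour a b sz, if get a sz = 0 then dg else upd b (\<lambda>_. get a dg) dg,
             if a \<in> set tc then b # tc else tc) = Some (k', sz', dg', tc')"
      using Cons.prems(1) by (simp_all split: if_split_asm)
    have fam1: "fam_ok dm t E (merge a b F) fam"
      using fam by (simp add: fam_ok_def sound_merge)
    have "merge a b F New \<subseteq> F New" using ab by (auto simp: merge_def)
    then have new_in': "\<forall>c\<in>fam. merge a b F New \<subseteq> \<Union>(fst c)"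
      using new_in by (meson order_trans)
    have t: "t + adds (Mv a b # ops) = t + adds ops" by simp
    show ?thesis
      unfolding Mv t by (rule Cons.IH[OF s forced state_ok_merge[OF wf ab deg] fam1 new_in'])
  next
    case (Att f g)
    obtain v dg1 tc1 where v: "F New = {v}" and f: "f \<noteq> New" "g \<noteq> Some New" "0 < get f sz"
      and s: "srun r ops (k * get f sz, shift f g sz, dg1, tc1) = Some (k', sz', dg', tc')"
      and wf1: "\<And>x. x \<in> F f \<Longrightarrow> state_ok r t (E \<union> {(v, x), (x, v)}) (move x g F) (shift f g sz) dg1 tc1"
      by (rule run_step_attach[OF Cons.prems(1)[unfolded Att] wf]) (rule that, assumption+)
    have "F f \<noteq> {}" using f(3) card[of f] by auto
    then obtain x where x: "x \<in> F f" by blast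
    have "x \<noteq> v" using x v f(1) F unfolding classes_ok_def by (metis disjoint_iff singletonI)
    have full: "attach_fam v x g F fam = attach_config v x ` fam"
    proof -
      have all: "case_prod (valid (move x g F)) (attach_config v x c)" if c: "c \<in> fam" for c
      proof -
        obtain P U where PU: "c = (P, U)" by (cases c)
        then have "sound dm t E F (P, U)" using fam c by (simp add: fam_ok_def)
        note sd = soundD[OF this fr]
        have "F New \<subseteq> \<Union>P" using bspec[OF new_in c] PU by simp
        then have "v \<in> \<Union>P" using v by simp
        moreover have "x \<in> frontier F" "v \<in> frontier F" using x v by (auto simp: frontier_def)
        ultimately show ?thesis
          unfolding PU attach_config_def prod.case
          by (intro valid_attach[OF sd(5) _ _ \<open>x \<noteq> v\<close> _ sd(4)])
      qed
      have "{c \<in> fam. case_prod (valid (move x g F)) (attach_config v x c)} = fam"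
      proof (intro equalityI subsetI)
        fix c assume "c \<in> fam"
        then show "c \<in> {c \<in> fam. case_prod (valid (move x g F)) (attach_config v x c)}"
          by (intro CollectI conjI all)
      qed (elim CollectE conjE)
      then show ?thesis by (simp add: attach_fam_def)
    qed
    have c: "card (attach_fam v x g F fam) = card fam"
      unfolding full using fam by (intro card_image inj_attach_config) (simp add: fam_ok_def)
    have "move x g F New \<subseteq> F New"
      using f(2) by (auto simp: move_def)
    then have new_in': "\<forall>c\<in>attach_fam v x g F fam. move x g F New \<subseteq> \<Union>(fst c)"
    proof -
      have "move x g F New \<subseteq> \<Union>(fst (attach_config v x c))" if "c \<in> fam" for c
        unfolding Union_attach_config using bspec[OF new_in that] \<open>move x g F New \<subseteq> F New\<close> by (rule order_trans[rotated])
      then show ?thesis unfolding full by blast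
    qed
    have t: "t + adds (op # ops) = t + adds ops" by (simp add: Att)
    show ?thesis
      unfolding t c[symmetric] by (rule Cons.IH[OF s forced wf1[OF x] fam_ok_attach[OF fam] new_in'])
  qed
qed

section \<open>From a closed family to a regular graph\<close>

text \<open>Connectedness in the library is strong connectedness of the symmetric closure; paths in
  \<open>E\<close> within \<open>S\<close> remain paths there.\<close>

lemma connected_induced:
  fixes E :: "(nat \<times> nat) set"
  assumes "S \<noteq> {}" and link: "\<And>x y. x \<in> S \<Longrightarrow> y \<in> S \<Longrightarrow> (x, y) \<in> (E \<inter> S \<times> S)\<^sup>*"
  shows "Digraph_Component.connected (with_proj \<lparr>pverts = X, parcs = E\<rparr> \<restriction> S)"
proof -
  let ?H = "mk_symmetric (with_proj \<lparr>pverts = X, parcs = E\<rparr> \<restriction> S)"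
  have "(x, y) \<in> rtrancl_on S (parcs ?H)" if x: "x \<in> S" and "(x, y) \<in> (E \<inter> S \<times> S)\<^sup>*" for x y
    using that(2)
  proof induction
    case base
    then show ?case using x by simp
  next
    case (step y z)
    have "(y, z) \<in> parcs ?H" using step(2) by (force simp: parcs_mk_symmetric)
    then show ?case using step by (auto intro: rtrancl_on_into_rtrancl_on)
  qed
  then show ?thesis
    using assms by (auto simp: connected_def reachable_def intro!: strongly_connectedI)
qed

text \<open>The frontier is one vertex \<open>v\<close>, which lies in every set of the family. Each
  block meets the frontier and hence contains \<open>v\<close>, so disjointness leaves a single,
  connected block. A waiting vertex would be a frontier vertex outside the set, so none exists and
  the set dominates.\<close>

lemma final_graph:
  assumes wf: "state_ok r t E F (V 1 0 0 0 0) dg tc" "get New dg = r"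
    and fam: "fam_ok dm t E F fam" and new_in: "\<forall>c\<in>fam. F New \<subseteq> \<Union>(fst c)"
  shows "\<exists>G\<in>regular_graphs r t. card fam \<le> num_conn G \<and> (dm \<longrightarrow> card fam \<le> num_conn_dom G)"
proof -
  let ?G = "\<lparr>pverts = {..<t}, parcs = E\<rparr> :: nat pair_pre_digraph"
  have F: "classes_ok F" and fr: "frontier F \<subseteq> {..<t}" and card: "card (F c) = get c (V 1 0 0 0 0)" for c
    using wf by (simp_all add: state_ok_def)
  have E: "E \<subseteq> {..<t} \<times> {..<t}" "sym E" "irrefl E" using wf by (simp_all add: state_ok_def)
  have "card (F New) = 1" using card[of New] by (simp add: get.simps)
  then obtain v where v: "F New = {v}" by (auto simp: card_1_singleton_iff)
  have empty: "F c = {}" if "c \<noteq> New" for c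
    using card[of c] F that by (cases c) (auto simp: get.simps classes_ok_def)
  have frv: "frontier F = {v}"
  proof
    have "F c \<subseteq> {v}" for c using v empty by (cases "c = New") auto
    then show "frontier F \<subseteq> {v}" by (auto simp: frontier_def)
    show "{v} \<subseteq> frontier F" using v unfolding frontier_def by blast
  qed
  have deg: "card (E `` {x}) = r" if "x < t" for x
  proof (cases "x = v")
    case True
    then have "x \<in> F New" using v by simp
    then show ?thesis using wf by (simp add: state_ok_def)
  next
    case False
    then show ?thesis using wf(1) frv that by (simp add: state_ok_def)
  qed
  have "finite E" using E(1) by (rule finite_subset) simp
  then have pg: "pair_graph ?G"
    using E by unfold_locales (auto simp: symmetric_def irrefl_def)
  have reg: "regular_graph r ?G"
  proof -
    have "out_degree (with_proj ?G) x = card (E `` {x})" for x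
    proof -
      have "out_arcs (with_proj ?G) x = Pair x ` (E `` {x})" by (auto simp: out_arcs_def)
      then show ?thesis by (simp add: out_degree_def card_image inj_on_def)
    qed
    then show ?thesis using deg by (simp add: regular_graph_def)
  qed
  have sets: "\<Union>(fst c) \<in> connected_sets ?G \<and> (dm \<longrightarrow> dominating ?G (\<Union>(fst c)))" if c: "c \<in> fam" for c
  proof -
    obtain P U where PU: "c = (P, U)" by (cases c)
    then have s: "sound dm t E F (P, U)" using fam c by (simp add: fam_ok_def)
    note sd = soundD[OF s fr]
    have "F New \<subseteq> \<Union>P" using bspec[OF new_in c] PU by simp
    then have vP: "v \<in> \<Union>P" using v by simp
    then obtain B where B: "B \<in> P" "v \<in> B" by auto
    have "B' = B" if "B' \<in> P" for B'
    proof -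
      have "v \<in> B'" using sd(5) that frv by (auto simp: valid_def)
      then show ?thesis using disjointD[OF sd(2) that B(1)] B(2) by blast
    qed
    then have PB: "P = {B}" using B(1) by blast
    have "(x, y) \<in> (E \<inter> B \<times> B)\<^sup>*" if "x \<in> B" "y \<in> B" for x y
      using sound_link[OF s B(1) that] .
    then have "Digraph_Component.connected (with_proj ?G \<restriction> B)"
      using B by (intro connected_induced) auto
    then have "\<Union>P \<in> connected_sets ?G"
      using B sd(3) PB by (auto simp: connected_sets_def)
    moreover have "dominating ?G (\<Union>P)" if dm
    proof -
      have "U = {}" using sd(4) frv vP by auto
      then have "\<exists>y\<in>\<Union>P. (x, y) \<in> E" if "x < t" "x \<notin> \<Union>P" for x
        using sound_dom[OF s \<open>dm\<close> that] by simp
      then show ?thesis using sd(3) by (auto simp: dominating_def)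
    qed
    ultimately show ?thesis by (simp add: PU)
  qed
  have fin: "finite (connected_sets ?G)"
    by (rule finite_subset[of _ "Pow {..<t}"]) (auto simp: connected_sets_def)
  have inj: "inj_on (\<lambda>c. \<Union>(fst c)) fam" using fam by (simp add: fam_ok_def)
  have "card fam \<le> num_conn ?G"
    unfolding num_conn_def
  proof (rule card_inj_on_le[OF inj _ fin])
    show "(\<lambda>c. \<Union>(fst c)) ` fam \<subseteq> connected_sets ?G"
      by (rule image_subsetI) (rule conjunct1[OF sets])
  qed
  moreover have "card fam \<le> num_conn_dom ?G" if dm
    unfolding num_conn_dom_def
  proof (rule card_inj_on_le[OF inj])
    show "(\<lambda>c. \<Union>(fst c)) ` fam \<subseteq> {S \<in> connected_sets ?G. dominating ?G S}"
    proof (rule image_subsetI)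
      fix c assume "c \<in> fam"
      then show "\<Union>(fst c) \<in> {S \<in> connected_sets ?G. dominating ?G S}"
        using sets[of c] that by simp
    qed
    show "finite {S \<in> connected_sets ?G. dominating ?G S}" using fin by simp
  qed
  moreover have "?G \<in> regular_graphs r t"
    using pg reg by (simp add: regular_graphs_def graph_order_def)
  ultimately show ?thesis by blast
qed

section \<open>Growth rates\<close>

text \<open>Each set contributes at most the largest weight, so a large mass forces many
  sets.\<close>

lemma look_bounded:
  "\<exists>b. \<forall>ks. look t ks \<le> b" "\<exists>b. \<forall>k ks. look_in f k ks \<le> b"
proof (induction t and f)
  case (Nd w f)
  then obtain b where b: "\<And>k ks. look_in f k ks \<le> b" by blast
  have "look (Nd w f) ks \<le> max w b" for ks
    using b by (cases ks) (auto simp: max.coboundedI2)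
  then show ?case by blast
next
  case Tip
  then show ?case by auto
next
  case (Br k t f)
  then obtain b b' where "\<And>ks. look t ks \<le> b" "\<And>k ks. look_in f k ks \<le> b'" by blast
  then have "look_in (Br k t f) k' ks \<le> max b b'" for k' ks
    by (auto simp: max.coboundedI1 max.coboundedI2)
  then show ?case by blast
qed

text \<open>The degree recorded for an empty class is a leftover without meaning, so degree vectors
  are compared on nonempty classes only.\<close>

definition agree :: "vec \<Rightarrow> vec \<Rightarrow> vec \<Rightarrow> bool" where
  "agree sz dg dg' \<longleftrightarrow> (\<forall>c. get c sz = 0 \<or> get c dg = get c dg')"

text \<open>Restores the normal form at the end of a period: leftover degrees are overwritten, and
  with all classes listed the clause on neighbours of the new vertex becomes vacuous.\<close>

lemma state_ok_agree:
  assumes "state_ok r t E F sz dg tc" and "agree sz dg dg'"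
  shows "state_ok r t E F sz dg' all_classes"
proof -
  have "card (E `` {x}) = get c dg'" if "x \<in> F c" for c x
  proof -
    have "card (F c) = get c sz" "finite (F c)" using assms(1) by (simp_all add: state_ok_def classes_ok_def)
    moreover from this(2) have "card (F c) \<noteq> 0" using that by (metis card_0_eq emptyE)
    ultimately have "get c sz \<noteq> 0" by simp
    then have "get c dg = get c dg'" using assms(2) by (metis agree_def)
    then show ?thesis using assms(1) that by (simp add: state_ok_def)
  qed
  moreover have "c \<in> set all_classes" for c by (cases c) simp_all
  ultimately show ?thesis using assms(1) by (simp add: state_ok_def)
qed

text \<open>Between periods no vertex is in \<open>New\<close>, so every configuration has a profile
  of the form covered by the certificate, and the inequality can be summed over the family.\<close>

lemma mass_main:
  assumes wf: "state_ok r t E F sz dg tc" and sz: "get New sz = 0" and fam: "fam_ok dm t E F fam"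
    and cert: "\<And>d u bs. num * look z (d # u # sort bs) \<le> den * W dm z ops None d u bs"
  shows "num * mass dm z [] F fam \<le> den * mass dm z ops F fam"
proof -
  have F: "classes_ok F" "frontier F \<subseteq> {..<t}" and "card (F New) = 0"
    using wf sz by (simp_all add: state_ok_def)
  then have new: "F New = {}" by (simp add: classes_ok_def)
  have "num * case_prod (tally dm z [] F) c \<le> den * case_prod (tally dm z ops F) c" if c: "c \<in> fam" for c
  proof -
    obtain P U where PU: "c = (P, U)" by (cases c)
    then have "sound dm t E F (P, U)" using fam c by (simp add: fam_ok_def)
    note sd = soundD[OF this F(2)]
    obtain m d u bs where prof: "profile F P U m d u bs" using profile_exists[OF sd(1)] .
    then have m: "m = None" using new by (cases m) (auto simp: profile_def)
    have "tally dm z ops' F P U = W dm z ops' None d u bs" for ops'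
      by (rule tally_eq[OF sd(2) _ prof[unfolded m], of 0]) (simp add: new)
    then show ?thesis using cert by (simp add: PU)
  qed
  then have "(\<Sum>c\<in>fam. num * case_prod (tally dm z [] F) c) \<le> (\<Sum>c\<in>fam. den * case_prod (tally dm z ops F) c)"
    by (rule sum_mono)
  then show ?thesis by (simp add: mass_def sum_distrib_left)
qed

lemma mass_le_card:
  assumes wf: "state_ok r t E F sz dg tc" and sz: "get New sz = 0" and fam: "fam_ok dm t E F fam"
    and b: "\<And>ks. look z ks \<le> b"
  shows "mass dm z [] F fam \<le> int (card fam) * b"
proof -
  have F: "classes_ok F" "frontier F \<subseteq> {..<t}" and "card (F New) = 0"
    using wf sz by (simp_all add: state_ok_def)
  then have new: "F New = {}" by (simp add: classes_ok_def)
  have "case_prod (tally dm z [] F) c \<le> b" if c: "c \<in> fam" for c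
  proof -
    obtain P U where PU: "c = (P, U)" by (cases c)
    then have "sound dm t E F (P, U)" using fam c by (simp add: fam_ok_def)
    note sd = soundD[OF this F(2)]
    obtain m d u bs where prof: "profile F P U m d u bs" using profile_exists[OF sd(1)] .
    then have m: "m = None" using new by (cases m) (auto simp: profile_def)
    have "tally dm z [] F P U = W dm z [] None d u bs"
      by (rule tally_eq[OF sd(2) _ prof[unfolded m], of 0]) (simp add: new)
    then show ?thesis using b by (simp add: PU)
  qed
  then show ?thesis
    unfolding mass_def using sum_bounded_above[of fam "case_prod (tally dm z [] F)" b] by simp
qed

text \<open>A period gives \<open>num * mass \<le> den * k * mass'\<close>, where
  \<open>mass'\<close> is the mass after it, and \<open>\<rho> * den * k \<le> num\<close> turns
  this into growth by \<open>\<rho>\<close>. Division by a bound on the weights converts mass into a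
  number of sets, and the closing program preserves that number.\<close>

lemma growth:
  assumes start: "srun r start (1, zero_vec, zero_vec, []) = Some (k0, sz, dg0, tc0)" "agree sz dg0 dg"
    and pos: "0 < W dm z start None zero_vec zero_vec []"
    and main: "srun r main (1, sz, dg, all_classes) = Some (k, sz, dg1, tc1)" "agree sz dg1 dg"
    and fin: "srun r fin (1, sz, dg, all_classes) = Some (kf, V 1 0 0 0 0, dgf, tcf)" "get New dgf = r"
      "Add True \<notin> set fin"
    and sz: "get New sz = 0"
    and cert: "\<And>d u bs. num * look z (d # u # sort bs) \<le> den * W dm z main None d u bs"
    and k: "0 < k" and k0: "0 < k0" and num: "0 < num" and den: "0 < den"
    and rate: "\<rho> * real_of_int den * real k \<le> real_of_int num" "0 < \<rho>"
  shows "\<exists>C>0. \<forall>j. \<exists>G\<in>regular_graphs r (adds start + adds main * j + adds fin).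
    C * \<rho> ^ j \<le> real (num_conn G) \<and> (dm \<longrightarrow> C * \<rho> ^ j \<le> real (num_conn_dom G))"
proof -
  define C where "C = real_of_int (W dm z start None zero_vec zero_vec []) / real k0"
  have C: "0 < C" using pos k0 by (simp add: C_def)
  have steps: "\<exists>E F fam. state_ok r (adds start + adds main * j) E F sz dg all_classes \<and>
      fam_ok dm (adds start + adds main * j) E F fam \<and> C * \<rho> ^ j \<le> real_of_int (mass dm z [] F fam)" for j
  proof (induction j)
    case 0
    \<comment> \<open>The run starts from the empty graph, with the empty set as its only
      configuration.\<close>
    let ?F = "\<lambda>_. {} :: nat set" and ?fam = "{({}, {})} :: config set"
    have "state_ok r 0 {} ?F zero_vec zero_vec []"
      by (simp add: state_ok_def classes_ok_def frontier_def sym_def irrefl_def all_cls get.simps)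
    moreover have "fam_ok dm 0 {} ?F ?fam"
      by (simp add: fam_ok_def sound_def)
    ultimately obtain E' F' fam' where ok: "state_ok r (0 + adds start) E' F' sz dg0 tc0"
      "fam_ok dm (0 + adds start) E' F' fam'"
      and le: "int 1 * mass dm z start ?F ?fam \<le> int k0 * mass dm z [] F' fam'"
      using run_average[OF start(1)] by blast
    have "tally dm z start ?F {} {} = W dm z start None zero_vec zero_vec []"
      by (rule tally_eq[of _ _ 0]) (simp_all add: profile_def vec_of_def)
    then have "mass dm z start ?F ?fam = W dm z start None zero_vec zero_vec []"
      by (simp add: mass_def)
    then have "real_of_int (W dm z start None zero_vec zero_vec []) \<le> real k0 * real_of_int (mass dm z [] F' fam')"
      using le by (metis mult_1 of_int_le_iff of_int_mult of_int_of_nat_eq of_nat_1)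
    then have "C \<le> real_of_int (mass dm z [] F' fam')"
      using k0 by (simp add: C_def divide_le_eq mult.commute)
    then show ?case using ok state_ok_agree[OF ok(1) start(2)] by auto
  next
    case (Suc j)
    then obtain E F fam where ok: "state_ok r (adds start + adds main * j) E F sz dg all_classes"
      "fam_ok dm (adds start + adds main * j) E F fam"
      and IH: "C * \<rho> ^ j \<le> real_of_int (mass dm z [] F fam)" by blast
    obtain E' F' fam' where ok': "state_ok r (adds start + adds main * j + adds main) E' F' sz dg1 tc1"
      "fam_ok dm (adds start + adds main * j + adds main) E' F' fam'"
      and le: "int 1 * mass dm z main F fam \<le> int k * mass dm z [] F' fam'"
      using run_average[OF main(1) ok] by blast
    have "num * mass dm z [] F fam \<le> den * mass dm z main F fam"
      by (rule mass_main[OF ok(1) sz ok(2) cert])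
    also have "\<dots> \<le> den * (int k * mass dm z [] F' fam')"
      using le den by (intro mult_left_mono) simp_all
    finally have "real_of_int num * real_of_int (mass dm z [] F fam) \<le>
        real_of_int den * real k * real_of_int (mass dm z [] F' fam')"
      by (metis mult.assoc of_int_le_iff of_int_mult of_int_of_nat_eq)
    moreover have "(\<rho> * real_of_int den * real k) * (C * \<rho> ^ j) \<le> real_of_int num * real_of_int (mass dm z [] F fam)"
      using rate IH C num by (intro mult_mono) simp_all
    ultimately have "(real_of_int den * real k) * (C * \<rho> ^ Suc j) \<le>
        (real_of_int den * real k) * real_of_int (mass dm z [] F' fam')"
      by (simp add: mult_ac)
    then have "C * \<rho> ^ Suc j \<le> real_of_int (mass dm z [] F' fam')"
      using den k by (subst (asm) mult_le_cancel_left_pos) simp_all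
    moreover have "adds start + adds main * j + adds main = adds start + adds main * Suc j" by simp
    ultimately show ?case using ok' state_ok_agree[OF ok'(1) main(2)] by metis
  qed
  obtain b where b: "\<And>ks. look z ks \<le> b" using look_bounded(1) by blast
  \<comment> \<open>The maximum with 1 guarantees a positive divisor.\<close>
  define b' where "b' = max b 1"
  have b': "0 < b'" "\<And>ks. look z ks \<le> b'" using b by (auto simp: b'_def max.coboundedI1)
  have "\<exists>G\<in>regular_graphs r (adds start + adds main * j + adds fin).
    C / b' * \<rho> ^ j \<le> real (num_conn G) \<and> (dm \<longrightarrow> C / b' * \<rho> ^ j \<le> real (num_conn_dom G))" for j
  proof -
    obtain E F fam where ok: "state_ok r (adds start + adds main * j) E F sz dg all_classes"
      "fam_ok dm (adds start + adds main * j) E F fam"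
      and le: "C * \<rho> ^ j \<le> real_of_int (mass dm z [] F fam)" using steps[of j] by blast
    have "real_of_int (mass dm z [] F fam) \<le> real (card fam) * real_of_int b'"
      using mass_le_card[OF ok(1) sz ok(2) b'(2)] by (metis of_int_le_iff of_int_mult of_int_of_nat_eq)
    then have le': "C / b' * \<rho> ^ j \<le> real (card fam)"
      using le b'(1) by (simp add: divide_le_eq)
    have "card (F New) = 0" "finite (F New)" using ok(1) sz by (simp_all add: state_ok_def classes_ok_def)
    then have "\<forall>c\<in>fam. F New \<subseteq> \<Union>(fst c)" by simp
    then obtain E' F' fam' where ok': "state_ok r (adds start + adds main * j + adds fin) E' F' (V 1 0 0 0 0) dgf tcf"
      "fam_ok dm (adds start + adds main * j + adds fin) E' F' fam'"
      and "card fam' = card fam" "\<forall>c\<in>fam'. F' New \<subseteq> \<Union>(fst c)"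
      using run_forced[OF fin(1,3) ok] by blast
    then obtain G where "G \<in> regular_graphs r (adds start + adds main * j + adds fin)"
      "card fam \<le> num_conn G" "dm \<longrightarrow> card fam \<le> num_conn_dom G"
      using final_graph[OF ok'(1) fin(2) ok'(2)] by metis
    then show ?thesis using le' by (meson of_nat_le_iff order_trans)
  qed
  then show ?thesis using C b' by (intro exI[of _ "C / b'"]) simp
qed

section \<open>From exponential growth to the limes superior\<close>

lemma ge_Limsup_orders:
  fixes f :: "nat \<Rightarrow> real"
  assumes "0 < \<mu>" "\<And>y. 0 < y \<Longrightarrow> y < \<mu> \<Longrightarrow> \<forall>N. \<exists>n\<ge>N. n \<in> S \<and> y \<le> f n"
  shows "ereal \<mu> \<le> Limsup (inf sequentially (principal S)) (\<lambda>n. ereal (f n))"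
proof (rule ccontr)
  let ?L = "Limsup (inf sequentially (principal S)) (\<lambda>n. ereal (f n))"
  assume "\<not> ereal \<mu> \<le> ?L"
  \<comment> \<open>The maximum with 0 makes the separating number \<open>y\<close> positive, as the
    second assumption demands.\<close>
  then have "max ?L (ereal 0) < ereal \<mu>" using assms(1) by auto
  then obtain y where y: "max ?L (ereal 0) < ereal y" "ereal y < ereal \<mu>"
    using ereal_dense2 by blast
  have "eventually (\<lambda>n. ereal (f n) < ereal y) (inf sequentially (principal S))"
    using y by (intro Limsup_lessD) auto
  then have "eventually (\<lambda>n. n \<in> S \<longrightarrow> f n < y) sequentially"
    by (simp add: eventually_inf_principal)
  then obtain N where "\<And>n. n \<ge> N \<Longrightarrow> n \<in> S \<Longrightarrow> f n < y"
    by (auto simp: eventually_sequentially)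
  moreover obtain n where "n \<ge> N" "n \<in> S" "y \<le> f n" using assms(2)[of y] y by auto
  ultimately show False by force
qed

text \<open>Since \<open>\<mu> / y\<close> exceeds 1, its powers eventually beat the constant
  \<open>y ^ a / C\<close>. Thus neither a constant factor nor \<open>a\<close> additional vertices
  change the rate.\<close>

lemma root_growth:
  fixes C \<mu> y :: real
  assumes C: "0 < C" and y: "0 < y" "y < \<mu>" and p: "0 < p"
  shows "\<exists>J. \<forall>j\<ge>J. y ^ (a + p * j) \<le> C * (\<mu> ^ p) ^ j"
proof -
  have "1 < (\<mu> / y) ^ p" using y p by (simp add: one_less_power)
  then obtain J where J: "y ^ a / C < ((\<mu> / y) ^ p) ^ J" using real_arch_pow by blast
  have "y ^ (a + p * j) \<le> C * (\<mu> ^ p) ^ j" if "j \<ge> J" for j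
  proof -
    have "((\<mu> / y) ^ p) ^ J \<le> ((\<mu> / y) ^ p) ^ j"
      using that \<open>1 < (\<mu> / y) ^ p\<close> by (intro power_increasing) simp_all
    then have "y ^ a / C \<le> ((\<mu> / y) ^ p) ^ j" using J by simp
    also have "\<dots> = \<mu> ^ (p * j) / y ^ (p * j)" by (simp add: power_divide power_mult)
    finally have "y ^ a \<le> \<mu> ^ (p * j) / y ^ (p * j) * C" using C by (simp only: pos_divide_le_eq)
    then have "y ^ a \<le> C * (\<mu> ^ (p * j) / y ^ (p * j))" by (simp only: mult.commute)
    then have "y ^ a * y ^ (p * j) \<le> C * \<mu> ^ (p * j)"
      using y by (simp add: field_simps)
    then show ?thesis by (simp add: power_add power_mult)
  qed
  then show ?thesis by blast
qed

lemma limsup_bound: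
  fixes \<mu> :: real
  assumes ex: "\<exists>C>0. \<forall>j. \<exists>G\<in>regular_graphs r (a + p * j + b).
      C * (\<mu> ^ p) ^ j \<le> real (num_conn G) \<and> (dm \<longrightarrow> C * (\<mu> ^ p) ^ j \<le> real (num_conn_dom G))"
    and \<mu>: "0 < \<mu>" and p: "0 < p"
  shows "ereal \<mu> \<le> c_lim r" "dm \<Longrightarrow> ereal \<mu> \<le> c_dom_lim r"
proof -
  obtain C where C: "0 < C" and G: "\<And>j. \<exists>G\<in>regular_graphs r (a + p * j + b).
      C * (\<mu> ^ p) ^ j \<le> real (num_conn G) \<and> (dm \<longrightarrow> C * (\<mu> ^ p) ^ j \<le> real (num_conn_dom G))"
    using ex by blast
  have key: "\<exists>n\<ge>N. n \<in> regular_orders r \<and> y \<le> c_max r n \<and> (dm \<longrightarrow> y \<le> c_dom_max r n)"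
    if y: "0 < y" "y < \<mu>" for y N
  proof -
    obtain J where J: "\<And>j. j \<ge> J \<Longrightarrow> y ^ (a + b + p * j) \<le> C * (\<mu> ^ p) ^ j"
      using root_growth[OF C y p] by metis
    \<comment> \<open>The successor makes the order \<open>n\<close> positive, so that
      \<open>root n\<close> is a genuine root; the maximum takes care of both thresholds.\<close>
    define j where "j = Suc (max J N)"
    define n where "n = a + p * j + b"
    have "j \<le> p * j" using p by simp
    then have n: "n \<ge> N" "0 < n" by (auto simp: n_def j_def)
    obtain G where G: "G \<in> regular_graphs r n" "C * (\<mu> ^ p) ^ j \<le> real (num_conn G)"
      "dm \<longrightarrow> C * (\<mu> ^ p) ^ j \<le> real (num_conn_dom G)"
      using G[of j] unfolding n_def by blast
    have yn: "y ^ n \<le> C * (\<mu> ^ p) ^ j" using J[of j] by (simp add: n_def j_def ac_simps)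
    have root: "y \<le> root n x" if "y ^ n \<le> x" for x
    proof -
      have "root n (y ^ n) \<le> root n x" using n that by simp
      then show ?thesis using n y by (simp add: real_root_power_cancel)
    qed
    have ord: "graph_order G = n" using G(1) by (simp add: regular_graphs_def)
    have "y \<le> conn_root G" unfolding conn_root_def ord using root yn G(2) by simp
    also have "\<dots> \<le> c_max r n"
      unfolding c_max_def by (rule Max_ge[OF finite_values(1)]) (use G(1) in blast)
    finally have 1: "y \<le> c_max r n" .
    have 2: "y \<le> c_dom_max r n" if dm
    proof -
      have "y \<le> conn_dom_root G" unfolding conn_dom_root_def ord using root yn G(3) that by simp
      also have "\<dots> \<le> c_dom_max r n"
        unfolding c_dom_max_def by (rule Max_ge[OF finite_values(2)]) (use G(1) in blast)
      finally show ?thesis .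
    qed
    have "n \<in> regular_orders r" using n G(1) by (auto simp: regular_orders_def)
    then show ?thesis using n 1 2 by blast
  qed
  show "ereal \<mu> \<le> c_lim r"
    unfolding c_lim_def by (rule ge_Limsup_orders[OF \<mu>]) (use key in blast)
  show "ereal \<mu> \<le> c_dom_lim r" if dm
    unfolding c_dom_lim_def by (rule ge_Limsup_orders[OF \<mu>]) (use key that in blast)
qed

section \<open>Certificates as finite checks\<close>

text \<open>The path from the root is accumulated in reverse in \<open>ks\<close>. The conditional
  skips entries of weight 0, among them inner nodes whose path is not a complete profile.\<close>

primrec all_in :: "(vec list \<Rightarrow> int \<Rightarrow> bool) \<Rightarrow> vec list \<Rightarrow> trie \<Rightarrow> bool"
  and all_in_forest :: "(vec list \<Rightarrow> int \<Rightarrow> bool) \<Rightarrow> vec list \<Rightarrow> forest \<Rightarrow> bool" where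
  "all_in P ks (Nd w f) = ((if w = 0 then True else P (rev ks) w) \<and> all_in_forest P ks f)"
| "all_in_forest P ks Tip = True"
| "all_in_forest P ks (Br k t f) = (all_in P (k # ks) t \<and> all_in_forest P ks f)"

lemma all_in_look:
  "all_in P ks t \<Longrightarrow> look t ks' \<noteq> 0 \<Longrightarrow> P (rev ks @ ks') (look t ks')"
  "all_in_forest P ks f \<Longrightarrow> look_in f k ks' \<noteq> 0 \<Longrightarrow> P (rev ks @ k # ks') (look_in f k ks')"
proof (induction t and f arbitrary: ks ks' and ks k ks')
  case (Nd w f)
  then show ?case by (cases ks') (auto split: if_splits)
next
  case Tip
  then show ?case by simp
next
  case (Br k' t f)
  then show ?case by (cases "k = k'") (simp_all, metis append_Cons append_Nil append_assoc rev.simps(2))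
qed

text \<open>A key shorter than two vectors encodes no profile and is rejected. Nonnegativity is
  tested along with the inequality, as \<open>W_nonneg\<close> relies on it.\<close>

fun key_ok :: "bool \<Rightarrow> int \<Rightarrow> int \<Rightarrow> oper list \<Rightarrow> trie \<Rightarrow> vec list \<Rightarrow> int \<Rightarrow> bool" where
  "key_ok dm num den ops t (d # u # bs) w = (0 \<le> w \<and> num * w \<le> den * W dm t ops None d u bs)"
| "key_ok dm num den ops t _ w = False"

definition cert_ok :: "bool \<Rightarrow> int \<Rightarrow> int \<Rightarrow> oper list \<Rightarrow> trie \<Rightarrow> bool" where
  "cert_ok dm num den ops t = all_in (key_ok dm num den ops t) [] t"

text \<open>A profile of nonzero weight is stored in the table and has been tested; at all others
  the left side is 0 and the right side nonnegative. Unsorted block lists are covered by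
  \<open>W_mset_cong\<close>.\<close>

lemma cert_okD:
  assumes "cert_ok dm num den ops t" and "0 < den"
  shows "num * look t (d # u # sort bs) \<le> den * W dm t ops None d u bs"
proof -
  have ok: "key_ok dm num den ops t ks (look t ks)" if "look t ks \<noteq> 0" for ks
    using all_in_look(1)[of "key_ok dm num den ops t" "[]" t ks] assms(1) that by (simp add: cert_ok_def)
  have "0 \<le> look t ks" for ks
  proof (cases "look t ks = 0")
    case False
    then show ?thesis using ok[OF False] by (auto elim: key_ok.elims)
  qed simp
  then have nonneg: "0 \<le> W dm t ops None d u bs" by (rule W_nonneg)
  show ?thesis
  proof (cases "look t (d # u # sort bs) = 0")
    case True
    then show ?thesis using nonneg assms(2) by simp
  next
    case False
    then show ?thesis using ok[OF False] W_mset_cong[of "sort bs" bs] by simp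
  qed
qed

definition reaches where
  "reaches r ops s sz dg k \<longleftrightarrow> 0 < k \<and> (\<exists>dg' tc'. srun r ops s = Some (k, sz, dg', tc') \<and> agree sz dg' dg)"

lemma reachesI:
  assumes "srun r ops s = Some (k, sz, dg', tc')" "agree sz dg' dg" "0 < k"
  shows "reaches r ops s sz dg k"
  using assms by (auto simp: reaches_def)

lemma bound_from_certificate:
  fixes \<mu> :: real
  assumes start: "\<exists>k. reaches r start (1, zero_vec, zero_vec, []) sz dg k"
    and main: "reaches r main (1, sz, dg, all_classes) sz dg k"
    and fin: "\<exists>k. reaches r fin (1, sz, dg, all_classes) (V 1 0 0 0 0) (V r 0 0 0 0) k"
    and ops: "Add True \<notin> set fin" "get New sz = 0" "0 < adds main"
    and pos: "0 < W dm z start None zero_vec zero_vec []"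
    and cert: "cert_ok dm num den main z" "0 < num" "0 < den"
    and rate: "\<mu> ^ adds main * real_of_int den * real k \<le> real_of_int num" "0 < \<mu>"
  shows "ereal \<mu> \<le> c_lim r" "dm \<Longrightarrow> ereal \<mu> \<le> c_dom_lim r"
proof -
  obtain k0 dg0 tc0 where s: "0 < k0" "srun r start (1, zero_vec, zero_vec, []) = Some (k0, sz, dg0, tc0)" "agree sz dg0 dg"
    using start unfolding reaches_def by blast
  obtain dg1 tc1 where m: "0 < k" "srun r main (1, sz, dg, all_classes) = Some (k, sz, dg1, tc1)" "agree sz dg1 dg"
    using main unfolding reaches_def by blast
  obtain k1 dgf tcf where f: "srun r fin (1, sz, dg, all_classes) = Some (k1, V 1 0 0 0 0, dgf, tcf)"
    and "agree (V 1 0 0 0 0) dgf (V r 0 0 0 0)"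
    using fin unfolding reaches_def by blast
  then have deg: "get New dgf = r" by (simp add: agree_def all_cls get.simps)
  have "\<exists>C>0. \<forall>j. \<exists>G\<in>regular_graphs r (adds start + adds main * j + adds fin).
    C * (\<mu> ^ adds main) ^ j \<le> real (num_conn G) \<and> (dm \<longrightarrow> C * (\<mu> ^ adds main) ^ j \<le> real (num_conn_dom G))"
  proof (rule growth[OF s(2,3) pos m(2,3) f deg ops(1,2) cert_okD[OF cert(1,3)] m(1) s(1) cert(2,3)])
    show "\<mu> ^ adds main * real_of_int den * real k \<le> real_of_int num" "0 < \<mu> ^ adds main"
      using rate by simp_all
  qed
  note ex = this
  show "ereal \<mu> \<le> c_lim r" by (rule limsup_bound(1)[OF ex rate(2) ops(3)])
  show "ereal \<mu> \<le> c_dom_lim r" if dm by (rule limsup_bound(2)[OF ex rate(2) ops(3) that])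
qed

section \<open>The programs\<close>

text \<open>The control flow of \<open>srun\<close> never looks at the multiplier, and each factor
  collected is checked to be positive.\<close>

lemma srun_multiplier:
  assumes "srun r ops (k, s) = Some (k', s')" and "0 < j"
  shows "\<exists>j'>0. srun r ops (j, s) = Some (j', s')"
  using assms
proof (induction r ops "(k, s)" arbitrary: k s j rule: srun.induct)
  case (1 r)
  then show ?case by auto
next
  case (2 r free ops k sz dg tc)
  then show ?case by (simp split: if_split_asm)
next
  case (3 r a b ops k sz dg tc)
  have C: "a \<noteq> b \<and> b \<noteq> New \<and> get New sz \<le> 1 \<and> (get a sz = 0 \<or> get b sz = 0 \<or> get a dg = get b dg)"
    by (rule ccontr) (use 3(2) in \<open>simp only: srun.simps if_False option.distinct\<close>)
  show ?case
    unfolding srun.simps if_P[OF C]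
    by (rule 3(1)[OF C]) (use 3(2,3) in \<open>simp_all only: srun.simps if_P[OF C]\<close>)
next
  case (4 r f g ops k sz dg tc)
  have pos: "0 < j * get f sz" if "0 < get f sz" using 4(4) that by simp
  show ?case
    using 4(1)[OF _ _ _ _ pos] 4(2)[OF _ _ _ _ pos] 4(3)
    by (cases g) (simp_all split: if_split_asm)
qed

text \<open>For start and closing programs only the existence of a positive multiplier matters.
  Evaluation with multiplier 0 keeps the product at 0 instead of computing a large number.\<close>

lemma reaches_exI:
  assumes "srun r ops (0, s) = Some (k', sz, dg', tc')" and "agree sz dg' dg"
  shows "\<exists>k. reaches r ops (1, s) sz dg k"
  using srun_multiplier[OF assms(1), of 1] assms(2) by (auto simp: reaches_def)

lemma agree_code [code]: "agree sz dg dg' \<longleftrightarrow>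
    (\<forall>c\<in>set all_classes. get c sz = 0 \<or> get c dg = get c dg')"
  by (simp add: agree_def all_cls)


abbreviation "att c c' \<equiv> Att c (Some c')"
abbreviation "fin c \<equiv> Att c None"

text \<open>A start program builds a connected graph with the
  right frontier (for degree 3 a cycle, for degree 4 a subdivided \<open>K\<^sub>3\<^sub>,\<^sub>3\<close>, for degree 5 a modified
  \<open>K\<^sub>4\<^sub>,\<^sub>4\<close>), a main program describes one period, and a closing program completes all degrees.\<close>

definition start3 where "start3 =
  [Add False, Mv New Queue, Add False, att Queue Queue, Mv New Last] @
  concat (replicate 4 [Add False, att Last Pool, Mv New Last]) @
  [Add False, att Last Pool, att Queue Queue, Mv New Last]"

definition main3 where "main3 =
  [Add True, fin Last, Mv New Last,
   Add True, fin Pool, Mv Queue Pool, att Last Queue, Mv New Last]"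

definition fin3 where "fin3 =
  [Mv Queue Pool, Mv Last Pool] @ concat (replicate 4 [Add False, fin Pool, fin Pool, Mv New Pool]) @
  [Add False, fin Pool, fin Pool, fin Pool]"

definition start4 where "start4 =
  concat (replicate 3 [Add False, Mv New Pool]) @
  concat (replicate 2 [Add False, att Pool Temp, att Pool Temp, att Pool Temp, Mv Temp Pool, Mv New Last]) @
  [Add False, att Pool Temp, att Pool Temp, Mv Temp Last, Mv New Pool,
   Add False, att Pool Queue, att Pool Temp, Mv Temp Last, Mv Last Pool, Mv New Last]"

text \<open>Every vertex sends one path edge and one chord backwards and later receives one of each,
  so a single vertex makes a period.\<close>

definition main4 where "main4 =
  [Add True, fin Pool, Mv Queue Pool, att Last Queue, Mv New Last]"

text \<open>The first two closing vertices leave exactly four vertices of degree 3, all neighbours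
  of the last one.\<close>

definition fin4 where "fin4 =
  [Mv Queue Pool, Add False, att Last Queue, fin Pool, fin Pool, Mv New Queue,
   Add False, fin Queue, fin Pool, fin Pool, Mv New Pool, Mv Queue Pool,
   Add False, fin Pool, fin Pool, fin Pool, fin Pool]"

definition start5 where "start5 =
  concat (replicate 4 [Add False, Mv New Pool]) @
  concat (replicate 2 [Add False, att Pool Temp, att Pool Temp, att Pool Temp, att Pool Temp, Mv Temp Pool, Mv New Last]) @
  [Add False, att Pool Temp, att Pool Temp, att Pool Temp, Mv New Queue,
   Add False, att Pool Queue, att Temp Last, att Temp Last, Mv Temp Queue, Mv New Queue,
   Add False, att Queue Last, att Queue Last, att Queue Last, Mv Last Pool, Mv New Last]"

text \<open>Five edges for two vertices: the first vertex has two backward and three forward edges,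
  the second three and two. \<open>Temp\<close> keeps vertices that received an edge in this period
  out of the pool until both chords to the pool are drawn.\<close>

definition main5 where "main5 =
  [Add True, fin Pool, att Last Temp, Mv New Last,
   Add True, fin Pool, att Queue Temp, Mv Temp Pool, att Last Queue, Mv New Last]"

text \<open>After the first closing vertex eight vertices lack one edge; the second completes four
  and joins the rest, which leaves five for the last vertex.\<close>

definition fin5 where "fin5 =
  [Mv Last Queue, Add False, att Queue Temp, att Queue Temp, fin Pool, fin Pool, Mv Temp Pool, Mv New Pool,
   Add False, fin Pool, fin Pool, fin Pool, fin Pool, Mv New Pool,
   Add False, fin Pool, fin Pool, fin Pool, fin Pool, fin Pool]"

lemma replicate_simps:
  "replicate 2 x = [x, x]" "replicate 3 x = [x, x, x]" "replicate 4 x = [x, x, x, x]"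
  by (simp_all add: numeral_eq_Suc)

lemma get_V:
  "get New (V n l p q t) = n" "get Last (V n l p q t) = l" "get Pool (V n l p q t) = p"
  "get Queue (V n l p q t) = q" "get Temp (V n l p q t) = t"
  by (simp_all add: get.simps)

lemma upd_V:
  "upd New f (V n l p q t) = V (f n) l p q t" "upd Last f (V n l p q t) = V n (f l) p q t"
  "upd Pool f (V n l p q t) = V n l (f p) q t" "upd Queue f (V n l p q t) = V n l p (f q) t"
  "upd Temp f (V n l p q t) = V n l p q (f t)"
  by (simp_all add: upd.simps)

lemma reaches_start3:
  "\<exists>k. reaches 3 start3 (1, zero_vec, zero_vec, []) (V 0 1 5 1 0) (V 0 2 2 2 0) k"
  \<comment> \<open>The witnesses are the values that the run produces; the degree 2 of the now
    empty class \<open>New\<close> is a leftover, ignored by \<open>agree\<close>.\<close>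
  by (rule reaches_exI[where dg' = "V 2 2 2 2 0" and tc' = "[Queue, Pool]"]) code_simp+

lemma reaches_main3:
  "reaches 3 main3 (1, V 0 1 5 1 0, V 0 2 2 2 0, all_classes) (V 0 1 5 1 0) (V 0 2 2 2 0) 5"
  by (rule reachesI[where dg' = "V 2 2 2 2 0" and tc' = "[Queue]"]) code_simp+

lemma reaches_fin3:
  "\<exists>k. reaches 3 fin3 (1, V 0 1 5 1 0, V 0 2 2 2 0, all_classes) (V 1 0 0 0 0) (V 3 0 0 0 0) k"
  by (rule reaches_exI[where dg' = "V 3 2 2 2 0" and tc' = "[]"]) code_simp+

lemma reaches_start4:
  "\<exists>k. reaches 4 start4 (1, zero_vec, zero_vec, []) (V 0 1 5 1 0) (V 0 2 3 3 0) k"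
  by (rule reaches_exI[where dg' = "V 2 2 3 3 3" and tc' = "[Pool, Last, Temp, Queue]"]) code_simp+

lemma reaches_main4:
  "reaches 4 main4 (1, V 0 1 5 1 0, V 0 2 3 3 0, all_classes) (V 0 1 5 1 0) (V 0 2 3 3 0) 5"
  by (rule reachesI[where dg' = "V 2 2 3 3 0" and tc' = "[Queue]"]) code_simp+

lemma reaches_fin4:
  "\<exists>k. reaches 4 fin4 (1, V 0 1 5 1 0, V 0 2 3 3 0, all_classes) (V 1 0 0 0 0) (V 4 0 0 0 0) k"
  by (rule reaches_exI[where dg' = "V 4 2 3 3 0" and tc' = "[]"]) code_simp+

lemma reaches_start5:
  "\<exists>k. reaches 5 start5 (1, zero_vec, zero_vec, []) (V 0 1 7 1 0) (V 0 3 4 3 0) k"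
  by (rule reaches_exI[where dg' = "V 3 3 4 3 3" and tc' = "[Pool, Last, Last, Last]"]) code_simp+

text \<open>The multiplier is \<open>7 * 6\<close>: two chords into the pool before it is refilled,
  while \<open>Last\<close> and \<open>Queue\<close> offer one vertex each.\<close>

lemma reaches_main5:
  "reaches 5 main5 (1, V 0 1 7 1 0, V 0 3 4 3 0, all_classes) (V 0 1 7 1 0) (V 0 3 4 3 0) 42"
  by (rule reachesI[where dg' = "V 3 3 4 3 4" and tc' = "[Queue, Pool, Temp]"]) code_simp+

lemma reaches_fin5:
  "\<exists>k. reaches 5 fin5 (1, V 0 1 7 1 0, V 0 3 4 3 0, all_classes) (V 1 0 0 0 0) (V 5 0 0 0 0) k"
  by (rule reaches_exI[where dg' = "V 5 3 4 3 4" and tc' = "[]"]) code_simp+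

section \<open>Evaluation of the certificates\<close>

lemma look_simps: "look (Nd w f) [] = w" "look (Nd w f) (k # ks) = look_in f k ks"
  by simp_all

lemma scale_simps: "scale 0 x = 0" "scale (Suc 0) x = x" "scale (Suc (Suc k)) x = int (Suc (Suc k)) * x"
  by (simp_all add: scale_def)

lemma int_Suc_simps:
  "int (Suc (Suc 0)) = 2" "int (Suc (Suc (Suc 0))) = 3" "int (Suc (Suc (Suc (Suc 0)))) = 4"
  "int (Suc (Suc (Suc (Suc (Suc 0))))) = 5" "int (Suc (Suc (Suc (Suc (Suc (Suc 0)))))) = 6"
  "int (Suc (Suc (Suc (Suc (Suc (Suc (Suc 0))))))) = 7"
  by simp_all

text \<open>Conditionals in place of a conjunction, so that the weak congruence rule stops at the
  first differing coordinate.\<close>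

lemma vec_eq_if: "V n l p q t = V n' l' p' q' t' \<longleftrightarrow>
    (if p = p' then if l = l' then if q = q' then if n = n' then t = t' else False
     else False else False else False)"
  by auto

lemma sum_map_simps: "(\<Sum>b\<leftarrow>[]. f b) = 0" "(\<Sum>b\<leftarrow>x # xs. f b) = f x + (\<Sum>b\<leftarrow>xs. f b)"
  for f :: "vec \<Rightarrow> int"
  by simp_all

lemma sort_simps:
  "sort [] = ([] :: vec list)" "sort (x # xs) = insort (x :: vec) (sort xs)" "insort x [] = [x :: vec]"
  "insort x (y # ys) = (if x \<le> y then x # y # ys else (y :: vec) # insort x ys)"
  by simp_all

lemma nat_simps:
  "(Suc m = Suc n) = (m = n)" "(0 = Suc n) = False" "(Suc n = 0) = False"
  "(Suc m \<le> Suc n) = (m \<le> n)" "(0 \<le> (n :: nat)) = True" "(Suc n \<le> 0) = False"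
  "Suc m + n = Suc (m + n)" "0 + (n :: nat) = n" "n + 0 = (n :: nat)"
  "Suc m - Suc n = m - n" "0 - n = (0 :: nat)" "m - 0 = (m :: nat)"
  by simp_all

lemma bool_simps: "(True \<and> P) = P" "(P \<and> True) = P" "(False \<and> P) = False" "((x :: 'a) = x) = True"
  by simp_all

lemmas eval_simps = W.simps look_simps look_in.simps all_in.simps all_in_forest.simps key_ok.simps
  get_V upd_V scale_simps int_Suc_simps vec_eq_if sum_map_simps sort_simps nat_simps bool_simps
  less_eq_vec.simps plus_vec.simps is_zero.simps shift_def put_def pour_def option.case list.map
  append.simps rev.simps remove1.simps cls.distinct option.distinct if_True if_False
  arith_simps rel_simps eq_numeral_simps zero_neq_one one_neq_zero zero_le_one zero_less_one One_nat_def

text \<open>These congruence rules keep the simplifier out of the tables and out of branches with factor zero.\<close>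

lemma eval_congs:
  "k = k' \<Longrightarrow> scale k x = scale k' x"
  "m = m' \<Longrightarrow> d = d' \<Longrightarrow> u = u' \<Longrightarrow> bs = bs' \<Longrightarrow> W dm z ops m d u bs = W dm z ops m' d' u' bs'"
  "ks = ks' \<Longrightarrow> look t ks = look t ks'"
  "c = c' \<Longrightarrow> look_in f c ks = look_in f c' ks"
  "ks = ks' \<Longrightarrow> key_ok dm num den ops t ks w = key_ok dm num den ops t ks' w"
  by simp_all

lemma sum_map_cong: "bs = bs' \<Longrightarrow> sum_list (map h bs) = sum_list (map h bs')" for h :: "vec \<Rightarrow> int"
  by simp

lemma all_in_congs: "all_in P ks t = all_in P ks t" "all_in_forest P ks f = all_in_forest P ks f"
  by (rule refl)+

abbreviation "nd l p q w f f' \<equiv> Br (V 0 l p q 0) (Nd w f) f'"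
abbreviation "lf l p q w f \<equiv> nd l p q w Tip f"

text \<open>Class counts are evaluated in unary, where increment, decrement and comparison are
  direct rewrite steps; the weights remain binary numerals.\<close>

lemma small_nats:
  "1 = Suc 0" "2 = Suc (Suc 0)" "3 = Suc (Suc (Suc 0))" "4 = Suc (Suc (Suc (Suc 0)))"
  "5 = Suc (Suc (Suc (Suc (Suc 0))))" "6 = Suc (Suc (Suc (Suc (Suc (Suc 0)))))"
  "7 = Suc (Suc (Suc (Suc (Suc (Suc (Suc 0))))))"
  by simp_all

section \<open>Certificates for degree 3\<close>

text \<open>A key lists the counts \<open>d\<close> and \<open>u\<close> and then the sorted blocks of a profile. In the certificates,
  \<open>num / den\<close> is the multiplier of the main program times \<open>\<mu>\<^sup>p\<close>, where \<open>\<mu>\<close> is the bound to be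
  proved and \<open>p\<close> the number of vertices added: for instance 16056320 = 5 * 1792 * 1792.\<close>

definition table_conn3 :: trie where "table_conn3 =
Nd 0 (nd 0 0 0 0 (nd 0 0 0 0 (nd 0 1 0 0 (nd 0 1 0 0 (nd 0 1 0 0 (nd 0 1 0 0 (lf 1 1 1 2219 Tip) (nd
0 2 0 0 (lf 1 0 1 3023 Tip) (lf 1 2 1 5734 Tip))) (nd 0 2 0 0 (lf 1 1 1 8198 Tip) (nd 0 3 0 0 (lf 1
0 1 8649 Tip) (lf 1 3 1 14733 Tip)))) (nd 0 2 0 0 (nd 0 2 0 0 (lf 1 0 1 11114 Tip) (lf 1 2 1 21701
Tip)) (nd 0 3 0 0 (lf 1 1 1 24100 Tip) (nd 0 4 0 0 (lf 1 0 1 23194 Tip) (lf 1 4 1 38110 Tip))))) (nd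
0 2 0 0 (nd 0 2 0 0 (lf 1 1 1 31034 Tip) (nd 0 3 0 0 (lf 1 0 1 32572 Tip) (lf 1 3 1 57277 Tip))) (nd
0 3 0 0 (lf 1 2 1 65567 Tip) (nd 0 4 0 0 (lf 1 1 1 66590 Tip) (nd 0 5 0 0 (lf 1 0 1 61264 Tip) (lf 1
5 1 100000 Tip)))))) Tip) (nd 0 0 1 0 (nd 0 0 0 0 (nd 0 1 0 0 (nd 0 1 0 0 (nd 0 1 0 0 (nd 0 1 0 0
(lf 1 1 0 1482 Tip) (nd 0 2 0 0 (lf 1 0 0 1696 Tip) (lf 1 2 0 4089 Tip))) (nd 0 2 0 0 (lf 1 1 0 5383
Tip) (nd 0 3 0 0 (lf 1 0 0 4707 Tip) (lf 1 3 0 10817 Tip)))) (nd 0 2 0 0 (nd 0 2 0 0 (lf 1 0 0 6023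
Tip) (lf 1 2 0 15220 Tip)) (nd 0 3 0 0 (lf 1 1 0 15510 Tip) (nd 0 4 0 0 (lf 1 0 0 12195 Tip) (lf 1 4
0 28353 Tip))))) (nd 0 2 0 0 (nd 0 2 0 0 (lf 1 1 0 19924 Tip) (nd 0 3 0 0 (lf 1 0 0 17009 Tip) (lf 1
3 0 41423 Tip))) (nd 0 3 0 0 (lf 1 2 0 45268 Tip) (nd 0 4 0 0 (lf 1 1 0 42031 Tip) (nd 0 5 0 0 (lf 1
0 0 31146 Tip) (lf 1 5 0 74763 Tip)))))) Tip) (nd 0 1 0 0 (nd 0 0 0 0 (nd 0 1 0 0 (nd 0 1 0 0 (nd 0
1 0 0 (nd 0 1 0 0 (lf 1 0 1 1565 Tip) (lf 1 1 1 4286 Tip)) (nd 0 2 0 0 (lf 1 0 1 5785 Tip) (lf 1 2 1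
11230 Tip))) (nd 0 2 0 0 (lf 1 1 1 15994 Tip) (nd 0 3 0 0 (lf 1 0 1 16732 Tip) (lf 1 3 1 29299
Tip)))) (nd 0 2 0 0 (nd 0 2 0 0 (lf 1 0 1 21499 Tip) (lf 1 2 1 43096 Tip)) (nd 0 3 0 0 (lf 1 1 1
47694 Tip) (nd 0 4 0 0 (lf 1 0 1 45516 Tip) (lf 1 4 1 77094 Tip))))) Tip) (nd 0 1 1 0 (nd 0 0 0 0
(nd 0 1 0 0 (nd 0 1 0 0 (nd 0 1 0 0 (nd 0 1 0 0 (lf 1 0 0 888 Tip) (lf 1 1 0 2804 Tip)) (nd 0 2 0 0
(lf 1 0 0 3114 Tip) (lf 1 2 0 7850 Tip))) (nd 0 2 0 0 (lf 1 1 0 10228 Tip) (nd 0 3 0 0 (lf 1 0 0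
8676 Tip) (lf 1 3 0 21120 Tip)))) (nd 0 2 0 0 (nd 0 2 0 0 (lf 1 0 0 11100 Tip) (lf 1 2 0 29596 Tip))
(nd 0 3 0 0 (lf 1 1 0 29863 Tip) (nd 0 4 0 0 (lf 1 0 0 22774 Tip) (lf 1 4 0 56348 Tip))))) Tip) (nd
0 2 0 0 (nd 0 0 0 0 (nd 0 1 0 0 (nd 0 1 0 0 (nd 0 1 0 0 (lf 1 0 1 3012 Tip) (lf 1 1 1 8246 Tip)) (nd
0 2 0 0 (lf 1 0 1 11033 Tip) (lf 1 2 1 21966 Tip))) (nd 0 2 0 0 (lf 1 1 1 31176 Tip) (nd 0 3 0 0 (lf
1 0 1 32343 Tip) (lf 1 3 1 58338 Tip)))) Tip) (nd 0 2 1 0 (nd 0 0 0 0 (nd 0 1 0 0 (nd 0 1 0 0 (nd 0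
1 0 0 (lf 1 0 0 1611 Tip) (lf 1 1 0 5253 Tip)) (nd 0 2 0 0 (lf 1 0 0 5656 Tip) (lf 1 2 0 15033
Tip))) (nd 0 2 0 0 (lf 1 1 0 19392 Tip) (nd 0 3 0 0 (lf 1 0 0 15946 Tip) (lf 1 3 0 41244 Tip))))
Tip) (nd 0 3 0 0 (nd 0 0 0 0 (nd 0 1 0 0 (nd 0 1 0 0 (lf 1 0 1 5664 Tip) (lf 1 1 1 15829 Tip)) (nd 0
2 0 0 (lf 1 0 1 20999 Tip) (lf 1 2 1 42989 Tip))) Tip) (nd 0 3 1 0 (nd 0 0 0 0 (nd 0 1 0 0 (nd 0 1 0
0 (lf 1 0 0 2884 Tip) (lf 1 1 0 9807 Tip)) (nd 0 2 0 0 (lf 1 0 0 10229 Tip) (lf 1 2 0 28771 Tip)))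
Tip) (nd 0 4 0 0 (nd 0 0 0 0 (nd 0 1 0 0 (lf 1 0 1 10614 Tip) (lf 1 1 1 30375 Tip)) Tip) (nd 0 4 1 0
(nd 0 0 0 0 (nd 0 1 0 0 (lf 1 0 0 5133 Tip) (lf 1 1 0 18280 Tip)) Tip) (nd 0 5 0 0 (nd 0 0 0 0 (lf 1
0 1 19866 Tip) Tip) (nd 0 5 1 0 (nd 0 0 0 0 (lf 1 0 0 9101 Tip) Tip) (nd 1 0 0 0 (nd 0 0 0 0 (nd 0 0
1 0 (nd 0 1 0 0 (nd 0 1 0 0 (nd 0 1 0 0 (lf 0 2 0 1437 Tip) (lf 0 3 0 4291 Tip)) (nd 0 2 0 0 (lf 0 2
0 5507 Tip) (lf 0 4 0 11692 Tip))) (nd 0 2 0 0 (lf 0 3 0 16401 Tip) (lf 0 5 0 31445 Tip))) (nd 0 1 0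
0 (nd 0 1 0 0 (nd 0 1 0 0 (nd 0 1 0 0 (lf 0 1 1 1453 Tip) (lf 0 2 1 4247 Tip)) (nd 0 1 1 0 (lf 0 2 0
5464 Tip) (lf 0 3 1 11524 Tip))) (nd 0 1 1 0 (lf 0 3 0 16240 Tip) (nd 0 2 0 0 (lf 0 2 1 16186 Tip)
(lf 0 4 1 30911 Tip)))) (nd 0 1 1 0 (nd 0 2 0 0 (lf 0 2 0 20879 Tip) (lf 0 4 0 45569 Tip)) (nd 0 2 0
0 (lf 0 3 1 45320 Tip) (nd 0 2 1 0 (lf 0 3 0 49597 Tip) (lf 0 5 1 83722 Tip)))))) Tip) (nd 1 0 1 0
(nd 0 0 0 0 (nd 0 1 0 0 (nd 0 1 0 0 (nd 0 1 0 0 (nd 0 1 0 0 (lf 0 1 0 763 Tip) (lf 0 2 0 2806 Tip))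
(lf 0 3 0 8250 Tip)) (nd 0 2 0 0 (lf 0 2 0 10591 Tip) (lf 0 4 0 22834 Tip))) (nd 0 2 0 0 (lf 0 3 0
32050 Tip) (lf 0 5 0 62676 Tip))) Tip) (nd 1 1 0 0 (nd 0 0 0 0 (nd 0 0 1 0 (nd 0 1 0 0 (nd 0 1 0 0
(nd 0 1 0 0 (lf 0 1 0 658 Tip) (lf 0 2 0 2810 Tip)) (lf 0 3 0 8281 Tip)) (nd 0 2 0 0 (lf 0 2 0 10630
Tip) (lf 0 4 0 22935 Tip))) (nd 0 1 0 0 (nd 0 1 0 0 (nd 0 1 0 0 (lf 0 1 1 2792 Tip) (lf 0 2 1 8168
Tip)) (nd 0 1 1 0 (lf 0 2 0 10520 Tip) (lf 0 3 1 22542 Tip))) (nd 0 1 1 0 (lf 0 3 0 31819 Tip) (nd 0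
2 0 0 (lf 0 2 1 31695 Tip) (lf 0 4 1 61756 Tip))))) Tip) (nd 1 1 1 0 (nd 0 0 0 0 (nd 0 1 0 0 (nd 0 1
0 0 (nd 0 1 0 0 (lf 0 1 0 1434 Tip) (lf 0 2 0 5334 Tip)) (lf 0 3 0 15895 Tip)) (nd 0 2 0 0 (lf 0 2 0
20409 Tip) (lf 0 4 0 44913 Tip))) Tip) (nd 1 2 0 0 (nd 0 0 0 0 (nd 0 0 1 0 (nd 0 1 0 0 (nd 0 1 0 0
(lf 0 1 0 1429 Tip) (lf 0 2 0 5356 Tip)) (lf 0 3 0 15975 Tip)) (nd 0 1 0 0 (nd 0 1 0 0 (lf 0 1 1
5298 Tip) (lf 0 2 1 15716 Tip)) (nd 0 1 1 0 (lf 0 2 0 20261 Tip) (lf 0 3 1 44282 Tip)))) Tip) (nd 1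
2 1 0 (nd 0 0 0 0 (nd 0 1 0 0 (nd 0 1 0 0 (lf 0 1 0 2685 Tip) (lf 0 2 0 10099 Tip)) (lf 0 3 0 30711
Tip)) Tip) (nd 1 3 0 0 (nd 0 0 0 0 (nd 0 0 1 0 (nd 0 1 0 0 (lf 0 1 0 2697 Tip) (lf 0 2 0 10156 Tip))
(nd 0 1 0 0 (lf 0 1 1 10025 Tip) (lf 0 2 1 30332 Tip))) Tip) (nd 1 3 1 0 (nd 0 0 0 0 (nd 0 1 0 0 (lf
0 1 0 4995 Tip) (lf 0 2 0 19153 Tip)) Tip) (nd 1 4 0 0 (nd 0 0 0 0 (nd 0 0 1 0 (lf 0 1 0 5026 Tip)
(lf 0 1 1 19002 Tip)) Tip) (nd 1 4 1 0 (nd 0 0 0 0 (lf 0 1 0 9293 Tip) Tip) (nd 1 5 0 0 (nd 0 0 0 0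
(lf 0 0 1 9362 Tip) Tip) Tip)))))))))))))))))))))))"

text \<open>The table is unfolded only where \<open>look\<close> is applied to it; everywhere else
  it stays a single constant during evaluation.\<close>

lemmas look_table_conn3 = arg_cong[where f = look, OF table_conn3_def, THEN fun_cong, unfolded small_nats]

lemma cert_conn3: "cert_ok False 16056320 1000000 main3 table_conn3"
  unfolding cert_ok_def main3_def
  \<comment> \<open>Only the copy traversed by \<open>all_in\<close> is unfolded; the one inside
    \<open>key_ok\<close> stays folded and is consulted through
    \<open>look_table_conn3\<close>.\<close>
  apply (subst (2) table_conn3_def)
  unfolding small_nats
  by (simp only: look_table_conn3 eval_simps cong: eval_congs sum_map_cong all_in_congs if_weak_cong)

lemma start_conn3: "0 < W False table_conn3 start3 None zero_vec zero_vec []"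
  unfolding start3_def replicate_simps concat.simps append.simps
  by (simp only: look_table_conn3 eval_simps cong: eval_congs sum_map_cong if_weak_cong)

lemma bound_conn3: "ereal 1.792 \<le> c_lim 3"
  by (rule bound_from_certificate(1)[OF reaches_start3 reaches_main3 reaches_fin3 _ _ _ start_conn3 cert_conn3])
    (simp_all add: fin3_def main3_def replicate_simps get_V)

text \<open>Here the second vector of a key can be nonzero: it counts waiting vertices. The scale is
  fixed by giving weight 20000 to the start profile, whose only block is the whole frontier.\<close>

definition table_dom3 :: trie where "table_dom3 =
Nd 0 (nd 0 0 0 0 (nd 0 0 0 0 (nd 0 1 0 0 (nd 0 1 0 0 (nd 0 1 0 0 (nd 0 1 0 0 (lf 1 1 1 607 Tip) (nd
0 2 0 0 (lf 1 0 1 813 Tip) (lf 1 2 1 1508 Tip))) (nd 0 2 0 0 (lf 1 1 1 2135 Tip) (nd 0 3 0 0 (lf 1 0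
1 2238 Tip) (lf 1 3 1 3589 Tip)))) (nd 0 2 0 0 (nd 0 2 0 0 (lf 1 0 1 2865 Tip) (lf 1 2 1 5220 Tip))
(nd 0 3 0 0 (lf 1 1 1 5751 Tip) (nd 0 4 0 0 (lf 1 0 1 5509 Tip) (lf 1 4 1 8475 Tip))))) (nd 0 2 0 0
(nd 0 2 0 0 (lf 1 1 1 7375 Tip) (nd 0 3 0 0 (lf 1 0 1 7675 Tip) (lf 1 3 1 12538 Tip))) (nd 0 3 0 0
(lf 1 2 1 14209 Tip) (nd 0 4 0 0 (lf 1 1 1 14356 Tip) (nd 0 5 0 0 (lf 1 0 1 13180 Tip) (lf 1 5 1
20000 Tip)))))) (nd 0 1 0 0 (nd 0 1 0 0 (nd 0 1 0 0 (nd 0 1 0 0 (lf 1 1 1 604 Tip) (nd 0 2 0 0 (lf 1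
0 1 808 Tip) (lf 1 2 1 1497 Tip))) (nd 0 2 0 0 (lf 1 1 1 2118 Tip) (nd 0 3 0 0 (lf 1 0 1 2219 Tip)
(lf 1 3 1 3550 Tip)))) (nd 0 2 0 0 (nd 0 2 0 0 (lf 1 0 1 2840 Tip) (lf 1 2 1 5156 Tip)) (nd 0 3 0 0
(lf 1 1 1 5676 Tip) (nd 0 4 0 0 (lf 1 0 1 5438 Tip) (lf 1 4 1 8331 Tip))))) (nd 0 2 0 0 (nd 0 1 0 0
(nd 0 1 0 0 (lf 1 1 1 562 Tip) (nd 0 2 0 0 (lf 1 0 1 737 Tip) (lf 1 2 1 1439 Tip))) (nd 0 2 0 0 (lf
1 1 1 2031 Tip) (nd 0 3 0 0 (lf 1 0 1 2124 Tip) (lf 1 3 1 3362 Tip)))) (nd 1 0 1 0 (nd 0 1 0 0 (nd 0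
1 0 0 (nd 0 1 0 0 (lf 0 2 0 239 Tip) (lf 0 3 0 662 Tip)) (nd 0 2 0 0 (lf 0 2 0 844 Tip) (lf 0 4 0
1578 Tip))) (nd 0 2 0 0 (lf 0 3 0 2182 Tip) (lf 0 5 0 3622 Tip))) (nd 1 1 1 0 (nd 0 1 0 0 (nd 0 1 0
0 (lf 0 2 0 224 Tip) (lf 0 3 0 641 Tip)) (lf 0 4 0 1501 Tip)) Tip))))) (nd 0 0 1 0 (nd 0 0 0 0 (nd 0
1 0 0 (nd 0 1 0 0 (nd 0 1 0 0 (nd 0 1 0 0 (lf 1 1 0 397 Tip) (nd 0 2 0 0 (lf 1 0 0 448 Tip) (lf 1 2
0 1030 Tip))) (nd 0 2 0 0 (lf 1 1 0 1340 Tip) (nd 0 3 0 0 (lf 1 0 0 1151 Tip) (lf 1 3 0 2519 Tip))))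
(nd 0 2 0 0 (nd 0 2 0 0 (lf 1 0 0 1466 Tip) (lf 1 2 0 3501 Tip)) (nd 0 3 0 0 (lf 1 1 0 3530 Tip) (nd
0 4 0 0 (lf 1 0 0 2724 Tip) (lf 1 4 0 6011 Tip))))) (nd 0 2 0 0 (nd 0 2 0 0 (lf 1 1 0 4516 Tip) (nd
0 3 0 0 (lf 1 0 0 3765 Tip) (lf 1 3 0 8654 Tip))) (nd 0 3 0 0 (lf 1 2 0 9367 Tip) (nd 0 4 0 0 (lf 1
1 0 8630 Tip) (nd 0 5 0 0 (lf 1 0 0 6274 Tip) (lf 1 5 0 14206 Tip)))))) (nd 0 1 0 0 (nd 0 1 0 0 (nd
0 1 0 0 (nd 0 1 0 0 (lf 1 1 0 394 Tip) (nd 0 2 0 0 (lf 1 0 0 445 Tip) (lf 1 2 0 1022 Tip))) (nd 0 2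
0 0 (lf 1 1 0 1328 Tip) (nd 0 3 0 0 (lf 1 0 0 1141 Tip) (lf 1 3 0 2494 Tip)))) (nd 0 2 0 0 (nd 0 2 0
0 (lf 1 0 0 1453 Tip) (lf 1 2 0 3455 Tip)) (nd 0 3 0 0 (lf 1 1 0 3479 Tip) (nd 0 4 0 0 (lf 1 0 0
2690 Tip) (lf 1 4 0 5914 Tip))))) (nd 0 2 0 0 (nd 0 1 0 0 (nd 0 1 0 0 (lf 1 1 0 375 Tip) (nd 0 2 0 0
(lf 1 0 0 421 Tip) (lf 1 2 0 927 Tip))) (nd 0 2 0 0 (lf 1 1 0 1216 Tip) (nd 0 3 0 0 (lf 1 0 0 1078
Tip) (lf 1 3 0 2316 Tip)))) (nd 1 0 0 0 (nd 0 1 0 0 (nd 0 1 0 0 (nd 0 1 0 0 (lf 0 2 0 448 Tip) (lf 0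
3 0 1151 Tip)) (nd 0 2 0 0 (lf 0 2 0 1466 Tip) (lf 0 4 0 2724 Tip))) (nd 0 2 0 0 (lf 0 3 0 3765 Tip)
(lf 0 5 0 6274 Tip))) (nd 1 1 0 0 (nd 0 1 0 0 (nd 0 1 0 0 (lf 0 2 0 445 Tip) (lf 0 3 0 1141 Tip))
(nd 0 2 0 0 (lf 0 2 0 1453 Tip) (lf 0 4 0 2690 Tip))) Tip))))) (nd 0 1 0 0 (nd 0 0 0 0 (nd 0 1 0 0
(nd 0 1 0 0 (nd 0 1 0 0 (nd 0 1 0 0 (lf 1 0 1 410 Tip) (lf 1 1 1 1076 Tip)) (nd 0 2 0 0 (lf 1 0 1
1442 Tip) (lf 1 2 1 2600 Tip))) (nd 0 2 0 0 (lf 1 1 1 3663 Tip) (nd 0 3 0 0 (lf 1 0 1 3812 Tip) (lf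
1 3 1 6166 Tip)))) (nd 0 2 0 0 (nd 0 2 0 0 (lf 1 0 1 4877 Tip) (lf 1 2 1 8941 Tip)) (nd 0 3 0 0 (lf
1 1 1 9817 Tip) (nd 0 4 0 0 (lf 1 0 1 9345 Tip) (lf 1 4 1 14526 Tip))))) (nd 0 1 0 0 (nd 0 1 0 0 (nd
0 1 0 0 (nd 0 1 0 0 (lf 1 0 1 407 Tip) (lf 1 1 1 1068 Tip)) (nd 0 2 0 0 (lf 1 0 1 1430 Tip) (lf 1 2
1 2574 Tip))) (nd 0 2 0 0 (lf 1 1 1 3619 Tip) (nd 0 3 0 0 (lf 1 0 1 3757 Tip) (lf 1 3 1 6067 Tip))))
(nd 0 2 0 0 (nd 0 1 0 0 (nd 0 1 0 0 (lf 1 0 1 363 Tip) (lf 1 1 1 970 Tip)) (nd 0 2 0 0 (lf 1 0 1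
1291 Tip) (lf 1 2 1 2342 Tip))) (nd 1 0 1 0 (nd 0 1 0 0 (nd 0 1 0 0 (nd 0 1 0 0 (lf 0 1 0 107 Tip)
(lf 0 2 0 429 Tip)) (lf 0 3 0 1107 Tip)) (nd 0 2 0 0 (lf 0 2 0 1410 Tip) (lf 0 4 0 2609 Tip))) (nd 1
1 1 0 (nd 0 1 0 0 (lf 0 2 0 400 Tip) (lf 0 3 0 1035 Tip)) Tip))))) (nd 0 1 1 0 (nd 0 0 0 0 (nd 0 1 0
0 (nd 0 1 0 0 (nd 0 1 0 0 (nd 0 1 0 0 (lf 1 0 0 230 Tip) (lf 1 1 0 681 Tip)) (nd 0 2 0 0 (lf 1 0 0
748 Tip) (lf 1 2 0 1757 Tip))) (nd 0 2 0 0 (lf 1 1 0 2265 Tip) (nd 0 3 0 0 (lf 1 0 0 1897 Tip) (lf 1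
3 0 4288 Tip)))) (nd 0 2 0 0 (nd 0 2 0 0 (lf 1 0 0 2415 Tip) (lf 1 2 0 5933 Tip)) (nd 0 3 0 0 (lf 1
1 0 5938 Tip) (nd 0 4 0 0 (lf 1 0 0 4476 Tip) (lf 1 4 0 10209 Tip))))) (nd 0 1 0 0 (nd 0 1 0 0 (nd 0
1 0 0 (nd 0 1 0 0 (lf 1 0 0 229 Tip) (lf 1 1 0 675 Tip)) (nd 0 2 0 0 (lf 1 0 0 740 Tip) (lf 1 2 0
1740 Tip))) (nd 0 2 0 0 (lf 1 1 0 2236 Tip) (nd 0 3 0 0 (lf 1 0 0 1874 Tip) (lf 1 3 0 4213 Tip))))
(nd 0 2 0 0 (nd 0 1 0 0 (nd 0 1 0 0 (lf 1 0 0 215 Tip) (lf 1 1 0 612 Tip)) (nd 0 2 0 0 (lf 1 0 0 688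
Tip) (lf 1 2 0 1487 Tip))) (nd 1 0 0 0 (nd 0 1 0 0 (nd 0 1 0 0 (nd 0 1 0 0 (lf 0 1 0 230 Tip) (lf 0
2 0 748 Tip)) (lf 0 3 0 1897 Tip)) (nd 0 2 0 0 (lf 0 2 0 2415 Tip) (lf 0 4 0 4476 Tip))) (nd 1 1 0 0
(nd 0 1 0 0 (nd 0 1 0 0 (lf 0 1 0 229 Tip) (lf 0 2 0 740 Tip)) (lf 0 3 0 1874 Tip)) Tip))))) (nd 0 2
0 0 (nd 0 0 0 0 (nd 0 1 0 0 (nd 0 1 0 0 (nd 0 1 0 0 (lf 1 0 1 732 Tip) (lf 1 1 1 1837 Tip)) (nd 0 2
0 0 (lf 1 0 1 2442 Tip) (lf 1 2 1 4427 Tip))) (nd 0 2 0 0 (lf 1 1 1 6211 Tip) (nd 0 3 0 0 (lf 1 0 1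
6420 Tip) (lf 1 3 1 10478 Tip)))) (nd 0 1 0 0 (nd 0 1 0 0 (nd 0 1 0 0 (lf 1 0 1 727 Tip) (lf 1 1 1
1819 Tip)) (nd 0 2 0 0 (lf 1 0 1 2408 Tip) (lf 1 2 1 4354 Tip))) (nd 0 2 0 0 (nd 0 1 0 0 (lf 1 0 1
650 Tip) (lf 1 1 1 1567 Tip)) (nd 1 0 1 0 (nd 0 1 0 0 (nd 0 1 0 0 (lf 0 1 0 219 Tip) (lf 0 2 0 718
Tip)) (lf 0 3 0 1818 Tip)) (nd 1 1 1 0 (nd 0 1 0 0 (lf 0 1 0 202 Tip) (lf 0 2 0 655 Tip)) Tip)))))
(nd 0 2 1 0 (nd 0 0 0 0 (nd 0 1 0 0 (nd 0 1 0 0 (nd 0 1 0 0 (lf 1 0 0 384 Tip) (lf 1 1 0 1146 Tip))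
(nd 0 2 0 0 (lf 1 0 0 1226 Tip) (lf 1 2 0 2961 Tip))) (nd 0 2 0 0 (lf 1 1 0 3784 Tip) (nd 0 3 0 0
(lf 1 0 0 3094 Tip) (lf 1 3 0 7215 Tip)))) (nd 0 1 0 0 (nd 0 1 0 0 (nd 0 1 0 0 (lf 1 0 0 380 Tip)
(lf 1 1 0 1134 Tip)) (nd 0 2 0 0 (lf 1 0 0 1209 Tip) (lf 1 2 0 2882 Tip))) (nd 0 2 0 0 (nd 0 1 0 0
(lf 1 0 0 286 Tip) (lf 1 1 0 856 Tip)) (nd 1 0 0 0 (nd 0 1 0 0 (nd 0 1 0 0 (lf 0 1 0 384 Tip) (lf 0
2 0 1226 Tip)) (lf 0 3 0 3094 Tip)) (nd 1 1 0 0 (nd 0 1 0 0 (lf 0 1 0 380 Tip) (lf 0 2 0 1209 Tip))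
Tip))))) (nd 0 3 0 0 (nd 0 0 0 0 (nd 0 1 0 0 (nd 0 1 0 0 (lf 1 0 1 1233 Tip) (lf 1 1 1 3097 Tip))
(nd 0 2 0 0 (lf 1 0 1 4085 Tip) (lf 1 2 1 7454 Tip))) (nd 0 1 0 0 (nd 0 1 0 0 (lf 1 0 1 1220 Tip)
(lf 1 1 1 3034 Tip)) (nd 1 0 1 0 (nd 0 1 0 0 (lf 0 1 0 368 Tip) (lf 0 2 0 1174 Tip)) Tip))) (nd 0 3
1 0 (nd 0 0 0 0 (nd 0 1 0 0 (nd 0 1 0 0 (lf 1 0 0 627 Tip) (lf 1 1 0 1903 Tip)) (nd 0 2 0 0 (lf 1 0
0 1985 Tip) (lf 1 2 0 4933 Tip))) (nd 0 1 0 0 (nd 0 1 0 0 (lf 1 0 0 620 Tip) (lf 1 1 0 1747 Tip))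
(nd 1 0 0 0 (nd 0 1 0 0 (lf 0 1 0 627 Tip) (lf 0 2 0 1985 Tip)) (nd 1 1 0 0 (lf 0 1 0 620 Tip)
Tip)))) (nd 0 4 0 0 (nd 0 0 0 0 (nd 0 1 0 0 (lf 1 0 1 2051 Tip) (lf 1 1 1 5162 Tip)) (nd 0 1 0 0 (lf
1 0 1 2017 Tip) (nd 1 0 1 0 (lf 0 1 0 603 Tip) Tip))) (nd 0 4 1 0 (nd 0 0 0 0 (nd 0 1 0 0 (lf 1 0 0
1009 Tip) (lf 1 1 0 3125 Tip)) (nd 1 0 0 0 (lf 0 1 0 1009 Tip) Tip)) (nd 0 5 0 0 (nd 0 0 0 0 (lf 1 0
1 3372 Tip) Tip) (nd 0 5 1 0 (nd 0 0 0 0 (lf 1 0 0 1608 Tip) Tip) (nd 1 0 0 0 (nd 0 0 0 0 (nd 0 0 1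
0 (nd 0 1 0 0 (nd 0 1 0 0 (nd 0 1 0 0 (lf 0 2 0 381 Tip) (lf 0 3 0 1097 Tip)) (nd 0 2 0 0 (lf 0 2 0
1400 Tip) (lf 0 4 0 2724 Tip))) (nd 0 2 0 0 (lf 0 3 0 3781 Tip) (lf 0 5 0 6542 Tip))) (nd 0 1 0 0
(nd 0 1 0 0 (nd 0 1 0 0 (nd 0 1 0 0 (lf 0 1 1 398 Tip) (lf 0 2 1 1103 Tip)) (nd 0 1 1 0 (lf 0 2 0
1406 Tip) (lf 0 3 1 2721 Tip))) (nd 0 1 1 0 (lf 0 3 0 3779 Tip) (nd 0 2 0 0 (lf 0 2 1 3777 Tip) (lf
0 4 1 6514 Tip)))) (nd 0 1 1 0 (nd 0 2 0 0 (lf 0 2 0 4829 Tip) (lf 0 4 0 9415 Tip)) (nd 0 2 0 0 (lf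
0 3 1 9396 Tip) (nd 0 2 1 0 (lf 0 3 0 10218 Tip) (lf 0 5 1 15489 Tip)))))) (nd 0 0 1 0 (nd 0 1 0 0
(nd 0 1 0 0 (nd 0 1 0 0 (lf 0 2 0 378 Tip) (lf 0 3 0 1085 Tip)) (nd 0 2 0 0 (lf 0 2 0 1384 Tip) (lf
0 4 0 2668 Tip))) (nd 0 2 0 0 (lf 0 3 0 3694 Tip) (lf 0 5 0 6321 Tip))) (nd 0 1 0 0 (nd 0 0 1 0 (nd
0 1 0 0 (nd 0 1 0 0 (lf 0 2 0 379 Tip) (lf 0 3 0 1087 Tip)) (nd 0 2 0 0 (lf 0 2 0 1386 Tip) (lf 0 4
0 2675 Tip))) (nd 0 1 0 0 (nd 0 1 0 0 (nd 0 1 0 0 (lf 0 1 1 396 Tip) (lf 0 2 1 1094 Tip)) (nd 0 1 1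
0 (lf 0 2 0 1393 Tip) (lf 0 3 1 2677 Tip))) (nd 0 1 1 0 (lf 0 3 0 3709 Tip) (nd 0 2 0 0 (lf 0 2 1
3707 Tip) (lf 0 4 1 6337 Tip))))) (nd 0 1 1 0 (nd 0 1 0 0 (nd 0 1 0 0 (lf 0 2 0 358 Tip) (lf 0 3 0
971 Tip)) (nd 0 2 0 0 (lf 0 2 0 1233 Tip) (lf 0 4 0 2288 Tip))) (nd 0 2 0 0 (nd 0 0 1 0 (nd 0 1 0 0
(lf 0 2 0 364 Tip) (lf 0 3 0 981 Tip)) (nd 0 1 0 0 (lf 0 2 1 1012 Tip) (nd 0 1 1 0 (lf 0 2 0 1278
Tip) (lf 0 3 1 2385 Tip)))) Tip))))) (nd 1 0 1 0 (nd 0 0 0 0 (nd 0 1 0 0 (nd 0 1 0 0 (nd 0 1 0 0 (lf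
0 2 0 707 Tip) (lf 0 3 0 1881 Tip)) (nd 0 2 0 0 (lf 0 2 0 2400 Tip) (lf 0 4 0 4624 Tip))) (nd 0 2 0
0 (lf 0 3 0 6402 Tip) (lf 0 5 0 11080 Tip))) (nd 0 1 0 0 (nd 0 1 0 0 (nd 0 1 0 0 (lf 0 2 0 701 Tip)
(lf 0 3 0 1851 Tip)) (nd 0 2 0 0 (lf 0 2 0 2359 Tip) (lf 0 4 0 4495 Tip))) (nd 0 2 0 0 (nd 0 1 0 0
(lf 0 2 0 645 Tip) (lf 0 3 0 1619 Tip)) Tip))) (nd 1 1 0 0 (nd 0 0 0 0 (nd 0 0 1 0 (nd 0 1 0 0 (nd 0
1 0 0 (nd 0 1 0 0 (lf 0 1 0 168 Tip) (lf 0 2 0 687 Tip)) (lf 0 3 0 1844 Tip)) (nd 0 2 0 0 (lf 0 2 0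
2353 Tip) (lf 0 4 0 4540 Tip))) (nd 0 1 0 0 (nd 0 1 0 0 (nd 0 1 0 0 (lf 0 1 1 694 Tip) (lf 0 2 1
1844 Tip)) (nd 0 1 1 0 (lf 0 2 0 2353 Tip) (lf 0 3 1 4521 Tip))) (nd 0 1 1 0 (lf 0 3 0 6270 Tip) (nd
0 2 0 0 (lf 0 2 1 6265 Tip) (lf 0 4 1 10814 Tip))))) (nd 0 0 1 0 (nd 0 1 0 0 (nd 0 1 0 0 (nd 0 1 0 0
(lf 0 1 0 167 Tip) (lf 0 2 0 679 Tip)) (lf 0 3 0 1811 Tip)) (nd 0 2 0 0 (lf 0 2 0 2253 Tip) (lf 0 4
0 4395 Tip))) (nd 0 1 0 0 (nd 0 0 1 0 (nd 0 1 0 0 (nd 0 1 0 0 (lf 0 1 0 167 Tip) (lf 0 2 0 681 Tip))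
(lf 0 3 0 1816 Tip)) (nd 0 1 0 0 (nd 0 1 0 0 (lf 0 1 1 688 Tip) (lf 0 2 1 1818 Tip)) (nd 0 1 1 0 (lf
0 2 0 2263 Tip) (lf 0 3 1 4409 Tip)))) (nd 0 1 1 0 (nd 0 1 0 0 (nd 0 1 0 0 (lf 0 1 0 156 Tip) (lf 0
2 0 602 Tip)) (lf 0 3 0 1523 Tip)) (nd 0 2 0 0 (nd 0 0 1 0 (nd 0 1 0 0 (lf 0 1 0 159 Tip) (lf 0 2 0
615 Tip)) (nd 0 1 0 0 (lf 0 1 1 630 Tip) (lf 0 2 1 1601 Tip))) Tip))))) (nd 1 1 1 0 (nd 0 0 0 0 (nd
0 1 0 0 (nd 0 1 0 0 (nd 0 1 0 0 (lf 0 1 0 354 Tip) (lf 0 2 0 1180 Tip)) (lf 0 3 0 3108 Tip)) (nd 0 2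
0 0 (lf 0 2 0 3963 Tip) (lf 0 4 0 7620 Tip))) (nd 0 1 0 0 (nd 0 1 0 0 (nd 0 1 0 0 (lf 0 1 0 344 Tip)
(lf 0 2 0 1163 Tip)) (lf 0 3 0 3023 Tip)) (nd 0 2 0 0 (lf 0 2 0 1006 Tip) Tip))) (nd 1 2 0 0 (nd 0 0
0 0 (nd 0 0 1 0 (nd 0 1 0 0 (nd 0 1 0 0 (lf 0 1 0 340 Tip) (lf 0 2 0 1156 Tip)) (lf 0 3 0 3051 Tip))
(nd 0 1 0 0 (nd 0 1 0 0 (lf 0 1 1 1158 Tip) (lf 0 2 1 3041 Tip)) (nd 0 1 1 0 (lf 0 2 0 3882 Tip) (lf
0 3 1 7440 Tip)))) (nd 0 0 1 0 (nd 0 1 0 0 (nd 0 1 0 0 (lf 0 1 0 324 Tip) (lf 0 2 0 1136 Tip)) (lf 0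
3 0 2956 Tip)) (nd 0 1 0 0 (nd 0 0 1 0 (nd 0 1 0 0 (lf 0 1 0 324 Tip) (lf 0 2 0 1139 Tip)) (nd 0 1 0
0 (lf 0 1 1 1142 Tip) (lf 0 2 1 2969 Tip))) (nd 0 1 1 0 (nd 0 1 0 0 (lf 0 1 0 293 Tip) (lf 0 2 0 938
Tip)) (nd 0 2 0 0 (nd 0 0 1 0 (lf 0 1 0 304 Tip) (lf 0 1 1 997 Tip)) Tip))))) (nd 1 2 1 0 (nd 0 0 0
0 (nd 0 1 0 0 (nd 0 1 0 0 (lf 0 1 0 587 Tip) (lf 0 2 0 1937 Tip)) (lf 0 3 0 5075 Tip)) (nd 0 1 0 0
(nd 0 1 0 0 (lf 0 1 0 579 Tip) (lf 0 2 0 1864 Tip)) Tip)) (nd 1 3 0 0 (nd 0 0 0 0 (nd 0 0 1 0 (nd 0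
1 0 0 (lf 0 1 0 575 Tip) (lf 0 2 0 1902 Tip)) (nd 0 1 0 0 (lf 0 1 1 1898 Tip) (lf 0 2 1 4961 Tip)))
(nd 0 0 1 0 (nd 0 1 0 0 (lf 0 1 0 564 Tip) (lf 0 2 0 1820 Tip)) (nd 0 1 0 0 (nd 0 0 1 0 (lf 0 1 0
566 Tip) (lf 0 1 1 1844 Tip)) (nd 0 1 1 0 (lf 0 1 0 366 Tip) Tip)))) (nd 1 3 1 0 (nd 0 0 0 0 (nd 0 1
0 0 (lf 0 1 0 956 Tip) (lf 0 2 0 3121 Tip)) (nd 0 1 0 0 (lf 0 1 0 809 Tip) Tip)) (nd 1 4 0 0 (nd 0 0
0 0 (nd 0 0 1 0 (lf 0 1 0 939 Tip) (lf 0 1 1 3066 Tip)) (nd 0 0 1 0 (lf 0 1 0 766 Tip) Tip)) (nd 1 4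
1 0 (nd 0 0 0 0 (lf 0 1 0 1539 Tip) Tip) (nd 1 5 0 0 (nd 0 0 0 0 (lf 0 0 1 1514 Tip) Tip)
Tip)))))))))))))))))))))))"

lemmas look_table_dom3 = arg_cong[where f = look, OF table_dom3_def, THEN fun_cong, unfolded small_nats]

lemma cert_dom3: "cert_ok True 15190245 1000000 main3 table_dom3"
  unfolding cert_ok_def main3_def
  apply (subst (2) table_dom3_def)
  unfolding small_nats
  by (simp only: look_table_dom3 eval_simps cong: eval_congs sum_map_cong all_in_congs if_weak_cong)

lemma start_dom3: "0 < W True table_dom3 start3 None zero_vec zero_vec []"
  unfolding start3_def replicate_simps concat.simps append.simps
  by (simp only: look_table_dom3 eval_simps cong: eval_congs sum_map_cong if_weak_cong)

lemma bound_dom3: "ereal 1.743 \<le> c_dom_lim 3"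
  by (rule bound_from_certificate(2)[OF reaches_start3 reaches_main3 reaches_fin3 _ _ _ start_dom3 cert_dom3])
    (simp_all add: fin3_def main3_def replicate_simps get_V)

section \<open>Certificates for degree 4\<close>

text \<open>The truncation is severe: of the profiles with all frontier vertices in the set, only
  the undivided one and the one that splits off a single pool vertex are kept.\<close>

definition table_conn4 :: trie where "table_conn4 =
Nd 0 (nd 0 0 0 0 (nd 0 0 0 0 (nd 0 1 0 0 (lf 1 4 1 4683 Tip) (lf 1 5 1 10000 Tip)) Tip) (nd 0 0 1 0
(nd 0 0 0 0 (nd 0 1 0 0 (nd 0 4 0 0 (lf 1 0 0 2405 Tip) (lf 1 4 0 4197 Tip)) (nd 0 5 0 0 (lf 1 0 0
6686 Tip) (lf 1 5 0 9047 Tip))) Tip) (nd 0 1 0 0 (nd 0 0 0 0 (nd 0 1 0 0 (nd 0 2 0 0 (lf 1 1 1 1608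
Tip) (nd 0 3 0 0 (lf 1 0 1 2095 Tip) (lf 1 3 1 4298 Tip))) (nd 0 2 0 0 (lf 1 2 1 4456 Tip) (nd 0 3 0
0 (lf 1 1 1 5197 Tip) (nd 0 4 0 0 (lf 1 0 1 5626 Tip) (lf 1 4 1 9237 Tip))))) Tip) (nd 0 1 1 0 (nd 0
0 0 0 (nd 0 1 0 0 (nd 0 1 0 0 (nd 0 2 0 0 (lf 1 0 0 649 Tip) Tip) (nd 0 3 0 0 (lf 1 0 0 2381 Tip)
(lf 1 3 0 3835 Tip))) (nd 0 2 0 0 (nd 0 2 0 0 (lf 1 0 0 2563 Tip) (lf 1 2 0 5082 Tip)) (nd 0 3 0 0
(lf 1 1 0 5659 Tip) (nd 0 4 0 0 (lf 1 0 0 5747 Tip) (lf 1 4 0 8251 Tip))))) Tip) (nd 0 2 0 0 (nd 0 0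
0 0 (nd 0 1 0 0 (nd 0 1 0 0 (lf 1 1 1 1043 Tip) (nd 0 2 0 0 (lf 1 0 1 2038 Tip) (lf 1 2 1 3928
Tip))) (nd 0 2 0 0 (lf 1 1 1 5083 Tip) (nd 0 3 0 0 (lf 1 0 1 5729 Tip) (lf 1 3 1 8450 Tip)))) Tip)
(nd 0 2 1 0 (nd 0 0 0 0 (nd 0 1 0 0 (nd 0 1 0 0 (nd 0 1 0 0 (lf 1 0 0 440 Tip) (lf 1 1 0 1390 Tip))
(nd 0 2 0 0 (lf 1 0 0 2023 Tip) (lf 1 2 0 3452 Tip))) (nd 0 2 0 0 (lf 1 1 0 4629 Tip) (nd 0 3 0 0
(lf 1 0 0 4961 Tip) (lf 1 3 0 7439 Tip)))) Tip) (nd 0 3 0 0 (nd 0 0 0 0 (nd 0 1 0 0 (nd 0 1 0 0 (lf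
1 0 1 1393 Tip) (lf 1 1 1 3554 Tip)) (nd 0 2 0 0 (lf 1 0 1 4785 Tip) (lf 1 2 1 7643 Tip))) Tip) (nd
0 3 1 0 (nd 0 0 0 0 (nd 0 1 0 0 (nd 0 1 0 0 (lf 1 0 0 1301 Tip) (lf 1 1 0 3029 Tip)) (nd 0 2 0 0 (lf
1 0 0 3966 Tip) (lf 1 2 0 6583 Tip))) Tip) (nd 0 4 0 0 (nd 0 0 0 0 (nd 0 1 0 0 (lf 1 0 1 3158 Tip)
(lf 1 1 1 6807 Tip)) Tip) (nd 0 4 1 0 (nd 0 0 0 0 (nd 0 1 0 0 (lf 1 0 0 2546 Tip) (lf 1 1 0 5642
Tip)) Tip) (nd 0 5 0 0 (nd 0 0 0 0 (lf 1 0 1 5910 Tip) Tip) (nd 0 5 1 0 (nd 0 0 0 0 (lf 1 0 0 4569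
Tip) Tip) (nd 1 0 0 0 (nd 0 0 0 0 (nd 0 1 0 0 (lf 0 4 1 3924 Tip) (lf 0 5 1 8972 Tip)) Tip) (nd 1 0
1 0 (nd 0 0 0 0 (nd 0 1 0 0 (lf 0 4 0 3437 Tip) (nd 0 2 0 0 (lf 0 3 0 4528 Tip) (lf 0 5 0 7977
Tip))) Tip) (nd 1 1 0 0 (nd 0 0 0 0 (nd 0 0 1 0 (lf 0 4 0 3448 Tip) (nd 0 1 0 0 (nd 0 1 1 0 (lf 0 2
0 596 Tip) (lf 0 3 1 3345 Tip)) (nd 0 1 1 0 (lf 0 3 0 4106 Tip) (nd 0 2 0 0 (lf 0 2 1 4096 Tip) (lf
0 4 1 7927 Tip))))) Tip) (nd 1 1 1 0 (nd 0 0 0 0 (nd 0 1 0 0 (nd 0 1 0 0 (lf 0 2 0 1031 Tip) (lf 0 3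
0 2881 Tip)) (nd 0 2 0 0 (lf 0 2 0 3544 Tip) (lf 0 4 0 6883 Tip))) Tip) (nd 1 2 0 0 (nd 0 0 0 0 (nd
0 0 1 0 (nd 0 1 0 0 (lf 0 2 0 995 Tip) (lf 0 3 0 2913 Tip)) (nd 0 1 0 0 (nd 0 1 0 0 (lf 0 1 1 994
Tip) (lf 0 2 1 2834 Tip)) (nd 0 1 1 0 (lf 0 2 0 3463 Tip) (lf 0 3 1 6827 Tip)))) Tip) (nd 1 2 1 0
(nd 0 0 0 0 (nd 0 1 0 0 (nd 0 1 0 0 (lf 0 1 0 639 Tip) (lf 0 2 0 2250 Tip)) (lf 0 3 0 5727 Tip))
Tip) (nd 1 3 0 0 (nd 0 0 0 0 (nd 0 0 1 0 (nd 0 1 0 0 (lf 0 1 0 615 Tip) (lf 0 2 0 2282 Tip)) (nd 0 1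
0 0 (lf 0 1 1 2235 Tip) (lf 0 2 1 5696 Tip))) Tip) (nd 1 3 1 0 (nd 0 0 0 0 (nd 0 1 0 0 (lf 0 1 0
1387 Tip) (lf 0 2 0 4403 Tip)) Tip) (nd 1 4 0 0 (nd 0 0 0 0 (nd 0 0 1 0 (lf 0 1 0 1402 Tip) (lf 0 1
1 4407 Tip)) Tip) (nd 1 4 1 0 (nd 0 0 0 0 (lf 0 1 0 2689 Tip) Tip) (nd 1 5 0 0 (nd 0 0 0 0 (lf 0 0 1
2759 Tip) Tip) Tip)))))))))))))))))))))))"

lemmas look_table_conn4 = arg_cong[where f = look, OF table_conn4_def, THEN fun_cong, unfolded small_nats]

lemma cert_conn4: "cert_ok False 9485 1000 main4 table_conn4"
  unfolding cert_ok_def main4_def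
  apply (subst (2) table_conn4_def)
  unfolding small_nats
  by (simp only: look_table_conn4 eval_simps cong: eval_congs sum_map_cong all_in_congs if_weak_cong)

lemma start_conn4: "0 < W False table_conn4 start4 None zero_vec zero_vec []"
  unfolding start4_def replicate_simps concat.simps append.simps
  by (simp only: look_table_conn4 eval_simps cong: eval_congs sum_map_cong if_weak_cong)

lemma bound_conn4: "ereal 1.897 \<le> c_lim 4"
  by (rule bound_from_certificate(1)[OF reaches_start4 reaches_main4 reaches_fin4 _ _ _ start_conn4 cert_conn4])
    (simp_all add: fin4_def main4_def replicate_simps get_V)

definition table_dom4 :: trie where "table_dom4 =
Nd 0 (nd 0 0 0 0 (nd 0 0 0 0 (nd 0 1 0 0 (nd 0 1 0 0 (lf 1 3 1 1540 Tip) (nd 0 2 0 0 (lf 1 2 1 2302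
Tip) (lf 1 4 1 4910 Tip))) (nd 0 2 0 0 (lf 1 3 1 7160 Tip) (nd 0 3 0 0 (lf 1 2 1 8142 Tip) (nd 0 4 0
0 (lf 1 1 1 8485 Tip) (lf 1 5 1 10000 Tip))))) (nd 0 1 0 0 (lf 1 4 1 4896 Tip) Tip)) (nd 0 0 1 0 (nd
0 0 0 0 (nd 0 1 0 0 (nd 0 1 0 0 (nd 0 3 0 0 (lf 1 0 0 1176 Tip) Tip) (nd 0 2 0 0 (nd 0 2 0 0 (lf 1 0
0 1518 Tip) Tip) (nd 0 4 0 0 (lf 1 0 0 3359 Tip) (lf 1 4 0 4367 Tip)))) (nd 0 2 0 0 (nd 0 3 0 0 (lf
1 0 0 4504 Tip) (lf 1 3 0 6245 Tip)) (nd 0 3 0 0 (lf 1 2 0 6955 Tip) (nd 0 4 0 0 (lf 1 1 0 7056 Tip)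
(nd 0 5 0 0 (lf 1 0 0 6742 Tip) (lf 1 5 0 8799 Tip)))))) (nd 0 1 0 0 (nd 0 1 0 0 (nd 0 3 0 0 (lf 1 0
0 1098 Tip) Tip) (nd 0 4 0 0 (lf 1 0 0 3336 Tip) (lf 1 4 0 4344 Tip))) (nd 1 0 0 0 (nd 0 1 0 0 (nd 0
1 0 0 (lf 0 3 0 1199 Tip) (lf 0 4 0 2950 Tip)) (nd 0 2 0 0 (lf 0 3 0 3376 Tip) (lf 0 5 0 6110 Tip)))
(nd 1 1 0 0 (nd 0 1 0 0 (lf 0 3 0 1180 Tip) (lf 0 4 0 2816 Tip)) Tip)))) (nd 0 1 0 0 (nd 0 0 0 0 (nd
0 1 0 0 (nd 0 1 0 0 (lf 1 2 1 1833 Tip) (nd 0 2 0 0 (lf 1 1 1 2684 Tip) (nd 0 3 0 0 (lf 1 0 1 2766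
Tip) (lf 1 3 1 4477 Tip)))) (nd 0 2 0 0 (nd 0 2 0 0 (lf 1 0 1 3499 Tip) (lf 1 2 1 6439 Tip)) (nd 0 3
0 0 (lf 1 1 1 7219 Tip) (nd 0 4 0 0 (lf 1 0 1 7413 Tip) (lf 1 4 1 9039 Tip))))) (nd 0 1 0 0 (nd 0 1
0 0 (lf 1 2 1 1613 Tip) (nd 0 2 0 0 (lf 1 1 1 2374 Tip) (nd 0 3 0 0 (lf 1 0 1 2697 Tip) (lf 1 3 1
4456 Tip)))) (nd 0 2 0 0 (lf 1 2 1 1535 Tip) (nd 1 0 1 0 (nd 0 1 0 0 (lf 0 3 0 997 Tip) (lf 0 4 0
2543 Tip)) (nd 1 1 1 0 (lf 0 3 0 858 Tip) Tip))))) (nd 0 1 1 0 (nd 0 0 0 0 (nd 0 1 0 0 (nd 0 1 0 0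
(nd 0 2 0 0 (lf 1 0 0 1026 Tip) (lf 1 2 0 1876 Tip)) (nd 0 2 0 0 (lf 1 1 0 2610 Tip) (nd 0 3 0 0 (lf
1 0 0 2808 Tip) (lf 1 3 0 3933 Tip)))) (nd 0 2 0 0 (nd 0 2 0 0 (lf 1 0 0 3515 Tip) (lf 1 2 0 5531
Tip)) (nd 0 3 0 0 (lf 1 1 0 6024 Tip) (nd 0 4 0 0 (lf 1 0 0 5901 Tip) (lf 1 4 0 7895 Tip))))) (nd 0
1 0 0 (nd 0 1 0 0 (nd 0 2 0 0 (lf 1 0 0 949 Tip) (lf 1 2 0 1826 Tip)) (nd 0 2 0 0 (lf 1 1 0 2528
Tip) (nd 0 3 0 0 (lf 1 0 0 2780 Tip) (lf 1 3 0 3910 Tip)))) (nd 0 2 0 0 (nd 0 2 0 0 (lf 1 0 0 916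
Tip) (lf 1 2 0 1755 Tip)) (nd 1 0 0 0 (nd 0 1 0 0 (nd 0 1 0 0 (lf 0 2 0 959 Tip) (lf 0 3 0 2429
Tip)) (nd 0 2 0 0 (lf 0 2 0 2912 Tip) (lf 0 4 0 5139 Tip))) (nd 1 1 0 0 (nd 0 1 0 0 (lf 0 2 0 939
Tip) (lf 0 3 0 2378 Tip)) (nd 1 2 0 0 (lf 0 2 0 907 Tip) Tip)))))) (nd 0 2 0 0 (nd 0 0 0 0 (nd 0 1 0
0 (nd 0 1 0 0 (nd 0 1 0 0 (lf 1 0 1 609 Tip) (lf 1 1 1 1905 Tip)) (nd 0 2 0 0 (lf 1 0 1 2672 Tip)
(lf 1 2 1 4045 Tip))) (nd 0 2 0 0 (lf 1 1 1 5724 Tip) (nd 0 3 0 0 (lf 1 0 1 6311 Tip) (lf 1 3 1 8121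
Tip)))) (nd 0 1 0 0 (nd 0 1 0 0 (nd 0 1 0 0 (lf 1 0 1 595 Tip) (lf 1 1 1 1839 Tip)) (nd 0 2 0 0 (lf
1 0 1 2553 Tip) (lf 1 2 1 4022 Tip))) (nd 0 2 0 0 (lf 1 1 1 1745 Tip) (nd 1 0 1 0 (nd 0 1 0 0 (lf 0
2 0 797 Tip) (lf 0 3 0 2230 Tip)) (nd 1 1 1 0 (lf 0 2 0 765 Tip) Tip))))) (nd 0 2 1 0 (nd 0 0 0 0
(nd 0 1 0 0 (nd 0 1 0 0 (nd 0 1 0 0 (lf 1 0 0 742 Tip) (lf 1 1 0 1694 Tip)) (nd 0 2 0 0 (lf 1 0 0
2289 Tip) (lf 1 2 0 3495 Tip))) (nd 0 2 0 0 (lf 1 1 0 4791 Tip) (nd 0 3 0 0 (lf 1 0 0 5021 Tip) (lf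
1 3 0 7014 Tip)))) (nd 0 1 0 0 (nd 0 1 0 0 (nd 0 1 0 0 (lf 1 0 0 681 Tip) (lf 1 1 0 1664 Tip)) (nd 0
2 0 0 (lf 1 0 0 2246 Tip) (lf 1 2 0 3469 Tip))) (nd 0 2 0 0 (nd 0 1 0 0 (lf 1 0 0 545 Tip) (lf 1 1 0
1548 Tip)) (nd 1 0 0 0 (nd 0 1 0 0 (nd 0 1 0 0 (lf 0 1 0 631 Tip) (lf 0 2 0 1885 Tip)) (lf 0 3 0
4222 Tip)) (nd 1 1 0 0 (nd 0 1 0 0 (lf 0 1 0 613 Tip) (lf 0 2 0 1807 Tip)) Tip))))) (nd 0 3 0 0 (nd
0 0 0 0 (nd 0 1 0 0 (nd 0 1 0 0 (lf 1 0 1 1755 Tip) (lf 1 1 1 3610 Tip)) (nd 0 2 0 0 (lf 1 0 1 5011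
Tip) (lf 1 2 1 7232 Tip))) (nd 0 1 0 0 (nd 0 1 0 0 (lf 1 0 1 1721 Tip) (lf 1 1 1 3586 Tip)) (nd 0 2
0 0 (lf 1 0 1 1672 Tip) (nd 1 0 1 0 (nd 0 1 0 0 (lf 0 1 0 528 Tip) (lf 0 2 0 1702 Tip)) (nd 1 1 1 0
(lf 0 1 0 458 Tip) Tip))))) (nd 0 3 1 0 (nd 0 0 0 0 (nd 0 1 0 0 (nd 0 1 0 0 (lf 1 0 0 1479 Tip) (lf
1 1 0 3035 Tip)) (nd 0 2 0 0 (lf 1 0 0 3988 Tip) (lf 1 2 0 6131 Tip))) (nd 0 1 0 0 (nd 0 1 0 0 (lf 1
0 0 1456 Tip) (lf 1 1 0 3008 Tip)) (nd 0 2 0 0 (lf 1 0 0 1205 Tip) (nd 1 0 0 0 (nd 0 1 0 0 (lf 0 1 0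
1182 Tip) (lf 0 2 0 3226 Tip)) (nd 1 1 0 0 (lf 0 1 0 1150 Tip) Tip))))) (nd 0 4 0 0 (nd 0 0 0 0 (nd
0 1 0 0 (lf 1 0 1 3170 Tip) (lf 1 1 1 6354 Tip)) (nd 0 1 0 0 (lf 1 0 1 3141 Tip) (nd 1 0 1 0 (lf 0 1
0 1084 Tip) Tip))) (nd 0 4 1 0 (nd 0 0 0 0 (nd 0 1 0 0 (lf 1 0 0 2534 Tip) (lf 1 1 0 5209 Tip)) (nd
0 1 0 0 (lf 1 0 0 2512 Tip) (nd 1 0 0 0 (lf 0 1 0 1991 Tip) Tip))) (nd 0 5 0 0 (nd 0 0 0 0 (lf 1 0 1
5461 Tip) Tip) (nd 0 5 1 0 (nd 0 0 0 0 (lf 1 0 0 4199 Tip) Tip) (nd 1 0 0 0 (nd 0 0 0 0 (nd 0 1 0 0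
(lf 0 4 1 4100 Tip) (nd 0 1 1 0 (lf 0 4 0 5871 Tip) (nd 0 2 0 0 (lf 0 3 1 5818 Tip) (nd 0 2 1 0 (lf
0 3 0 6302 Tip) (lf 0 5 1 8752 Tip))))) (nd 0 1 0 0 (lf 0 4 1 4081 Tip) Tip)) (nd 1 0 1 0 (nd 0 0 0
0 (nd 0 1 0 0 (lf 0 4 0 3559 Tip) (nd 0 2 0 0 (lf 0 3 0 4862 Tip) (lf 0 5 0 7614 Tip))) (nd 0 1 0 0
(lf 0 4 0 3537 Tip) Tip)) (nd 1 1 0 0 (nd 0 0 0 0 (nd 0 0 1 0 (nd 0 1 0 0 (lf 0 3 0 1544 Tip) (nd 0
2 0 0 (lf 0 2 0 1797 Tip) (lf 0 4 0 3603 Tip))) (nd 0 1 0 0 (nd 0 1 0 0 (lf 0 2 1 1513 Tip) (nd 0 1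
1 0 (lf 0 2 0 1763 Tip) (lf 0 3 1 3500 Tip))) (nd 0 1 1 0 (lf 0 3 0 4747 Tip) (nd 0 2 0 0 (lf 0 2 1
4719 Tip) (lf 0 4 1 7462 Tip))))) (nd 0 0 1 0 (nd 0 1 0 0 (lf 0 3 0 1507 Tip) (lf 0 4 0 3564 Tip))
(nd 0 1 0 0 (nd 0 0 1 0 (lf 0 3 0 1510 Tip) (nd 0 1 0 0 (lf 0 2 1 1484 Tip) (nd 0 1 1 0 (lf 0 2 0
1567 Tip) (lf 0 3 1 3467 Tip)))) (nd 0 1 1 0 (lf 0 3 0 1217 Tip) (nd 0 2 0 0 (lf 0 2 1 1206 Tip)
Tip))))) (nd 1 1 1 0 (nd 0 0 0 0 (nd 0 1 0 0 (nd 0 1 0 0 (lf 0 2 0 1224 Tip) (lf 0 3 0 2935 Tip))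
(nd 0 2 0 0 (lf 0 2 0 3693 Tip) (lf 0 4 0 6384 Tip))) (nd 0 1 0 0 (nd 0 1 0 0 (lf 0 2 0 1198 Tip)
(lf 0 3 0 2907 Tip)) (nd 0 2 0 0 (lf 0 2 0 1122 Tip) Tip))) (nd 1 2 0 0 (nd 0 0 0 0 (nd 0 0 1 0 (nd
0 1 0 0 (nd 0 1 0 0 (lf 0 1 0 237 Tip) (lf 0 2 0 1192 Tip)) (lf 0 3 0 2958 Tip)) (nd 0 1 0 0 (nd 0 1
0 0 (lf 0 1 1 1174 Tip) (lf 0 2 1 2880 Tip)) (nd 0 1 1 0 (lf 0 2 0 3627 Tip) (lf 0 3 1 6260 Tip))))
(nd 0 0 1 0 (nd 0 1 0 0 (lf 0 2 0 1156 Tip) (lf 0 3 0 2922 Tip)) (nd 0 1 0 0 (nd 0 0 1 0 (lf 0 2 0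
1160 Tip) (nd 0 1 0 0 (lf 0 1 1 1143 Tip) (lf 0 2 1 2850 Tip))) (nd 0 1 1 0 (lf 0 2 0 1077 Tip) (nd
0 2 0 0 (lf 0 1 1 1092 Tip) Tip))))) (nd 1 2 1 0 (nd 0 0 0 0 (nd 0 1 0 0 (nd 0 1 0 0 (lf 0 1 0 766
Tip) (lf 0 2 0 2260 Tip)) (lf 0 3 0 5190 Tip)) (nd 0 1 0 0 (nd 0 1 0 0 (lf 0 1 0 744 Tip) (lf 0 2 0
2224 Tip)) (nd 0 2 0 0 (lf 0 1 0 555 Tip) Tip))) (nd 1 3 0 0 (nd 0 0 0 0 (nd 0 0 1 0 (nd 0 1 0 0 (lf
0 1 0 754 Tip) (lf 0 2 0 2280 Tip)) (nd 0 1 0 0 (lf 0 1 1 2233 Tip) (lf 0 2 1 5103 Tip))) (nd 0 0 1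
0 (nd 0 1 0 0 (lf 0 1 0 724 Tip) (lf 0 2 0 2231 Tip)) (nd 0 1 0 0 (nd 0 0 1 0 (lf 0 1 0 727 Tip) (lf
0 1 1 2189 Tip)) (nd 0 1 1 0 (lf 0 1 0 458 Tip) Tip)))) (nd 1 3 1 0 (nd 0 0 0 0 (nd 0 1 0 0 (lf 0 1
0 1392 Tip) (lf 0 2 0 3927 Tip)) (nd 0 1 0 0 (lf 0 1 0 1372 Tip) Tip)) (nd 1 4 0 0 (nd 0 0 0 0 (nd 0
0 1 0 (lf 0 1 0 1405 Tip) (lf 0 1 1 3887 Tip)) (nd 0 0 1 0 (lf 0 1 0 1379 Tip) (nd 0 1 0 0 (lf 0 0 1
1382 Tip) Tip))) (nd 1 4 1 0 (nd 0 0 0 0 (lf 0 1 0 2378 Tip) Tip) (nd 1 5 0 0 (nd 0 0 0 0 (lf 0 0 1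
2413 Tip) Tip) Tip)))))))))))))))))))))))"

lemmas look_table_dom4 = arg_cong[where f = look, OF table_dom4_def, THEN fun_cong, unfolded small_nats]

lemma cert_dom4: "cert_ok True 9375 1000 main4 table_dom4"
  unfolding cert_ok_def main4_def
  apply (subst (2) table_dom4_def)
  unfolding small_nats
  by (simp only: look_table_dom4 eval_simps cong: eval_congs sum_map_cong all_in_congs if_weak_cong)

lemma start_dom4: "0 < W True table_dom4 start4 None zero_vec zero_vec []"
  unfolding start4_def replicate_simps concat.simps append.simps
  by (simp only: look_table_dom4 eval_simps cong: eval_congs sum_map_cong if_weak_cong)

lemma bound_dom4: "ereal 1.875 \<le> c_dom_lim 4"
  by (rule bound_from_certificate(2)[OF reaches_start4 reaches_main4 reaches_fin4 _ _ _ start_dom4 cert_dom4])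
    (simp_all add: fin4_def main4_def replicate_simps get_V)

section \<open>Certificates for degree 5\<close>

definition table_conn5 :: trie where "table_conn5 =
Nd 0 (nd 0 0 0 0 (nd 0 0 0 0 (nd 0 1 0 0 (lf 1 6 1 4858 Tip) (lf 1 7 1 10000 Tip)) Tip) (nd 0 0 1 0
(nd 0 0 0 0 (nd 0 1 0 0 (lf 1 6 0 4519 Tip) (lf 1 7 0 9540 Tip)) Tip) (nd 0 1 0 0 (nd 0 0 0 0 (nd 0
1 0 0 (lf 1 5 1 4691 Tip) (nd 0 2 0 0 (lf 1 4 1 5483 Tip) (nd 0 3 0 0 (lf 1 3 1 6328 Tip) (nd 0 4 0
0 (lf 1 2 1 7004 Tip) (nd 0 5 0 0 (lf 1 1 1 7436 Tip) (lf 1 6 1 9671 Tip)))))) Tip) (nd 0 1 1 0 (nd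
0 0 0 0 (nd 0 1 0 0 (lf 1 5 0 4251 Tip) (nd 0 2 0 0 (lf 1 4 0 6007 Tip) (nd 0 3 0 0 (lf 1 3 0 6990
Tip) (nd 0 4 0 0 (lf 1 2 0 7292 Tip) (nd 0 6 0 0 (lf 1 0 0 6345 Tip) (lf 1 6 0 9100 Tip)))))) Tip)
(nd 0 2 0 0 (nd 0 0 0 0 (nd 0 1 0 0 (nd 0 3 0 0 (lf 1 1 1 2759 Tip) (lf 1 4 1 4538 Tip)) (nd 0 2 0 0
(lf 1 3 1 6201 Tip) (nd 0 3 0 0 (lf 1 2 1 7208 Tip) (nd 0 4 0 0 (lf 1 1 1 7705 Tip) (nd 0 5 0 0 (lf
1 0 1 7903 Tip) (lf 1 5 1 9337 Tip)))))) Tip) (nd 0 2 1 0 (nd 0 0 0 0 (nd 0 1 0 0 (nd 0 1 0 0 (lf 1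
3 0 1613 Tip) (nd 0 2 0 0 (lf 1 2 0 2324 Tip) (nd 0 4 0 0 (lf 1 0 0 2847 Tip) (lf 1 4 0 4119 Tip))))
(nd 0 2 0 0 (nd 0 3 0 0 (lf 1 0 0 3630 Tip) (lf 1 3 0 5892 Tip)) (nd 0 3 0 0 (lf 1 2 0 6618 Tip) (nd
0 4 0 0 (lf 1 1 0 6708 Tip) (nd 0 5 0 0 (lf 1 0 0 6203 Tip) (lf 1 5 0 8661 Tip)))))) Tip) (nd 0 3 0
0 (nd 0 0 0 0 (nd 0 1 0 0 (nd 0 1 0 0 (lf 1 2 1 1606 Tip) (nd 0 2 0 0 (lf 1 1 1 2483 Tip) (nd 0 3 0
0 (lf 1 0 1 3009 Tip) (lf 1 3 1 4386 Tip)))) (nd 0 2 0 0 (lf 1 2 1 6317 Tip) (nd 0 3 0 0 (lf 1 1 1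
7257 Tip) (nd 0 4 0 0 (lf 1 0 1 7651 Tip) (lf 1 4 1 8991 Tip))))) Tip) (nd 0 3 1 0 (nd 0 0 0 0 (nd 0
1 0 0 (nd 0 1 0 0 (nd 0 2 0 0 (lf 1 0 0 884 Tip) (lf 1 2 0 1667 Tip)) (nd 0 2 0 0 (lf 1 1 0 2371
Tip) (nd 0 3 0 0 (lf 1 0 0 2677 Tip) (lf 1 3 0 3943 Tip)))) (nd 0 2 0 0 (nd 0 2 0 0 (lf 1 0 0 3111
Tip) (lf 1 2 0 5564 Tip)) (nd 0 3 0 0 (lf 1 1 0 6074 Tip) (nd 0 4 0 0 (lf 1 0 0 5885 Tip) (lf 1 4 0
8200 Tip))))) Tip) (nd 0 4 0 0 (nd 0 0 0 0 (nd 0 1 0 0 (nd 0 1 0 0 (lf 1 1 1 1799 Tip) (nd 0 2 0 0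
(lf 1 0 1 2656 Tip) (lf 1 2 1 4224 Tip))) (nd 0 2 0 0 (lf 1 1 1 6092 Tip) (nd 0 3 0 0 (lf 1 0 1 6910
Tip) (lf 1 3 1 8622 Tip)))) Tip) (nd 0 4 1 0 (nd 0 0 0 0 (nd 0 1 0 0 (nd 0 1 0 0 (nd 0 1 0 0 (lf 1 0
0 589 Tip) (lf 1 1 0 1656 Tip)) (nd 0 2 0 0 (lf 1 0 0 2268 Tip) (lf 1 2 0 3685 Tip))) (nd 0 2 0 0
(lf 1 1 0 5072 Tip) (nd 0 3 0 0 (lf 1 0 0 5307 Tip) (lf 1 3 0 7686 Tip)))) Tip) (nd 0 5 0 0 (nd 0 0
0 0 (nd 0 1 0 0 (nd 0 1 0 0 (lf 1 0 1 1862 Tip) (lf 1 1 1 4041 Tip)) (nd 0 2 0 0 (lf 1 0 1 5788 Tip)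
(lf 1 2 1 8219 Tip))) Tip) (nd 0 5 1 0 (nd 0 0 0 0 (nd 0 1 0 0 (nd 0 1 0 0 (lf 1 0 0 1509 Tip) (lf 1
1 0 3358 Tip)) (nd 0 2 0 0 (lf 1 0 0 4428 Tip) (lf 1 2 0 7082 Tip))) Tip) (nd 0 6 0 0 (nd 0 0 0 0
(nd 0 1 0 0 (lf 1 0 1 3822 Tip) (lf 1 1 1 7766 Tip)) Tip) (nd 0 6 1 0 (nd 0 0 0 0 (nd 0 1 0 0 (lf 1
0 0 2926 Tip) (lf 1 1 0 6335 Tip)) Tip) (nd 0 7 0 0 (nd 0 0 0 0 (lf 1 0 1 7245 Tip) Tip) (nd 0 7 1 0
(nd 0 0 0 0 (lf 1 0 0 5352 Tip) Tip) (nd 1 0 0 0 (nd 0 0 0 0 (nd 0 1 0 0 (lf 0 6 1 4519 Tip) (lf 0 7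
1 9540 Tip)) Tip) (nd 1 0 1 0 (nd 0 0 0 0 (nd 0 1 0 0 (lf 0 6 0 4236 Tip) (lf 0 7 0 9069 Tip)) Tip)
(nd 1 1 0 0 (nd 0 0 0 0 (nd 0 0 1 0 (lf 0 6 0 6344 Tip) (nd 0 1 0 0 (lf 0 5 1 4251 Tip) (nd 0 2 0 0
(lf 0 4 1 6007 Tip) (nd 0 2 1 0 (lf 0 4 0 7292 Tip) (nd 0 3 0 0 (lf 0 3 1 6990 Tip) (lf 0 6 1 9100
Tip)))))) Tip) (nd 1 1 1 0 (nd 0 0 0 0 (nd 0 1 0 0 (lf 0 5 0 3984 Tip) (nd 0 2 0 0 (lf 0 4 0 5626
Tip) (nd 0 3 0 0 (lf 0 3 0 6087 Tip) (lf 0 6 0 8521 Tip)))) Tip) (nd 1 2 0 0 (nd 0 0 0 0 (nd 0 0 1 0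
(nd 0 1 0 0 (lf 0 4 0 2706 Tip) (nd 0 2 0 0 (lf 0 3 0 3632 Tip) (lf 0 5 0 6193 Tip))) (nd 0 1 0 0
(nd 0 1 0 0 (lf 0 3 1 1607 Tip) (nd 0 1 1 0 (lf 0 3 0 2751 Tip) (nd 0 2 0 0 (lf 0 2 1 2389 Tip) (lf
0 4 1 4112 Tip)))) (nd 0 1 1 0 (lf 0 4 0 6706 Tip) (nd 0 2 0 0 (lf 0 3 1 5889 Tip) (nd 0 2 1 0 (lf 0
3 0 6618 Tip) (lf 0 5 1 8661 Tip)))))) Tip) (nd 1 2 1 0 (nd 0 0 0 0 (nd 0 1 0 0 (nd 0 1 0 0 (lf 0 3
0 1499 Tip) (nd 0 2 0 0 (lf 0 2 0 1811 Tip) (lf 0 4 0 3639 Tip))) (nd 0 2 0 0 (lf 0 3 0 4967 Tip)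
(lf 0 5 0 7936 Tip))) Tip) (nd 1 3 0 0 (nd 0 0 0 0 (nd 0 0 1 0 (nd 0 1 0 0 (nd 0 1 0 0 (lf 0 2 0 884
Tip) (lf 0 3 0 2573 Tip)) (nd 0 2 0 0 (lf 0 2 0 3112 Tip) (lf 0 4 0 5871 Tip))) (nd 0 1 0 0 (nd 0 1
0 0 (lf 0 2 1 1664 Tip) (nd 0 1 1 0 (lf 0 2 0 2370 Tip) (lf 0 3 1 3932 Tip))) (nd 0 1 1 0 (lf 0 3 0
6072 Tip) (nd 0 2 0 0 (lf 0 2 1 5560 Tip) (lf 0 4 1 8199 Tip))))) Tip) (nd 1 3 1 0 (nd 0 0 0 0 (nd 0
1 0 0 (nd 0 1 0 0 (lf 0 2 0 1255 Tip) (lf 0 3 0 3278 Tip)) (nd 0 2 0 0 (lf 0 2 0 3999 Tip) (lf 0 4 0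
7269 Tip))) Tip) (nd 1 4 0 0 (nd 0 0 0 0 (nd 0 0 1 0 (nd 0 1 0 0 (nd 0 1 0 0 (lf 0 1 0 589 Tip) (lf
0 2 0 2268 Tip)) (lf 0 3 0 5299 Tip)) (nd 0 1 0 0 (nd 0 1 0 0 (lf 0 1 1 1657 Tip) (lf 0 2 1 3679
Tip)) (nd 0 1 1 0 (lf 0 2 0 5073 Tip) (lf 0 3 1 7685 Tip)))) Tip) (nd 1 4 1 0 (nd 0 0 0 0 (nd 0 1 0
0 (nd 0 1 0 0 (lf 0 1 0 796 Tip) (lf 0 2 0 2704 Tip)) (lf 0 3 0 6428 Tip)) Tip) (nd 1 5 0 0 (nd 0 0
0 0 (nd 0 0 1 0 (nd 0 1 0 0 (lf 0 1 0 1509 Tip) (lf 0 2 0 4428 Tip)) (nd 0 1 0 0 (lf 0 1 1 3358 Tip)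
(lf 0 2 1 7081 Tip))) Tip) (nd 1 5 1 0 (nd 0 0 0 0 (nd 0 1 0 0 (lf 0 1 0 1762 Tip) (lf 0 2 0 5256
Tip)) Tip) (nd 1 6 0 0 (nd 0 0 0 0 (nd 0 0 1 0 (lf 0 1 0 2926 Tip) (lf 0 1 1 6335 Tip)) Tip) (nd 1 6
1 0 (nd 0 0 0 0 (lf 0 1 0 3389 Tip) Tip) (nd 1 7 0 0 (nd 0 0 0 0 (lf 0 0 1 5352 Tip) Tip)
Tip)))))))))))))))))))))))))))))))"

lemmas look_table_conn5 = arg_cong[where f = look, OF table_conn5_def, THEN fun_cong, unfolded small_nats]

lemma cert_conn5: "cert_ok False 160196778 1000000 main5 table_conn5"
  unfolding cert_ok_def main5_def
  apply (subst (2) table_conn5_def)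
  unfolding small_nats
  by (simp only: look_table_conn5 eval_simps cong: eval_congs sum_map_cong all_in_congs if_weak_cong)

lemma start_conn5: "0 < W False table_conn5 start5 None zero_vec zero_vec []"
  unfolding start5_def replicate_simps concat.simps append.simps
  by (simp only: look_table_conn5 eval_simps cong: eval_congs sum_map_cong if_weak_cong)

lemma bound_conn5: "ereal 1.953 \<le> c_lim 5"
  by (rule bound_from_certificate(1)[OF reaches_start5 reaches_main5 reaches_fin5 _ _ _ start_conn5 cert_conn5])
    (simp_all add: fin5_def main5_def replicate_simps get_V)

definition table_dom5 :: trie where "table_dom5 =
Nd 0 (nd 0 0 0 0 (nd 0 0 0 0 (nd 0 1 0 0 (lf 1 6 1 5031 Tip) (nd 0 2 0 0 (lf 1 5 1 7447 Tip) (nd 0 3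
0 0 (lf 1 4 1 8596 Tip) (nd 0 4 0 0 (lf 1 3 1 9126 Tip) (lf 1 7 1 10000 Tip))))) (nd 0 1 0 0 (lf 1 6
1 5025 Tip) Tip)) (nd 0 0 1 0 (nd 0 0 0 0 (nd 0 1 0 0 (lf 1 6 0 4686 Tip) (nd 0 2 0 0 (lf 1 5 0 6893
Tip) (nd 0 3 0 0 (lf 1 4 0 7893 Tip) (nd 0 4 0 0 (lf 1 3 0 8267 Tip) (lf 1 7 0 9406 Tip))))) (nd 0 1
0 0 (lf 1 6 0 4676 Tip) Tip)) (nd 0 1 0 0 (nd 0 0 0 0 (nd 0 1 0 0 (nd 0 1 0 0 (lf 1 4 1 1916 Tip)
(nd 0 2 0 0 (lf 1 3 1 2926 Tip) (nd 0 3 0 0 (lf 1 2 1 3478 Tip) (nd 0 4 0 0 (lf 1 1 1 3796 Tip) (lf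
1 5 1 4842 Tip))))) (nd 0 2 0 0 (lf 1 4 1 7140 Tip) (nd 0 3 0 0 (lf 1 3 1 8211 Tip) (nd 0 4 0 0 (lf
1 2 1 8681 Tip) (nd 0 5 0 0 (lf 1 1 1 8519 Tip) (lf 1 6 1 9576 Tip)))))) (nd 0 1 0 0 (nd 0 1 0 0 (lf
1 4 1 1922 Tip) (nd 0 2 0 0 (lf 1 3 1 2925 Tip) (nd 0 3 0 0 (lf 1 2 1 3472 Tip) (nd 0 4 0 0 (lf 1 1
1 3792 Tip) (lf 1 5 1 4834 Tip))))) (nd 1 1 1 0 (lf 0 5 0 2226 Tip) Tip))) (nd 0 1 1 0 (nd 0 0 0 0
(nd 0 1 0 0 (nd 0 1 0 0 (lf 1 4 0 2087 Tip) (nd 0 2 0 0 (lf 1 3 0 3045 Tip) (nd 0 3 0 0 (lf 1 2 0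
3436 Tip) (nd 0 4 0 0 (lf 1 1 0 3510 Tip) (nd 0 5 0 0 (lf 1 0 0 3348 Tip) (lf 1 5 0 4439 Tip))))))
(nd 0 2 0 0 (nd 0 4 0 0 (lf 1 0 0 4612 Tip) (lf 1 4 0 6472 Tip)) (nd 0 3 0 0 (nd 0 3 0 0 (lf 1 0 0
4924 Tip) (lf 1 3 0 7334 Tip)) (nd 0 4 0 0 (lf 1 2 0 7567 Tip) (nd 0 5 0 0 (lf 1 1 0 7362 Tip) (nd 0
6 0 0 (lf 1 0 0 6721 Tip) (lf 1 6 0 8845 Tip))))))) (nd 0 1 0 0 (nd 0 1 0 0 (nd 0 4 0 0 (lf 1 0 0
1406 Tip) (lf 1 4 0 2131 Tip)) (nd 0 2 0 0 (lf 1 3 0 3019 Tip) (nd 0 3 0 0 (lf 1 2 0 3435 Tip) (nd 0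
5 0 0 (lf 1 0 0 3285 Tip) (lf 1 5 0 4424 Tip))))) (nd 1 0 0 0 (nd 0 1 0 0 (lf 0 5 0 3179 Tip) (nd 0
2 0 0 (lf 0 4 0 4383 Tip) (nd 0 3 0 0 (lf 0 3 0 4750 Tip) (lf 0 6 0 6396 Tip)))) (nd 1 1 0 0 (lf 0 5
0 3031 Tip) Tip)))) (nd 0 2 0 0 (nd 0 0 0 0 (nd 0 1 0 0 (nd 0 1 0 0 (nd 0 2 0 0 (lf 1 1 1 1269 Tip)
(lf 1 3 1 2168 Tip)) (nd 0 2 0 0 (lf 1 2 1 3218 Tip) (nd 0 3 0 0 (lf 1 1 1 3712 Tip) (nd 0 4 0 0 (lf
1 0 1 3929 Tip) (lf 1 4 1 4653 Tip))))) (nd 0 2 0 0 (nd 0 2 0 0 (lf 1 1 1 4320 Tip) (nd 0 3 0 0 (lf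
1 0 1 4837 Tip) (lf 1 3 1 6830 Tip))) (nd 0 3 0 0 (lf 1 2 1 7815 Tip) (nd 0 4 0 0 (lf 1 1 1 8218
Tip) (nd 0 5 0 0 (lf 1 0 1 7994 Tip) (lf 1 5 1 9158 Tip)))))) (nd 0 1 0 0 (nd 0 1 0 0 (nd 0 2 0 0
(lf 1 1 1 1273 Tip) (lf 1 3 1 2177 Tip)) (nd 0 2 0 0 (lf 1 2 1 3217 Tip) (nd 0 3 0 0 (lf 1 1 1 3708
Tip) (nd 0 4 0 0 (lf 1 0 1 3925 Tip) (lf 1 4 1 4644 Tip))))) (nd 0 2 0 0 (lf 1 3 1 1517 Tip) (nd 1 0
1 0 (nd 0 1 0 0 (lf 0 4 0 2348 Tip) (nd 0 2 0 0 (lf 0 3 0 3112 Tip) (lf 0 5 0 4473 Tip))) (nd 1 1 1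
0 (nd 0 1 0 0 (lf 0 3 0 1064 Tip) (lf 0 4 0 2263 Tip)) (nd 1 2 1 0 (lf 0 3 0 959 Tip) Tip)))))) (nd
0 2 1 0 (nd 0 0 0 0 (nd 0 1 0 0 (nd 0 1 0 0 (nd 0 2 0 0 (lf 1 1 0 1253 Tip) (nd 0 3 0 0 (lf 1 0 0
1363 Tip) (lf 1 3 0 2030 Tip))) (nd 0 2 0 0 (nd 0 2 0 0 (lf 1 0 0 1758 Tip) (lf 1 2 0 2917 Tip)) (nd
0 3 0 0 (lf 1 1 0 3217 Tip) (nd 0 4 0 0 (lf 1 0 0 3161 Tip) (lf 1 4 0 4195 Tip))))) (nd 0 2 0 0 (nd
0 2 0 0 (lf 1 1 0 3964 Tip) (nd 0 3 0 0 (lf 1 0 0 4199 Tip) (lf 1 3 0 6049 Tip))) (nd 0 3 0 0 (lf 1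
2 0 6746 Tip) (nd 0 4 0 0 (lf 1 1 0 6783 Tip) (nd 0 5 0 0 (lf 1 0 0 6288 Tip) (lf 1 5 0 8303
Tip)))))) (nd 0 1 0 0 (nd 0 1 0 0 (nd 0 2 0 0 (lf 1 1 0 1269 Tip) (nd 0 3 0 0 (lf 1 0 0 1385 Tip)
(lf 1 3 0 2055 Tip))) (nd 0 2 0 0 (nd 0 2 0 0 (lf 1 0 0 1784 Tip) (lf 1 2 0 2919 Tip)) (nd 0 3 0 0
(lf 1 1 0 3217 Tip) (nd 0 4 0 0 (lf 1 0 0 3138 Tip) (lf 1 4 0 4182 Tip))))) (nd 0 2 0 0 (nd 0 3 0 0
(lf 1 0 0 1243 Tip) (lf 1 3 0 1876 Tip)) (nd 1 0 0 0 (nd 0 1 0 0 (nd 0 1 0 0 (lf 0 3 0 1350 Tip) (nd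
0 2 0 0 (lf 0 2 0 1736 Tip) (lf 0 4 0 3009 Tip))) (nd 0 2 0 0 (lf 0 3 0 4075 Tip) (lf 0 5 0 5928
Tip))) (nd 1 1 0 0 (nd 0 1 0 0 (lf 0 3 0 1331 Tip) (nd 0 2 0 0 (lf 0 2 0 1647 Tip) (lf 0 4 0 2949
Tip))) (nd 1 2 0 0 (lf 0 3 0 1246 Tip) Tip)))))) (nd 0 3 0 0 (nd 0 0 0 0 (nd 0 1 0 0 (nd 0 1 0 0 (nd
0 1 0 0 (lf 1 1 1 805 Tip) (nd 0 2 0 0 (lf 1 0 1 1268 Tip) (lf 1 2 1 2210 Tip))) (nd 0 2 0 0 (lf 1 1
1 3242 Tip) (nd 0 3 0 0 (lf 1 0 1 3700 Tip) (lf 1 3 1 4461 Tip)))) (nd 0 2 0 0 (nd 0 2 0 0 (lf 1 0 1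
4088 Tip) (lf 1 2 1 6509 Tip)) (nd 0 3 0 0 (lf 1 1 1 7400 Tip) (nd 0 4 0 0 (lf 1 0 1 7723 Tip) (lf 1
4 1 8742 Tip))))) (nd 0 1 0 0 (nd 0 1 0 0 (nd 0 1 0 0 (lf 1 1 1 808 Tip) (nd 0 2 0 0 (lf 1 0 1 1271
Tip) (lf 1 2 1 2220 Tip))) (nd 0 2 0 0 (lf 1 1 1 3243 Tip) (nd 0 3 0 0 (lf 1 0 1 3699 Tip) (lf 1 3 1
4453 Tip)))) (nd 0 2 0 0 (nd 0 1 0 0 (lf 1 1 1 771 Tip) (lf 1 2 1 1818 Tip)) (nd 1 0 1 0 (nd 0 1 0 0
(lf 0 3 0 2155 Tip) (nd 0 2 0 0 (lf 0 2 0 2689 Tip) (lf 0 4 0 4276 Tip))) (nd 1 1 1 0 (nd 0 1 0 0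
(lf 0 2 0 992 Tip) (lf 0 3 0 2107 Tip)) (nd 1 2 1 0 (lf 0 2 0 817 Tip) Tip)))))) (nd 0 3 1 0 (nd 0 0
0 0 (nd 0 1 0 0 (nd 0 1 0 0 (nd 0 1 0 0 (lf 1 1 0 800 Tip) (nd 0 2 0 0 (lf 1 0 0 1214 Tip) (lf 1 2 0
1955 Tip))) (nd 0 2 0 0 (lf 1 1 0 2740 Tip) (nd 0 3 0 0 (lf 1 0 0 2895 Tip) (lf 1 3 0 3941 Tip))))
(nd 0 2 0 0 (nd 0 2 0 0 (lf 1 0 0 3654 Tip) (lf 1 2 0 5590 Tip)) (nd 0 3 0 0 (lf 1 1 0 6073 Tip) (nd
0 4 0 0 (lf 1 0 0 5818 Tip) (lf 1 4 0 7765 Tip))))) (nd 0 1 0 0 (nd 0 1 0 0 (nd 0 1 0 0 (nd 0 1 0 0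
(lf 1 0 0 368 Tip) (lf 1 1 0 828 Tip)) (nd 0 2 0 0 (lf 1 0 0 1266 Tip) (lf 1 2 0 1961 Tip))) (nd 0 2
0 0 (lf 1 1 0 2743 Tip) (nd 0 3 0 0 (lf 1 0 0 2900 Tip) (lf 1 3 0 3930 Tip)))) (nd 0 2 0 0 (nd 0 1 0
0 (nd 0 1 0 0 (lf 1 0 0 370 Tip) (lf 1 1 0 789 Tip)) (nd 0 2 0 0 (lf 1 0 0 1100 Tip) (lf 1 2 0 1858
Tip))) (nd 1 0 0 0 (nd 0 1 0 0 (nd 0 1 0 0 (lf 0 2 0 1204 Tip) (lf 0 3 0 2724 Tip)) (nd 0 2 0 0 (lf
0 2 0 3376 Tip) (lf 0 4 0 5433 Tip))) (nd 1 1 0 0 (nd 0 1 0 0 (nd 0 1 0 0 (lf 0 1 0 383 Tip) (lf 0 2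
0 1176 Tip)) (lf 0 3 0 2677 Tip)) (nd 1 2 0 0 (lf 0 2 0 1048 Tip) Tip)))))) (nd 0 4 0 0 (nd 0 0 0 0
(nd 0 1 0 0 (nd 0 1 0 0 (nd 0 1 0 0 (lf 1 0 1 794 Tip) (lf 1 1 1 2140 Tip)) (nd 0 2 0 0 (lf 1 0 1
3104 Tip) (lf 1 2 1 4260 Tip))) (nd 0 2 0 0 (lf 1 1 1 6170 Tip) (nd 0 3 0 0 (lf 1 0 1 6952 Tip) (lf
1 3 1 8320 Tip)))) (nd 0 1 0 0 (nd 0 1 0 0 (nd 0 1 0 0 (lf 1 0 1 795 Tip) (lf 1 1 1 2148 Tip)) (nd 0
2 0 0 (lf 1 0 1 3108 Tip) (lf 1 2 1 4253 Tip))) (nd 0 2 0 0 (lf 1 1 1 2028 Tip) (nd 1 0 1 0 (nd 0 1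
0 0 (lf 0 2 0 1844 Tip) (lf 0 3 0 3887 Tip)) (nd 1 1 1 0 (nd 0 1 0 0 (lf 0 1 0 700 Tip) (lf 0 2 0
1805 Tip)) (nd 1 2 1 0 (lf 0 1 0 535 Tip) Tip)))))) (nd 0 4 1 0 (nd 0 0 0 0 (nd 0 1 0 0 (nd 0 1 0 0
(nd 0 1 0 0 (lf 1 0 0 798 Tip) (lf 1 1 0 1812 Tip)) (nd 0 2 0 0 (lf 1 0 0 2440 Tip) (lf 1 2 0 3658
Tip))) (nd 0 2 0 0 (lf 1 1 0 5052 Tip) (nd 0 3 0 0 (lf 1 0 0 5228 Tip) (lf 1 3 0 7212 Tip)))) (nd 0
1 0 0 (nd 0 1 0 0 (nd 0 1 0 0 (lf 1 0 0 862 Tip) (lf 1 1 0 1819 Tip)) (nd 0 2 0 0 (lf 1 0 0 2448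
Tip) (lf 1 2 0 3649 Tip))) (nd 0 2 0 0 (nd 0 1 0 0 (lf 1 0 0 820 Tip) (lf 1 1 0 1740 Tip)) (nd 1 0 0
0 (nd 0 1 0 0 (nd 0 1 0 0 (lf 0 1 0 793 Tip) (lf 0 2 0 2284 Tip)) (lf 0 3 0 4835 Tip)) (nd 1 1 0 0
(nd 0 1 0 0 (lf 0 1 0 797 Tip) (lf 0 2 0 2239 Tip)) (nd 1 2 0 0 (lf 0 1 0 679 Tip) Tip)))))) (nd 0 5
0 0 (nd 0 0 0 0 (nd 0 1 0 0 (nd 0 1 0 0 (lf 1 0 1 2054 Tip) (lf 1 1 1 4046 Tip)) (nd 0 2 0 0 (lf 1 0
1 5800 Tip) (lf 1 2 1 7882 Tip))) (nd 0 1 0 0 (nd 0 1 0 0 (lf 1 0 1 2062 Tip) (lf 1 1 1 4039 Tip))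
(nd 0 2 0 0 (lf 1 0 1 1971 Tip) (nd 1 0 1 0 (nd 0 1 0 0 (lf 0 1 0 1253 Tip) (lf 0 2 0 3265 Tip)) (nd
1 1 1 0 (lf 0 1 0 1240 Tip) Tip))))) (nd 0 5 1 0 (nd 0 0 0 0 (nd 0 1 0 0 (nd 0 1 0 0 (lf 1 0 0 1619
Tip) (lf 1 1 0 3320 Tip)) (nd 0 2 0 0 (lf 1 0 0 4367 Tip) (lf 1 2 0 6609 Tip))) (nd 0 1 0 0 (nd 0 1
0 0 (lf 1 0 0 1629 Tip) (lf 1 1 0 3312 Tip)) (nd 0 2 0 0 (lf 1 0 0 1583 Tip) (nd 1 0 0 0 (nd 0 1 0 0
(lf 0 1 0 1517 Tip) (lf 0 2 0 4006 Tip)) (nd 1 1 0 0 (lf 0 1 0 1491 Tip) Tip))))) (nd 0 6 0 0 (nd 0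
0 0 0 (nd 0 1 0 0 (lf 1 0 1 3810 Tip) (lf 1 1 1 7412 Tip)) (nd 0 1 0 0 (lf 1 0 1 3804 Tip) (nd 1 0 1
0 (lf 0 1 0 2185 Tip) Tip))) (nd 0 6 1 0 (nd 0 0 0 0 (nd 0 1 0 0 (lf 1 0 0 2889 Tip) (lf 1 1 0 5903
Tip)) (nd 0 1 0 0 (lf 1 0 0 2883 Tip) (nd 1 0 0 0 (lf 0 1 0 2638 Tip) Tip))) (nd 0 7 0 0 (nd 0 0 0 0
(lf 1 0 1 6894 Tip) Tip) (nd 0 7 1 0 (nd 0 0 0 0 (lf 1 0 0 5006 Tip) Tip) (nd 1 0 0 0 (nd 0 0 0 0
(nd 0 1 0 0 (lf 0 6 1 4686 Tip) (nd 0 2 0 0 (lf 0 5 1 6893 Tip) (nd 0 3 0 0 (lf 0 4 1 7893 Tip) (nd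
0 3 1 0 (lf 0 4 0 8267 Tip) (lf 0 7 1 9406 Tip))))) (nd 0 1 0 0 (lf 0 6 1 4676 Tip) Tip)) (nd 1 0 1
0 (nd 0 0 0 0 (nd 0 1 0 0 (lf 0 6 0 4348 Tip) (nd 0 2 0 0 (lf 0 5 0 6310 Tip) (nd 0 3 0 0 (lf 0 4 0
7070 Tip) (lf 0 7 0 8826 Tip)))) (nd 0 1 0 0 (lf 0 6 0 4339 Tip) Tip)) (nd 1 1 0 0 (nd 0 0 0 0 (nd 0
0 1 0 (nd 0 1 0 0 (lf 0 5 0 3348 Tip) (nd 0 2 0 0 (lf 0 4 0 4612 Tip) (nd 0 3 0 0 (lf 0 3 0 4924
Tip) (lf 0 6 0 6721 Tip)))) (nd 0 1 0 0 (nd 0 1 0 0 (lf 0 4 1 2087 Tip) (nd 0 1 1 0 (lf 0 4 0 3510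
Tip) (nd 0 2 0 0 (lf 0 3 1 3045 Tip) (nd 0 2 1 0 (lf 0 3 0 3436 Tip) (lf 0 5 1 4439 Tip))))) (nd 0 1
1 0 (lf 0 5 0 7362 Tip) (nd 0 2 0 0 (lf 0 4 1 6472 Tip) (nd 0 2 1 0 (lf 0 4 0 7567 Tip) (nd 0 3 0 0
(lf 0 3 1 7334 Tip) (lf 0 6 1 8845 Tip))))))) (nd 0 0 1 0 (nd 0 1 0 0 (lf 0 5 0 3179 Tip) (nd 0 2 0
0 (lf 0 4 0 4383 Tip) (nd 0 3 0 0 (lf 0 3 0 4750 Tip) (lf 0 6 0 6396 Tip)))) (nd 0 1 0 0 (nd 0 0 1 0
(nd 0 1 0 0 (lf 0 4 0 1406 Tip) (lf 0 5 0 3285 Tip)) (nd 0 1 0 0 (lf 0 4 1 2131 Tip) (nd 0 2 0 0 (lf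
0 3 1 3019 Tip) (nd 0 2 1 0 (lf 0 3 0 3435 Tip) (lf 0 5 1 4424 Tip))))) (nd 0 1 1 0 (lf 0 5 0 3031
Tip) Tip)))) (nd 1 1 1 0 (nd 0 0 0 0 (nd 0 1 0 0 (nd 0 1 0 0 (lf 0 4 0 1943 Tip) (nd 0 2 0 0 (lf 0 3
0 2676 Tip) (lf 0 5 0 4028 Tip))) (nd 0 2 0 0 (lf 0 4 0 5739 Tip) (nd 0 3 0 0 (lf 0 3 0 6207 Tip)
(lf 0 6 0 8140 Tip)))) (nd 0 1 0 0 (nd 0 1 0 0 (lf 0 4 0 1949 Tip) (nd 0 2 0 0 (lf 0 3 0 2680 Tip)
(lf 0 5 0 4017 Tip))) Tip)) (nd 1 2 0 0 (nd 0 0 0 0 (nd 0 0 1 0 (nd 0 1 0 0 (nd 0 1 0 0 (lf 0 3 0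
1363 Tip) (nd 0 2 0 0 (lf 0 2 0 1758 Tip) (lf 0 4 0 3161 Tip))) (nd 0 2 0 0 (lf 0 3 0 4199 Tip) (lf
0 5 0 6288 Tip))) (nd 0 1 0 0 (nd 0 1 0 0 (nd 0 1 1 0 (lf 0 2 0 1253 Tip) (lf 0 3 1 2030 Tip)) (nd 0
1 1 0 (lf 0 3 0 3217 Tip) (nd 0 2 0 0 (lf 0 2 1 2917 Tip) (lf 0 4 1 4195 Tip)))) (nd 0 1 1 0 (nd 0 2
0 0 (lf 0 2 0 3964 Tip) (lf 0 4 0 6783 Tip)) (nd 0 2 0 0 (lf 0 3 1 6049 Tip) (nd 0 2 1 0 (lf 0 3 0
6746 Tip) (lf 0 5 1 8303 Tip)))))) (nd 0 0 1 0 (nd 0 1 0 0 (nd 0 1 0 0 (lf 0 3 0 1350 Tip) (nd 0 2 0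
0 (lf 0 2 0 1736 Tip) (lf 0 4 0 3009 Tip))) (nd 0 2 0 0 (lf 0 3 0 4075 Tip) (lf 0 5 0 5928 Tip)))
(nd 0 1 0 0 (nd 0 0 1 0 (nd 0 1 0 0 (lf 0 3 0 1385 Tip) (nd 0 2 0 0 (lf 0 2 0 1784 Tip) (lf 0 4 0
3138 Tip))) (nd 0 1 0 0 (nd 0 1 1 0 (lf 0 2 0 1269 Tip) (lf 0 3 1 2055 Tip)) (nd 0 1 1 0 (lf 0 3 0
3217 Tip) (nd 0 2 0 0 (lf 0 2 1 2919 Tip) (lf 0 4 1 4182 Tip))))) (nd 0 1 1 0 (nd 0 1 0 0 (lf 0 3 0
1331 Tip) (nd 0 2 0 0 (lf 0 2 0 1647 Tip) (lf 0 4 0 2949 Tip))) (nd 0 2 0 0 (nd 0 0 1 0 (lf 0 3 0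
1243 Tip) (lf 0 3 1 1876 Tip)) (nd 0 2 1 0 (lf 0 3 0 1246 Tip) Tip)))))) (nd 1 2 1 0 (nd 0 0 0 0 (nd
0 1 0 0 (nd 0 1 0 0 (lf 0 3 0 1716 Tip) (nd 0 2 0 0 (lf 0 2 0 2172 Tip) (lf 0 4 0 3691 Tip))) (nd 0
2 0 0 (lf 0 3 0 5064 Tip) (lf 0 5 0 7457 Tip))) (nd 0 1 0 0 (nd 0 1 0 0 (lf 0 3 0 1737 Tip) (nd 0 2
0 0 (lf 0 2 0 2179 Tip) (lf 0 4 0 3680 Tip))) (nd 0 2 0 0 (lf 0 3 0 1658 Tip) Tip))) (nd 1 3 0 0 (nd
0 0 0 0 (nd 0 0 1 0 (nd 0 1 0 0 (nd 0 1 0 0 (lf 0 2 0 1214 Tip) (lf 0 3 0 2895 Tip)) (nd 0 2 0 0 (lf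
0 2 0 3654 Tip) (lf 0 4 0 5818 Tip))) (nd 0 1 0 0 (nd 0 1 0 0 (nd 0 1 0 0 (lf 0 1 1 800 Tip) (lf 0 2
1 1955 Tip)) (nd 0 1 1 0 (lf 0 2 0 2740 Tip) (lf 0 3 1 3941 Tip))) (nd 0 1 1 0 (lf 0 3 0 6073 Tip)
(nd 0 2 0 0 (lf 0 2 1 5590 Tip) (lf 0 4 1 7765 Tip))))) (nd 0 0 1 0 (nd 0 1 0 0 (nd 0 1 0 0 (lf 0 2
0 1204 Tip) (lf 0 3 0 2724 Tip)) (nd 0 2 0 0 (lf 0 2 0 3376 Tip) (lf 0 4 0 5433 Tip))) (nd 0 1 0 0
(nd 0 0 1 0 (nd 0 1 0 0 (nd 0 1 0 0 (lf 0 1 0 368 Tip) (lf 0 2 0 1266 Tip)) (lf 0 3 0 2900 Tip)) (nd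
0 1 0 0 (nd 0 1 0 0 (lf 0 1 1 828 Tip) (lf 0 2 1 1961 Tip)) (nd 0 1 1 0 (lf 0 2 0 2743 Tip) (lf 0 3
1 3930 Tip)))) (nd 0 1 1 0 (nd 0 1 0 0 (nd 0 1 0 0 (lf 0 1 0 383 Tip) (lf 0 2 0 1176 Tip)) (lf 0 3 0
2677 Tip)) (nd 0 2 0 0 (nd 0 0 1 0 (nd 0 1 0 0 (lf 0 1 0 370 Tip) (lf 0 2 0 1100 Tip)) (nd 0 1 0 0
(lf 0 1 1 789 Tip) (lf 0 2 1 1858 Tip))) (nd 0 2 1 0 (lf 0 2 0 1048 Tip) Tip)))))) (nd 1 3 1 0 (nd 0
0 0 0 (nd 0 1 0 0 (nd 0 1 0 0 (lf 0 2 0 1409 Tip) (lf 0 3 0 3281 Tip)) (nd 0 2 0 0 (lf 0 2 0 4147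
Tip) (lf 0 4 0 6752 Tip))) (nd 0 1 0 0 (nd 0 1 0 0 (nd 0 1 0 0 (lf 0 1 0 433 Tip) (lf 0 2 0 1457
Tip)) (lf 0 3 0 3273 Tip)) (nd 0 2 0 0 (lf 0 2 0 1361 Tip) Tip))) (nd 1 4 0 0 (nd 0 0 0 0 (nd 0 0 1
0 (nd 0 1 0 0 (nd 0 1 0 0 (lf 0 1 0 798 Tip) (lf 0 2 0 2440 Tip)) (lf 0 3 0 5228 Tip)) (nd 0 1 0 0
(nd 0 1 0 0 (lf 0 1 1 1812 Tip) (lf 0 2 1 3658 Tip)) (nd 0 1 1 0 (lf 0 2 0 5052 Tip) (lf 0 3 1 7212
Tip)))) (nd 0 0 1 0 (nd 0 1 0 0 (nd 0 1 0 0 (lf 0 1 0 793 Tip) (lf 0 2 0 2284 Tip)) (lf 0 3 0 4835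
Tip)) (nd 0 1 0 0 (nd 0 0 1 0 (nd 0 1 0 0 (lf 0 1 0 862 Tip) (lf 0 2 0 2448 Tip)) (nd 0 1 0 0 (lf 0
1 1 1819 Tip) (lf 0 2 1 3649 Tip))) (nd 0 1 1 0 (nd 0 1 0 0 (lf 0 1 0 797 Tip) (lf 0 2 0 2239 Tip))
(nd 0 2 0 0 (nd 0 0 1 0 (lf 0 1 0 820 Tip) (lf 0 1 1 1740 Tip)) (nd 0 2 1 0 (lf 0 1 0 679 Tip)
Tip)))))) (nd 1 4 1 0 (nd 0 0 0 0 (nd 0 1 0 0 (nd 0 1 0 0 (lf 0 1 0 883 Tip) (lf 0 2 0 2705 Tip))
(lf 0 3 0 5936 Tip)) (nd 0 1 0 0 (nd 0 1 0 0 (lf 0 1 0 948 Tip) (lf 0 2 0 2700 Tip)) (nd 0 2 0 0 (lf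
0 1 0 863 Tip) Tip))) (nd 1 5 0 0 (nd 0 0 0 0 (nd 0 0 1 0 (nd 0 1 0 0 (lf 0 1 0 1619 Tip) (lf 0 2 0
4367 Tip)) (nd 0 1 0 0 (lf 0 1 1 3320 Tip) (lf 0 2 1 6609 Tip))) (nd 0 0 1 0 (nd 0 1 0 0 (lf 0 1 0
1517 Tip) (lf 0 2 0 4006 Tip)) (nd 0 1 0 0 (nd 0 0 1 0 (lf 0 1 0 1629 Tip) (lf 0 1 1 3312 Tip)) (nd
0 1 1 0 (lf 0 1 0 1491 Tip) (nd 0 2 0 0 (lf 0 0 1 1583 Tip) Tip))))) (nd 1 5 1 0 (nd 0 0 0 0 (nd 0 1
0 0 (lf 0 1 0 1762 Tip) (lf 0 2 0 4849 Tip)) (nd 0 1 0 0 (lf 0 1 0 1764 Tip) Tip)) (nd 1 6 0 0 (nd 0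
0 0 0 (nd 0 0 1 0 (lf 0 1 0 2889 Tip) (lf 0 1 1 5903 Tip)) (nd 0 0 1 0 (lf 0 1 0 2638 Tip) (nd 0 1 0
0 (lf 0 0 1 2883 Tip) Tip))) (nd 1 6 1 0 (nd 0 0 0 0 (lf 0 1 0 3137 Tip) Tip) (nd 1 7 0 0 (nd 0 0 0
0 (lf 0 0 1 5006 Tip) Tip) Tip)))))))))))))))))))))))))))))))"

lemmas look_table_dom5 = arg_cong[where f = look, OF table_dom5_def, THEN fun_cong, unfolded small_nats]

lemma cert_dom5: "cert_ok True 158071200 1000000 main5 table_dom5"
  unfolding cert_ok_def main5_def
  apply (subst (2) table_dom5_def)
  unfolding small_nats
  by (simp only: look_table_dom5 eval_simps cong: eval_congs sum_map_cong all_in_congs if_weak_cong)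

lemma start_dom5: "0 < W True table_dom5 start5 None zero_vec zero_vec []"
  unfolding start5_def replicate_simps concat.simps append.simps
  by (simp only: look_table_dom5 eval_simps cong: eval_congs sum_map_cong if_weak_cong)

lemma bound_dom5: "ereal 1.940 \<le> c_dom_lim 5"
  by (rule bound_from_certificate(2)[OF reaches_start5 reaches_main5 reaches_fin5 _ _ _ start_dom5 cert_dom5])
    (simp_all add: fin5_def main5_def replicate_simps get_V)

theorem mainTheorem1:
  shows "c_lim 3 \<ge> ereal 1.792 \<and> c_lim 4 \<ge> ereal 1.897 \<and> c_lim 5 \<ge> ereal 1.953 \<and>
         c_dom_lim 3 \<ge> ereal 1.743 \<and> c_dom_lim 4 \<ge> ereal 1.875 \<and> c_dom_lim 5 \<ge> ereal 1.940"
  by (intro conjI bound_conn3 bound_conn4 bound_conn5 bound_dom3 bound_dom4 bound_dom5)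

end
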